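(* A continuous plurisubharmonic function $u$ on a strongly pseudoconvex domain $D$ in $\mathbb C^n$ is maximal if and only if through every point $z\in D$ passes the cluster of a perfect leaf $L$ (that is, $z\in\operatorname{cl}L$) such that: (1) $u$ is maximal on $\operatorname{cl}L$; (2) $\operatorname{supp}L\subset\partial D$.
   Context: A plurisubharmonic function $u$ on a domain $D\subset\mathbb C^n$ is maximal if for every domain $G\Subset D$ and every plurisubharmonic function $v$ on $D$ the inequality $v\le u$ on $\partial G$ implies $v\le u$ on $G$. $U=\{\zeta\in\mathbb C:|\zeta|<1\}$, $S=\partial U$, and $B(a,r)$ is the open ball in $\mathbb C^n$. For an open set $E\subset U$, the harmonic measure $\omega(\cdot,E,U)$ is the infimum of all positive superharmonic functions on $U$ that are continuous and greater than $1$ on $E$. A bounded holomorphic map $f:U\to\mathbb C^n$ is extended to almost every point of $S$ by radial limits, and $\mu(E,f)=\frac1{2\pi}m(f^{-1}(E)\cap S)$ ($m$ arc length) is its holomorphic measure on $\mathbb C^n$. A leaf is a uniformly bounded sequence $L=\{f_j\}$ of holomorphic maps $U\to\mathbb C^n$ such that $\mu(dz,f_j)$ converges weakly to a measure, denoted $\mu(dz,L)$; $\operatorname{supp}L$ is the support of $\mu(dz,L)$. The cluster $\operatorname{cl}L$ is the set of all limits $\lim_k f_{j_k}(\zeta_{j_k})$ along subsequences, with $\zeta_{j_k}\in U$. A point $z\in\operatorname{cl}L$ is nonessential if for some $r>0$ one has $\lim_{j\to\infty}\omega(0,f_j^{-1}(B(z,r)),U)=0$, and essential otherwise. A leaf is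 perfect if all points of its cluster are essential. For a leaf $L$ with $\operatorname{supp}L\subset\partial D$, an upper semicontinuous function $u$ is maximal on $\operatorname{cl}L$ if for all domains $G\Subset H\Subset D$ and every plurisubharmonic (resp. plurisuperharmonic) function $v$ on $H$, the inequality $u\ge v$ (resp. $u\le v$) on $\operatorname{cl}L\cap\partial G$ implies $u\ge v$ (resp. $u\le v$) on $\operatorname{cl}L\cap G$. (Only the values of $u$ on $\operatorname{cl}L\cap D$ enter.) *)

theory Defs
  imports "HOL-Complex_Analysis.Complex_Analysis"
begin

section \<open>Domains\<close>

definition domain_set :: "'a::topological_space set \<Rightarrow> bool" where
  "domain_set D \<longleftrightarrow> open D \<and> connected D \<and> D \<noteq> {}"

definition rel_compact_in :: "'a::topological_space set \<Rightarrow> 'a set \<Rightarrow> bool"  (infix \<open>\<subset>\<subset>\<close> 50) where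
  "G \<subset>\<subset> D \<longleftrightarrow> compact (closure G) \<and> closure G \<subseteq> D"

section \<open>Subharmonic and plurisubharmonic functions\<close>

text \<open>
  These functions take values in \<open>[-\<infinity>, \<infinity>)\<close>; the constant \<open>-\<infinity>\<close> is allowed.
  Only the values on the given open set matter.
\<close>

definition usc_on :: "'a::topological_space set \<Rightarrow> ('a \<Rightarrow> ereal) \<Rightarrow> bool" where
  "usc_on S u \<longleftrightarrow> (\<forall>c. openin (top_of_set S) {x \<in> S. u x < c})"

text \<open>Normalised arc length on the unit circle, in the parameter \<open>t \<mapsto> cis t\<close>.\<close>

definition circle_prob :: "real measure" where
  "circle_prob = uniform_measure lborel {0..2 * pi}"

text \<open>
  The mean value over a circle as the extended Lebesgue integral, positive part minus
  negative part (\<open>e2ennreal\<close> sends negative numbers to 0). For an upper semicontinuous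
  function with values below \<open>\<infinity>\<close> the positive part is finite, so that the undefined
  form \<open>\<infinity> - \<infinity>\<close> does not arise.
\<close>

definition circle_mean :: "(complex \<Rightarrow> ereal) \<Rightarrow> complex \<Rightarrow> real \<Rightarrow> ereal" where
  "circle_mean u a r =
     enn2ereal (\<integral>\<^sup>+ t. e2ennreal (u (a + of_real r * cis t)) \<partial>circle_prob)
   - enn2ereal (\<integral>\<^sup>+ t. e2ennreal (- u (a + of_real r * cis t)) \<partial>circle_prob)"

definition subharmonic_on :: "complex set \<Rightarrow> (complex \<Rightarrow> ereal) \<Rightarrow> bool" where
  "subharmonic_on \<Omega> u \<longleftrightarrow>
     usc_on \<Omega> u \<and> (\<forall>z\<in>\<Omega>. u z < \<infinity>) \<and>
     (\<forall>a r. 0 < r \<and> cball a r \<subseteq> \<Omega> \<longrightarrow> u a \<le> circle_mean u a r)"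

definition superharmonic_on :: "complex set \<Rightarrow> (complex \<Rightarrow> ereal) \<Rightarrow> bool" where
  "superharmonic_on \<Omega> u \<longleftrightarrow> subharmonic_on \<Omega> (\<lambda>z. - u z)"

definition psh_on :: "(complex ^ 'n) set \<Rightarrow> (complex ^ 'n \<Rightarrow> ereal) \<Rightarrow> bool" where
  "psh_on D u \<longleftrightarrow>
     usc_on D u \<and> (\<forall>z\<in>D. u z < \<infinity>) \<and>
     (\<forall>a b. subharmonic_on {\<zeta>. a + \<zeta> *s b \<in> D} (\<lambda>\<zeta>. u (a + \<zeta> *s b)))"

definition plurisuperharmonic_on :: "(complex ^ 'n) set \<Rightarrow> (complex ^ 'n \<Rightarrow> ereal) \<Rightarrow> bool" where
  "plurisuperharmonic_on D u \<longleftrightarrow> psh_on D (\<lambda>z. - u z)"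

definition maximal_psh_on :: "(complex ^ 'n) set \<Rightarrow> (complex ^ 'n \<Rightarrow> ereal) \<Rightarrow> bool" where
  "maximal_psh_on D u \<longleftrightarrow>
     psh_on D u \<and>
     (\<forall>G v. domain_set G \<and> G \<subset>\<subset> D \<and> psh_on D v \<and> (\<forall>z\<in>frontier G. v z \<le> u z)
        \<longrightarrow> (\<forall>z\<in>G. v z \<le> u z))"

section \<open>Strongly pseudoconvex domains\<close>

definition C2_on ::
  "'a::real_normed_vector set \<Rightarrow> ('a \<Rightarrow> real) \<Rightarrow> ('a \<Rightarrow> 'a \<Rightarrow>\<^sub>L real) \<Rightarrow> ('a \<Rightarrow> 'a \<Rightarrow>\<^sub>L 'a \<Rightarrow>\<^sub>L real) \<Rightarrow> bool"
where
  "C2_on V \<rho> \<rho>' \<rho>'' \<longleftrightarrow>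
     (\<forall>x\<in>V. (\<rho> has_derivative blinfun_apply (\<rho>' x)) (at x)) \<and>
     (\<forall>x\<in>V. (\<rho>' has_derivative blinfun_apply (\<rho>'' x)) (at x)) \<and>
     continuous_on V \<rho>''"

text \<open>
  With \<open>l\<close> the real differential of \<open>\<rho>\<close> at a point, the Wirtinger derivative
  \<open>\<partial>\<rho>/\<partial>z\<^sub>j = (\<partial>\<rho>/\<partial>x\<^sub>j - i \<partial>\<rho>/\<partial>y\<^sub>j) / 2\<close>.
\<close>

definition wirtinger :: "((complex ^ 'n) \<Rightarrow>\<^sub>L real) \<Rightarrow> 'n \<Rightarrow> complex" where
  "wirtinger l j = (of_real (l (axis j 1)) - \<i> * of_real (l (axis j \<i>))) / 2"

text \<open>
  With \<open>B\<close> the real second differential of \<open>\<rho>\<close> at a point, the mixed derivative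
  \<open>\<partial>\<^sup>2\<rho>/\<partial>z\<^sub>j\<partial>\<zeta>\<^sub>k = ((\<partial>/\<partial>x\<^sub>j - i \<partial>/\<partial>y\<^sub>j) (\<partial>/\<partial>x\<^sub>k + i \<partial>/\<partial>y\<^sub>k) \<rho>) / 4\<close>, where
  \<open>\<zeta>\<^sub>k\<close> is the complex conjugate of \<open>z\<^sub>k\<close>.
\<close>

definition wirtinger2 :: "((complex ^ 'n) \<Rightarrow>\<^sub>L (complex ^ 'n) \<Rightarrow>\<^sub>L real) \<Rightarrow> 'n \<Rightarrow> 'n \<Rightarrow> complex" where
  "wirtinger2 B j k =
     (of_real (B (axis j 1) (axis k 1) + B (axis j \<i>) (axis k \<i>))
      + \<i> * of_real (B (axis j 1) (axis k \<i>) - B (axis j \<i>) (axis k 1))) / 4"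

text \<open>The sum below is real when \<open>B\<close> is symmetric, as second differentials are.\<close>

definition levi_form :: "((complex ^ 'n) \<Rightarrow>\<^sub>L (complex ^ 'n) \<Rightarrow>\<^sub>L real) \<Rightarrow> complex ^ 'n \<Rightarrow> real" where
  "levi_form B w = Re (\<Sum>j\<in>UNIV. \<Sum>k\<in>UNIV. wirtinger2 B j k * (w $ j) * cnj (w $ k))"

text \<open>
  A bounded domain with a \<open>C\<^sup>2\<close> boundary whose Levi form is positive definite on the
  complex tangent space at each boundary point.
\<close>

definition strongly_pseudoconvex :: "(complex ^ 'n) set \<Rightarrow> bool" where
  "strongly_pseudoconvex D \<longleftrightarrow>
     domain_set D \<and> bounded D \<and>
     (\<exists>V \<rho> \<rho>' \<rho>''.
        open V \<and> frontier D \<subseteq> V \<and> C2_on V \<rho> \<rho>' \<rho>'' \<and>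
        D \<inter> V = {z \<in> V. \<rho> z < 0} \<and>
        (\<forall>p\<in>frontier D. \<rho>' p \<noteq> 0 \<and>
           (\<forall>w. w \<noteq> 0 \<and> (\<Sum>j\<in>UNIV. wirtinger (\<rho>' p) j * (w $ j)) = 0
              \<longrightarrow> 0 < levi_form (\<rho>'' p) w)))"

section \<open>Harmonic and holomorphic measure\<close>

abbreviation unit_disc :: "complex set"  (\<open>\<U>\<close>) where
  "\<U> \<equiv> ball 0 1"

definition harmonic_measure :: "complex \<Rightarrow> complex set \<Rightarrow> ereal" where
  "harmonic_measure \<zeta> E =
     Inf {v \<zeta> | v. superharmonic_on \<U> v \<and> (\<forall>z\<in>\<U>. 0 < v z) \<and>
                   continuous_on E v \<and> (\<forall>z\<in>E. 1 < v z)}"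

definition holomorphic_map :: "(complex \<Rightarrow> complex ^ 'n) \<Rightarrow> bool" where
  "holomorphic_map f \<longleftrightarrow> (\<forall>i. (\<lambda>\<zeta>. f \<zeta> $ i) holomorphic_on \<U>)"

text \<open>
  For bounded holomorphic \<open>f\<close> the limit exists for almost every \<open>\<zeta>\<close> on the unit circle;
  where it does not exist, \<open>Lim\<close> is a constant that does not depend on \<open>\<zeta>\<close>.
\<close>

definition radial_limit :: "(complex \<Rightarrow> complex ^ 'n) \<Rightarrow> complex \<Rightarrow> complex ^ 'n" where
  "radial_limit f \<zeta> = Lim (at_left (1::real)) (\<lambda>r. f (of_real r * \<zeta>))"

definition holomorphic_measure :: "(complex \<Rightarrow> complex ^ 'n) \<Rightarrow> (complex ^ 'n) measure" where
  "holomorphic_measure f = distr circle_prob borel (\<lambda>t. radial_limit f (cis t))"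

definition weak_limit ::
  "(nat \<Rightarrow> 'a::metric_space measure) \<Rightarrow> 'a measure \<Rightarrow> bool" where
  "weak_limit M \<mu> \<longleftrightarrow>
     finite_measure \<mu> \<and> sets \<mu> = sets borel \<and>
     (\<forall>\<phi> :: 'a \<Rightarrow> real. continuous_on UNIV \<phi> \<and> bounded (range \<phi>)
        \<longrightarrow> (\<lambda>j. integral\<^sup>L (M j) \<phi>) \<longlonglongrightarrow> integral\<^sup>L \<mu> \<phi>)"

definition measure_support :: "'a::topological_space measure \<Rightarrow> 'a set" where
  "measure_support \<mu> = {x. \<forall>V. open V \<and> x \<in> V \<longrightarrow> 0 < emeasure \<mu> V}"

section \<open>Leaves\<close>

type_synonym 'n map_seq = "nat \<Rightarrow> complex \<Rightarrow> complex ^ 'n"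

definition leaf :: "'n::finite map_seq \<Rightarrow> bool" where
  "leaf L \<longleftrightarrow>
     (\<forall>j. holomorphic_map (L j)) \<and>
     (\<exists>M. \<forall>j. \<forall>\<zeta>\<in>\<U>. norm (L j \<zeta>) \<le> M) \<and>
     (\<exists>\<mu>. weak_limit (\<lambda>j. holomorphic_measure (L j)) \<mu>)"

text \<open>A weak limit of finite Borel measures on a metric space is unique.\<close>

definition leaf_measure :: "'n::finite map_seq \<Rightarrow> (complex ^ 'n) measure" where
  "leaf_measure L = (THE \<mu>. weak_limit (\<lambda>j. holomorphic_measure (L j)) \<mu>)"

definition leaf_supp :: "'n::finite map_seq \<Rightarrow> (complex ^ 'n) set" where
  "leaf_supp L = measure_support (leaf_measure L)"

definition cluster :: "'n::finite map_seq \<Rightarrow> (complex ^ 'n) set" where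
  "cluster L =
     {z. \<exists>(j :: nat \<Rightarrow> nat) \<zeta>. strict_mono j \<and> (\<forall>k. \<zeta> k \<in> \<U>) \<and> (\<lambda>k. L (j k) (\<zeta> k)) \<longlonglongrightarrow> z}"

definition nonessential :: "'n::finite map_seq \<Rightarrow> complex ^ 'n \<Rightarrow> bool" where
  "nonessential L z \<longleftrightarrow>
     (\<exists>r>0. (\<lambda>j. harmonic_measure 0 {\<zeta> \<in> \<U>. L j \<zeta> \<in> ball z r}) \<longlonglongrightarrow> 0)"

definition perfect_leaf :: "'n::finite map_seq \<Rightarrow> bool" where
  "perfect_leaf L \<longleftrightarrow> leaf L \<and> (\<forall>z\<in>cluster L. \<not> nonessential L z)"

definition maximal_on_cluster ::
  "(complex ^ 'n) set \<Rightarrow> 'n::finite map_seq \<Rightarrow> (complex ^ 'n \<Rightarrow> ereal) \<Rightarrow> bool" where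
  "maximal_on_cluster D L u \<longleftrightarrow>
     usc_on (cluster L \<inter> D) u \<and>
     (\<forall>G H v. domain_set G \<and> domain_set H \<and> G \<subset>\<subset> H \<and> H \<subset>\<subset> D \<longrightarrow>
        (psh_on H v \<and> (\<forall>z \<in> cluster L \<inter> frontier G. v z \<le> u z)
           \<longrightarrow> (\<forall>z \<in> cluster L \<inter> G. v z \<le> u z)) \<and>
        (plurisuperharmonic_on H v \<and> (\<forall>z \<in> cluster L \<inter> frontier G. u z \<le> v z)
           \<longrightarrow> (\<forall>z \<in> cluster L \<inter> G. u z \<le> v z)))"

end

theory Submission
  imports Defs
begin

text \<open>
  The leaf can be chosen independently of \<open>u\<close>: a bounded domain \<open>D\<close> carries a perfect leaf whose
  cluster contains all of \<open>D\<close> and whose support lies in the boundary. On such a cluster, maximality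
  of \<open>u\<close> on \<open>cl L\<close> follows from maximality on \<open>D\<close>: a competitor \<open>v\<close> on \<open>H\<close> is replaced by the
  plurisubharmonic function equal to \<open>max u v\<close> on \<open>G\<close> and to \<open>u\<close> elsewhere, and a
  plurisuperharmonic majorant is handled by the maximum principle. Conversely, maximality on the
  cluster through \<open>z\<close> gives \<open>v z \<le> u z\<close> at once.

  The leaf consists of partial sums of one power series. A partial sum \<open>f\<close> mapping the closed disc
  into \<open>D\<close> is continued to \<open>f + \<zeta> ^ N R b\<close> with a fixed vector \<open>b\<close>, a trigonometric polynomial \<open>R\<close>
  close on the circle to a prescribed function of \<open>f\<close>, and \<open>N\<close> large. This moves the boundary
  values by prescribed amounts in all phases and hardly changes \<open>f\<close> inside. Short steps, repeated
  along chains in the connected set \<open>D\<close>, make the discs visit a dense set in a way that persists; steps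
  comparable to the distance to the complement of \<open>D\<close> drive the boundary values to the boundary,
  because the power series has orthogonal terms of bounded total energy. The same orthogonality gives
  a subsequence with boundary values converging almost everywhere, hence the weak limit.
\<close>

section \<open>Mean values over circles\<close>

text \<open>\<open>subharmonic_on\<close> tests every closed disc in the open set, whereas gluing
  \<open>u\<close> and \<open>v\<close> gives the mean value inequality only on small circles. The
  passage from small circles to all circles is therefore proved on its own, with real parts of
  polynomials as harmonic majorants. The discs face two opposing demands: values inside keep
  returning close to every point of \<open>D\<close>, while values on the circle move out to the
  frontier. High powers separate the two, since \<zeta>^N is negligible on a smaller disc and has
  modulus 1 on the circle. The prescribed size of a step is a real function on the circle, hence in
  general not the trace of a holomorphic function; multiplied by \<zeta>^N, its trigonometric
  approximation becomes a polynomial of the same modulus there. Every visit is protected by a radius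
  below 1 inside which all later steps together stay small. Perfection follows from the same
  protection: near every cluster point lie values of the leaf in \<open>D\<close>, and a persistent
  visit near such a value provides a fixed ball whose harmonic measure is a lower bound.\<close>

lemma space_circle_prob [simp]: "space circle_prob = UNIV"
  by (simp add: circle_prob_def uniform_measure_def)

lemma sets_circle_prob [measurable_cong, simp]: "sets circle_prob = sets borel"
  by (simp add: circle_prob_def)

lemma emeasure_circle_prob:
  assumes [measurable]: "A \<in> sets borel"
  shows "emeasure circle_prob A = emeasure lborel ({0..2 * pi} \<inter> A) / ennreal (2 * pi)"
  by (simp add: circle_prob_def)

lemma emeasure_circle_prob_UNIV [simp]: "emeasure circle_prob UNIV = 1"
proof -
  have "ennreal (2 * pi) / ennreal (2 * pi) = ennreal (2 * pi / (2 * pi))"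
    by (rule divide_ennreal) auto
  then show ?thesis
    by (simp add: emeasure_circle_prob)
qed

lemma finite_measure_circle_prob [simp, intro]: "finite_measure circle_prob"
  by (rule finite_measureI) simp

lemma measure_circle_prob_UNIV [simp]: "measure circle_prob UNIV = 1"
  by (simp add: measure_def)

lemma integrable_circle_prob_bounded:
  fixes f :: "real \<Rightarrow> 'b::{banach, second_countable_topology}"
  assumes "f \<in> borel_measurable borel" "\<And>t. norm (f t) \<le> B"
  shows "integrable circle_prob f"
  by (rule finite_measure.integrable_const_bound[where B = B])
    (use assms in \<open>auto simp: measurable_def\<close>)

lemma integrable_circle_prob_const [simp]:
  "integrable circle_prob (\<lambda>t. c :: 'b::{banach, second_countable_topology})"
  by (rule integrable_circle_prob_bounded[where B = "norm c"]) auto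

lemma integral_circle_prob:
  fixes f :: "real \<Rightarrow> real"
  assumes "continuous_on UNIV f"
  shows "integral\<^sup>L circle_prob f = integral {0..2 * pi} f / (2 * pi)"
proof -
  have [measurable]: "f \<in> borel_measurable borel"
    using assms by (rule borel_measurable_continuous_onI)
  have si: "set_integrable lborel {0..2 * pi} f"
    using assms by (intro borel_integrable_atLeastAtMost') (auto intro: continuous_on_subset)
  have eq: "circle_prob = density lborel (\<lambda>t. ennreal (indicator {0..2 * pi} t / (2 * pi)))"
    unfolding circle_prob_def uniform_measure_def
    by (rule density_cong) (auto simp: indicator_def divide_ennreal ennreal_1[symmetric] simp del: ennreal_1)
  have "integral\<^sup>L circle_prob f = (LINT t|lborel. (indicator {0..2 * pi} t / (2 * pi)) *\<^sub>R f t)"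
    unfolding eq by (rule integral_density) auto
  also have "\<dots> = (LINT t|lborel. (indicator {0..2 * pi} t *\<^sub>R f t) / (2 * pi))"
    by (simp add: field_simps)
  also have "\<dots> = (LINT t:{0..2 * pi}|lborel. f t) / (2 * pi)"
    unfolding set_lebesgue_integral_def by simp
  also have "(LINT t:{0..2 * pi}|lborel. f t) = integral {0..2 * pi} f"
    using si by (rule set_borel_integral_eq_integral)
  finally show ?thesis .
qed

lemma integral_circle_prob_cos:
  assumes "k \<noteq> (0::int)"
  shows "integral\<^sup>L circle_prob (\<lambda>t. cos (of_int k * t)) = 0"
proof -
  have "((\<lambda>t. cos (of_int k * t)) has_integral
      (sin (of_int k * (2 * pi)) / of_int k - sin (of_int k * 0) / of_int k)) {0..2 * pi}"
    by (rule fundamental_theorem_of_calculus)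
      (use assms in \<open>auto intro!: derivative_eq_intros
        simp: has_real_derivative_iff_has_vector_derivative[symmetric]\<close>)
  moreover have "sin (of_int k * (2 * pi)) = 0"
    by (metis mult.commute mult.assoc sin_int_2pin mult.left_commute)
  ultimately show ?thesis
    by (subst integral_circle_prob) (auto intro!: continuous_intros simp: integral_unique)
qed

lemma integral_circle_prob_sin:
  "integral\<^sup>L circle_prob (\<lambda>t. sin (of_int k * t)) = 0"
proof (cases "k = 0")
  case False
  have "((\<lambda>t. sin (of_int k * t)) has_integral
      (- cos (of_int k * (2 * pi)) / of_int k - (- cos (of_int k * 0) / of_int k))) {0..2 * pi}"
    by (rule fundamental_theorem_of_calculus)
      (use False in \<open>auto intro!: derivative_eq_intros
        simp: has_real_derivative_iff_has_vector_derivative[symmetric]\<close>)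
  moreover have "cos (of_int k * (2 * pi)) = 1"
    by (metis mult.commute mult.assoc cos_int_2pin mult.left_commute)
  ultimately show ?thesis
    by (subst integral_circle_prob) (auto intro!: continuous_intros simp: integral_unique)
qed simp

section \<open>Arcs of positive measure and strict mean values\<close>

lemma emeasure_circle_prob_interval_pos:
  assumes "0 \<le> a" "a < b" "b \<le> 2 * pi" "{a<..<b} \<subseteq> A" "A \<in> sets borel"
  shows "0 < emeasure circle_prob A"
proof -
  have "0 < ennreal ((b - a) / (2 * pi))"
    using assms by simp
  also have "\<dots> = ennreal (b - a) / ennreal (2 * pi)"
    using assms by (subst divide_ennreal) auto
  also have "\<dots> = emeasure circle_prob {a<..<b}"
  proof -
    have "{0..2 * pi} \<inter> {a<..<b} = {a<..<b}"
      using assms by auto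
    then show ?thesis
      using assms by (simp add: emeasure_circle_prob)
  qed
  also have "\<dots> \<le> emeasure circle_prob A"
    using assms by (intro emeasure_mono) auto
  finally show ?thesis .
qed

lemma circle_prob_ball_pos:
  assumes "norm \<zeta> = r" "0 < s"
  shows "0 < emeasure circle_prob {t. of_real r * cis t \<in> ball \<zeta> s}"
proof -
  have cont: "continuous_on UNIV (\<lambda>t. of_real r * cis t)"
    by (intro continuous_intros)
  have op: "open {t. of_real r * cis t \<in> ball \<zeta> s}"
    using open_vimage[OF open_ball cont] by (simp add: vimage_def)
  define a where "a = Arg2pi \<zeta>"
  have a: "0 \<le> a" "a < 2 * pi" "of_real r * cis a = \<zeta>"
    using Arg2pi[of \<zeta>] assms by (auto simp: a_def cis_conv_exp is_Arg_def)
  then have "a \<in> {t. of_real r * cis t \<in> ball \<zeta> s}"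
    using assms by simp
  then obtain d where d: "d > 0" "\<And>t. dist t a < d \<Longrightarrow> of_real r * cis t \<in> ball \<zeta> s"
    using op unfolding open_dist by blast
  \<comment> \<open>As \<open>Arg2pi\<close> takes values in [0, 2 pi), the parameter interval has
    room to the right of \<open>a\<close> even after truncation; to the left there is none when
    \<open>a = 0\<close>.\<close>
  define b where "b = min (a + d) (2 * pi)"
  have "{a<..<b} \<subseteq> {t. of_real r * cis t \<in> ball \<zeta> s}"
    using d(2) by (force simp: b_def dist_real_def)
  then show ?thesis
    using a d(1) op by (intro emeasure_circle_prob_interval_pos[of a b]) (auto simp: b_def)
qed

text \<open>The half circle \<open>0 < cos t\<close> has positive measure, so a strict inequality
  there survives integration. In the maximum principle it is the half on which the tie-breaking
  function is larger than at the centre.\<close>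

lemma integral_circle_prob_strict:
  fixes f :: "real \<Rightarrow> real"
  assumes "f \<in> borel_measurable borel" "\<And>t. \<bar>f t\<bar> \<le> B" "\<And>t. f t \<le> m"
    and "\<And>t. 0 < cos t \<Longrightarrow> f t < m"
  shows "integral\<^sup>L circle_prob f < m"
proof -
  have int: "integrable circle_prob f"
    by (rule integrable_circle_prob_bounded[where B = B]) (use assms in auto)
  have "integral\<^sup>L circle_prob f \<le> integral\<^sup>L circle_prob (\<lambda>t. m)"
    using int assms(3) by (intro integral_mono) auto
  moreover have "integral\<^sup>L circle_prob f \<noteq> m"
  proof
    assume eq: "integral\<^sup>L circle_prob f = m"
    have "integral\<^sup>L circle_prob (\<lambda>t. m - f t) = 0"
      using int eq by (subst Bochner_Integration.integral_diff) auto
    then have ae: "AE t in circle_prob. m - f t = 0"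
      using int assms(3) by (subst (asm) integral_nonneg_eq_0_iff_AE) auto
    have "emeasure circle_prob {t. 0 < cos t} = 0"
    proof -
      have "AE t in circle_prob. t \<notin> {t. 0 < cos t}"
        using ae by eventually_elim (use assms(4) in force)
      moreover have "{t::real. 0 < cos t} \<in> sets borel"
        by measurable
      ultimately show ?thesis
        by (subst (asm) AE_iff_measurable[where N = "{t. 0 < cos t}"]) auto
    qed
    moreover have "0 < emeasure circle_prob {t. 0 < cos t}"
      by (rule emeasure_circle_prob_interval_pos[of 0 "pi / 2"])
        (use pi_gt_zero in \<open>auto intro!: cos_gt_zero_pi\<close>)
    ultimately show False by simp
  qed
  ultimately show ?thesis by simp
qed

lemma circle_mean_mono:
  assumes "\<And>t. u (a + of_real r * cis t) \<le> w (a + of_real r * cis t)"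
  shows "circle_mean u a r \<le> circle_mean w a r"
  unfolding circle_mean_def
  using assms by (intro ereal_minus_mono iffD1[OF less_eq_ennreal.rep_eq] nn_integral_mono e2ennreal_mono) (auto simp: ereal_minus_le_minus)

text \<open>A bounded integrand makes both extended integrals in \<open>circle_mean\<close> finite,
  so their difference is an ordinary integral and linearity becomes available.\<close>

lemma circle_mean_real:
  assumes "(\<lambda>t. w (a + of_real r * cis t)) \<in> borel_measurable borel"
    and "\<And>t. \<bar>w (a + of_real r * cis t)\<bar> \<le> B"
  shows "circle_mean (\<lambda>z. ereal (w z)) a r = ereal (integral\<^sup>L circle_prob (\<lambda>t. w (a + of_real r * cis t)))"
proof -
  define f where "f t = w (a + of_real r * cis t)" for t
  have int: "integrable circle_prob f"
    unfolding f_def by (rule integrable_circle_prob_bounded[where B = B]) (use assms in auto)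
  have B: "f t \<le> B" "- f t \<le> B" for t
    using assms(2)[of t] by (auto simp: f_def)
  have B0: "0 \<le> B"
    using B[of 0] by linarith
  have fin: "(\<integral>\<^sup>+ t. ennreal (g t) \<partial>circle_prob) < top" if "\<And>t. g t \<le> B" for g
  proof -
    have "(\<integral>\<^sup>+ t. ennreal (g t) \<partial>circle_prob) \<le> (\<integral>\<^sup>+ t. ennreal B \<partial>circle_prob)"
      by (intro nn_integral_mono ennreal_leI that)
    also have "\<dots> < top" by simp
    finally show ?thesis .
  qed
  have "integral\<^sup>L circle_prob f =
      enn2real (\<integral>\<^sup>+ t. ennreal (f t) \<partial>circle_prob) - enn2real (\<integral>\<^sup>+ t. ennreal (- f t) \<partial>circle_prob)"
    using int by (rule real_lebesgue_integral_def)
  moreover have "enn2ereal x = ereal (enn2real x)" if "x < top" for x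
    using that by (cases x) auto
  ultimately show ?thesis
    using fin[of f] fin[of "\<lambda>t. - f t"] B
    by (simp add: circle_mean_def f_def[symmetric] flip: ennreal.abs_eq)
qed

lemma circle_composition:
  fixes g :: "complex \<Rightarrow> 'b::{banach, second_countable_topology}"
  assumes "continuous_on (sphere a r) g" "0 \<le> r"
  shows borel_measurable_circle: "(\<lambda>t. g (a + of_real r * cis t)) \<in> borel_measurable borel"
    and bounded_circle: "\<exists>B. \<forall>t. norm (g (a + of_real r * cis t)) \<le> B"
    and integrable_circle: "integrable circle_prob (\<lambda>t. g (a + of_real r * cis t))"
proof -
  have sph: "a + of_real r * cis t \<in> sphere a r" for t
    using assms(2) by (simp add: dist_norm norm_mult)
  have "continuous_on UNIV (\<lambda>t. g (a + of_real r * cis t))"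
    by (rule continuous_on_compose2[OF assms(1)]) (use sph in \<open>auto intro!: continuous_intros\<close>)
  then show m: "(\<lambda>t. g (a + of_real r * cis t)) \<in> borel_measurable borel"
    by (rule borel_measurable_continuous_onI)
  have "bounded (g ` sphere a r)"
    using assms(1) by (intro compact_imp_bounded compact_continuous_image) auto
  then obtain B where "\<forall>x\<in>g ` sphere a r. norm x \<le> B"
    unfolding bounded_iff by blast
  then have B: "\<forall>t. norm (g (a + of_real r * cis t)) \<le> B"
    using sph by blast
  then show "\<exists>B. \<forall>t. norm (g (a + of_real r * cis t)) \<le> B" ..
  show "integrable circle_prob (\<lambda>t. g (a + of_real r * cis t))"
    using m B by (intro integrable_circle_prob_bounded[where B = B]) auto
qed

section \<open>Real parts of polynomials as harmonic functions\<close>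

lemma integral_circle_prob_Re_poly:
  assumes "0 \<le> r"
  shows "integral\<^sup>L circle_prob (\<lambda>t. Re (poly p (a + of_real r * cis t))) = Re (poly p a)"
proof -
  \<comment> \<open>The affine substitution turns the circle into the unit circle and the value at
    the centre into the constant coefficient, the only one that survives integration.\<close>
  define q where "q = pcompose p [:a, of_real r:]"
  have eq: "Re (poly p (a + of_real r * cis t))
      = (\<Sum>k\<le>degree q. Re (coeff q k) * cos (of_int (int k) * t) - Im (coeff q k) * sin (of_int (int k) * t))" for t
  proof -
    have "poly p (a + of_real r * cis t) = poly q (cis t)"
      by (simp add: q_def poly_pcompose mult.commute)
    also have "\<dots> = (\<Sum>k\<le>degree q. coeff q k * cis (real k * t))"
      unfolding poly_altdef Complex.DeMoivre ..
    finally show ?thesis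
      by simp
  qed
  have int: "integrable circle_prob (\<lambda>t. cos (c * t))" "integrable circle_prob (\<lambda>t. sin (c * t))" for c
    by (rule integrable_circle_prob_bounded[where B = 1]; simp)+
  have "integral\<^sup>L circle_prob (\<lambda>t. Re (poly p (a + of_real r * cis t)))
      = (\<Sum>k\<le>degree q. Re (coeff q k) * integral\<^sup>L circle_prob (\<lambda>t. cos (of_int (int k) * t))
          - Im (coeff q k) * integral\<^sup>L circle_prob (\<lambda>t. sin (of_int (int k) * t)))"
    unfolding eq using int by (simp del: of_int_of_nat_eq)
  also have "\<dots> = (\<Sum>k\<le>degree q. if k = 0 then Re (coeff q 0) else 0)"
    by (intro sum.cong refl) (simp add: integral_circle_prob_cos integral_circle_prob_sin del: of_int_of_nat_eq)
  also have "\<dots> = Re (coeff q 0)"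
    by simp
  also have "coeff q 0 = poly p a"
    by (simp add: q_def poly_0_coeff_0[symmetric] poly_pcompose)
  finally show ?thesis .
qed

text \<open>Since 2 Re x Re y = Re (x y) + Re (cnj x y), and cnj \<zeta> is the inverse of \<zeta>
  on the circle, two monomials with exponents \<open>k \<le> l\<close> multiply to terms with the
  nonnegative exponents k + l and l - k. Hence the real parts of polynomials form an algebra on the
  circle.\<close>

lemma Re_poly_mult_on_circle:
  "\<exists>r. \<forall>\<zeta>\<in>sphere 0 1. Re (poly p \<zeta>) * Re (poly q \<zeta>) = Re (poly r \<zeta>)"
proof -
  have mono: "\<exists>r. \<forall>\<zeta>\<in>sphere 0 1. Re (a * \<zeta> ^ k) * Re (b * \<zeta> ^ l) = Re (poly r \<zeta>)"
    if "k \<le> l" for a b :: complex and k l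
  proof (intro exI ballI)
    fix \<zeta> :: complex
    assume "\<zeta> \<in> sphere 0 1"
    then have "cmod (\<zeta> ^ k) = 1"
      by (simp add: norm_power)
    then have one: "cnj (\<zeta> ^ k) * \<zeta> ^ k = 1"
      by (metis complex_norm_square mult.commute of_real_1 power_one)
    have "cnj (a * \<zeta> ^ k) * (b * \<zeta> ^ l) = (cnj a * b * \<zeta> ^ (l - k)) * (cnj (\<zeta> ^ k) * \<zeta> ^ k)"
      using that by (simp add: algebra_simps flip: power_add)
    also have "\<dots> = cnj a * b * \<zeta> ^ (l - k)"
      by (simp only: one mult_1_right)
    finally have c: "cnj (a * \<zeta> ^ k) * (b * \<zeta> ^ l) = cnj a * b * \<zeta> ^ (l - k)" .
    have "Re x * Re y = (Re (x * y) + Re (cnj x * y)) / 2" for x y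
      by simp
    then have "Re (a * \<zeta> ^ k) * Re (b * \<zeta> ^ l)
        = (Re (a * \<zeta> ^ k * (b * \<zeta> ^ l)) + Re (cnj a * b * \<zeta> ^ (l - k))) / 2"
      by (simp only: c[symmetric])
    also have "\<dots> = Re ((a * b * \<zeta> ^ (k + l) + cnj a * b * \<zeta> ^ (l - k)) / 2)"
      by (simp add: power_add mult_ac)
    also have "(a * b * \<zeta> ^ (k + l) + cnj a * b * \<zeta> ^ (l - k)) / 2
        = poly (smult (1/2) (monom (a * b) (k + l) + monom (cnj a * b) (l - k))) \<zeta>"
      by (simp add: poly_monom)
    finally show "Re (a * \<zeta> ^ k) * Re (b * \<zeta> ^ l)
        = Re (poly (smult (1/2) (monom (a * b) (k + l) + monom (cnj a * b) (l - k))) \<zeta>)" .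
  qed
  have mono: "\<exists>r. \<forall>\<zeta>\<in>sphere 0 1. Re (a * \<zeta> ^ k) * Re (b * \<zeta> ^ l) = Re (poly r \<zeta>)"
    for a b :: complex and k l
    using mono[of k l a b] mono[of l k b a] by (cases "k \<le> l") (auto simp: mult.commute)
  define R where "R a b k l = (SOME r. \<forall>\<zeta>\<in>sphere 0 1. Re (a * \<zeta> ^ k) * Re (b * \<zeta> ^ l) = Re (poly r \<zeta>))"
    for a b :: complex and k l
  have R: "Re (a * \<zeta> ^ k) * Re (b * \<zeta> ^ l) = Re (poly (R a b k l) \<zeta>)"
    if "\<zeta> \<in> sphere 0 1" for a b k l \<zeta>
    using someI_ex[OF mono[of a k b l]] that by (simp add: R_def)
  have "Re (poly p \<zeta>) * Re (poly q \<zeta>)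
      = Re (poly (\<Sum>k\<le>degree p. \<Sum>l\<le>degree q. R (coeff p k) (coeff q l) k l) \<zeta>)"
    if "\<zeta> \<in> sphere 0 1" for \<zeta>
    using R[OF that] by (simp add: poly_altdef[of p] poly_altdef[of q] sum_product poly_sum)
  then show ?thesis by blast
qed

text \<open>Stone-Weierstrass; the points of the circle are separated by Re \<zeta> and by Im
  \<zeta> = Re (-i \<zeta>). The result replaces the solution of the Dirichlet problem by an
  approximate one.\<close>

lemma Re_poly_dense_on_circle:
  assumes "continuous_on (sphere 0 1) h" "0 < e"
  obtains p where "\<And>\<zeta>. \<zeta> \<in> sphere 0 1 \<Longrightarrow> \<bar>h \<zeta> - Re (poly p \<zeta>)\<bar> < e"
proof -
  define P where "P f \<longleftrightarrow> (\<exists>p. \<forall>\<zeta>\<in>sphere 0 1. f \<zeta> = Re (poly p \<zeta>))" for f :: "complex \<Rightarrow> real"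
  have "\<exists>g. P g \<and> (\<forall>x\<in>sphere 0 1. \<bar>h x - g x\<bar> < e)"
  proof (rule Stone_Weierstrass_HOL[where P = P])
    show "P (\<lambda>x. c)" for c
      unfolding P_def by (intro exI[of _ "[:of_real c:]"]) simp
    show "continuous_on (sphere 0 1) f" if Pf: "P f" for f
    proof -
      obtain p where "\<forall>\<zeta>\<in>sphere 0 1. f \<zeta> = Re (poly p \<zeta>)"
        using Pf unfolding P_def by blast
      then show ?thesis
        by (subst continuous_on_cong[OF refl]) (auto intro!: continuous_intros)
    qed
    show "P (\<lambda>x. f x + g x)" if Pfg: "P f \<and> P g" for f g
    proof -
      obtain p q where "\<forall>\<zeta>\<in>sphere 0 1. f \<zeta> = Re (poly p \<zeta>)" "\<forall>\<zeta>\<in>sphere 0 1. g \<zeta> = Re (poly q \<zeta>)"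
        using Pfg unfolding P_def by blast
      then show ?thesis
        unfolding P_def by (intro exI[of _ "p + q"]) simp
    qed
    show "P (\<lambda>x. f x * g x)" if "P f \<and> P g" for f g
      using that Re_poly_mult_on_circle unfolding P_def by metis
    show "\<exists>f. P f \<and> f x \<noteq> f y" if "x \<in> sphere 0 1 \<and> y \<in> sphere 0 1 \<and> x \<noteq> y" for x y
    proof (cases "Re x = Re y")
      case True
      have "P (\<lambda>\<zeta>. Im \<zeta>)"
        unfolding P_def by (intro exI[of _ "[:0, -\<i>:]"]) simp
      moreover have "Im x \<noteq> Im y"
        using that True by (auto simp: complex_eq_iff)
      ultimately show ?thesis by blast
    next
      case False
      moreover have "P (\<lambda>\<zeta>. Re \<zeta>)"
        unfolding P_def by (intro exI[of _ "[:0, 1:]"]) simp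
      ultimately show ?thesis by blast
    qed
  qed (use assms in auto)
  then show ?thesis
    using that unfolding P_def by metis
qed

section \<open>Upper semicontinuous functions and the maximum principle\<close>

lemma usc_on_open_iff:
  assumes "open S"
  shows "usc_on S u \<longleftrightarrow> (\<forall>c. open {x \<in> S. u x < c})"
  unfolding usc_on_def using assms by (auto simp: openin_open_eq)

lemma usc_on_ereal_open_iff:
  assumes "open S"
  shows "usc_on S (\<lambda>x. ereal (u x)) \<longleftrightarrow> (\<forall>c. open {x \<in> S. u x < c})"
proof -
  have "open {x \<in> S. ereal (u x) < c}" if "\<forall>c. open {x \<in> S. u x < c}" for c
    by (cases c) (use that assms in \<open>simp_all add: Collect_mem_eq\<close>)
  moreover have "open {x \<in> S. u x < c}" if "\<forall>c. open {x \<in> S. ereal (u x) < c}" for c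
    using that[rule_format, of "ereal c"] by simp
  ultimately show ?thesis
    using assms by (auto simp: usc_on_open_iff)
qed

text \<open>Without a maximum point the open sets
  \<open>{x \<in> \<Omega>. \<phi> x < \<phi> y}\<close> with \<open>y \<in> K\<close> cover
  \<open>K\<close>. In a finite subcover, the \<open>y\<close> with the largest value lies in none
  of the sets.\<close>

lemma usc_attains_max:
  fixes \<phi> :: "'a::topological_space \<Rightarrow> real"
  assumes "compact K" "K \<noteq> {}" "K \<subseteq> \<Omega>" "\<And>c. open {x \<in> \<Omega>. \<phi> x < c}"
  obtains p where "p \<in> K" "\<And>x. x \<in> K \<Longrightarrow> \<phi> x \<le> \<phi> p"
proof -
  have "\<exists>p\<in>K. \<forall>x\<in>K. \<phi> x \<le> \<phi> p"
  proof (rule ccontr)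
    assume "\<not> ?thesis"
    then have no_max: "\<exists>x\<in>K. \<phi> p < \<phi> x" if "p \<in> K" for p
      using that by (meson not_le)
    obtain C where C: "C \<subseteq> K" "finite C" "K \<subseteq> (\<Union>y\<in>C. {x \<in> \<Omega>. \<phi> x < \<phi> y})"
    proof (rule compactE_image[OF assms(1), of K "\<lambda>y. {x \<in> \<Omega>. \<phi> x < \<phi> y}"])
      show "K \<subseteq> (\<Union>y\<in>K. {x \<in> \<Omega>. \<phi> x < \<phi> y})"
        using no_max assms(3) by blast
    qed (use assms(4) in auto)
    have "C \<noteq> {}"
      using C(3) assms(2) by auto
    then have "Max (\<phi> ` C) \<in> \<phi> ` C"
      using C(2) by (intro Max_in) auto
    then obtain y where "y \<in> C" "Max (\<phi> ` C) = \<phi> y"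
      by blast
    then have y: "y \<in> C" "\<And>x. x \<in> C \<Longrightarrow> \<phi> x \<le> \<phi> y"
      using C(2) Max_ge[of "\<phi> ` C"] by auto
    have "y \<in> K"
      using y(1) C(1) by blast
    then obtain z where "z \<in> C" "\<phi> y < \<phi> z"
      using C(3) by blast
    then show False
      using y(2)[of z] by simp
  qed
  then show thesis
    using that by blast
qed

text \<open>The maximum points form a compact set, being \<open>K\<close> minus an open sublevel
  set, so \<open>l\<close> attains its maximum on them. A point of \<open>K\<close> with larger
  \<open>l\<close> is then no maximum point.\<close>

lemma usc_attains_max_tie_break:
  fixes \<phi> l :: "'a::metric_space \<Rightarrow> real"
  assumes "compact K" "K \<noteq> {}" "K \<subseteq> \<Omega>" "\<And>c. open {x \<in> \<Omega>. \<phi> x < c}"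
    and "continuous_on K l"
  obtains p where "p \<in> K" "\<And>x. x \<in> K \<Longrightarrow> \<phi> x \<le> \<phi> p"
    "\<And>x. x \<in> K \<Longrightarrow> l p < l x \<Longrightarrow> \<phi> x < \<phi> p"
proof -
  obtain q where q: "q \<in> K" "\<And>x. x \<in> K \<Longrightarrow> \<phi> x \<le> \<phi> q"
    using usc_attains_max[OF assms(1-4)] by metis
  define M where "M = K - {x \<in> \<Omega>. \<phi> x < \<phi> q}"
  have M_iff: "x \<in> M \<longleftrightarrow> x \<in> K \<and> \<phi> x = \<phi> q" for x
    using q(2) assms(3) by (fastforce simp: M_def)
  have "compact M"
    unfolding M_def using assms(1,4) by (rule compact_diff)
  moreover have "q \<in> M" "continuous_on M l"
    using q assms(5) by (auto simp: M_iff M_def intro: continuous_on_subset)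
  ultimately obtain p where p: "p \<in> M" "\<And>x. x \<in> M \<Longrightarrow> l x \<le> l p"
    using continuous_attains_sup[of M l] by blast
  show thesis
  proof (rule that[of p])
    show "\<phi> x < \<phi> p" if "x \<in> K" "l p < l x" for x
      using that p q(2)[of x] by (force simp: M_iff)
  qed (use p q in \<open>auto simp: M_iff\<close>)
qed

lemma usc_borel_measurable_curve:
  fixes \<phi> :: "'a::topological_space \<Rightarrow> real" and \<gamma> :: "real \<Rightarrow> 'a"
  assumes "\<And>c. open {x \<in> \<Omega>. \<phi> x < c}" "continuous_on UNIV \<gamma>" "\<And>t. \<gamma> t \<in> \<Omega>"
  shows "(\<lambda>t. \<phi> (\<gamma> t)) \<in> borel_measurable borel"
proof (subst borel_measurable_iff_less, intro allI)
  fix c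
  have "{t \<in> space borel. \<phi> (\<gamma> t) < c} = \<gamma> -` {x \<in> \<Omega>. \<phi> x < c}"
    using assms(3) by auto
  moreover have "open (\<gamma> -` {x \<in> \<Omega>. \<phi> x < c})"
    using assms(1,2) by (rule open_vimage)
  ultimately show "{t \<in> space borel. \<phi> (\<gamma> t) < c} \<in> sets borel"
    by simp
qed

text \<open>Semicontinuity bounds the values from above only; the lower bound \<open>B\<close> is
  what makes the mean over the curve an ordinary integral.\<close>

lemma usc_bounded_curve:
  fixes \<phi> :: "'a::topological_space \<Rightarrow> real" and \<gamma> :: "real \<Rightarrow> 'a"
  assumes "compact K" "K \<subseteq> \<Omega>" "\<And>c. open {x \<in> \<Omega>. \<phi> x < c}" "\<And>x. x \<in> K \<Longrightarrow> B \<le> \<phi> x"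
    and "\<And>t. \<gamma> t \<in> K"
  obtains B' where "\<And>t. \<bar>\<phi> (\<gamma> t)\<bar> \<le> B'"
proof -
  obtain p where p: "\<And>x. x \<in> K \<Longrightarrow> \<phi> x \<le> \<phi> p"
    using usc_attains_max[OF assms(1) _ assms(2,3)] assms(5) by (metis empty_iff)
  have "\<bar>\<phi> (\<gamma> t)\<bar> \<le> \<bar>B\<bar> + \<bar>\<phi> p\<bar>" for t
    using p[OF assms(5)[of t]] assms(4)[OF assms(5)[of t]] by linarith
  then show thesis ..
qed

text \<open>
  At a maximum point that is extremal for \<open>l\<close>, half of a small circle carries smaller values,
  which contradicts the mean value inequality.
\<close>

lemma usc_maximum_principle:
  fixes \<phi> l :: "'a::metric_space \<Rightarrow> real"
  assumes "compact K" "K \<subseteq> \<Omega>" "\<And>c. open {x \<in> \<Omega>. \<phi> x < c}" "continuous_on K l"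
    and "\<And>x. x \<in> K \<Longrightarrow> B \<le> \<phi> x"
    and circle: "\<And>p. p \<in> K \<Longrightarrow> 0 < \<phi> p \<Longrightarrow> \<exists>\<gamma>. continuous_on UNIV \<gamma> \<and> (\<forall>t. \<gamma> t \<in> K) \<and>
      (\<forall>t. 0 < cos t \<longrightarrow> l p < l (\<gamma> t)) \<and> \<phi> p \<le> integral\<^sup>L circle_prob (\<lambda>t. \<phi> (\<gamma> t))"
    and "x \<in> K"
  shows "\<phi> x \<le> 0"
proof (rule ccontr)
  assume "\<not> \<phi> x \<le> 0"
  obtain p where p: "p \<in> K" "\<And>x. x \<in> K \<Longrightarrow> \<phi> x \<le> \<phi> p"
    "\<And>x. x \<in> K \<Longrightarrow> l p < l x \<Longrightarrow> \<phi> x < \<phi> p"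
    using usc_attains_max_tie_break[OF assms(1) _ assms(2-4)] \<open>x \<in> K\<close> by (metis empty_iff)
  have "0 < \<phi> p"
    using p(2)[OF \<open>x \<in> K\<close>] \<open>\<not> \<phi> x \<le> 0\<close> by simp
  then obtain \<gamma> where \<gamma>: "continuous_on UNIV \<gamma>" "\<And>t. \<gamma> t \<in> K"
    "\<And>t. 0 < cos t \<Longrightarrow> l p < l (\<gamma> t)" "\<phi> p \<le> integral\<^sup>L circle_prob (\<lambda>t. \<phi> (\<gamma> t))"
    using circle[OF p(1)] by blast
  obtain B' where B': "\<And>t. \<bar>\<phi> (\<gamma> t)\<bar> \<le> B'"
    using usc_bounded_curve[OF assms(1-3,5) \<gamma>(2)] by metis
  have "integral\<^sup>L circle_prob (\<lambda>t. \<phi> (\<gamma> t)) < \<phi> p"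
  proof (rule integral_circle_prob_strict[OF _ B'])
    show "(\<lambda>t. \<phi> (\<gamma> t)) \<in> borel_measurable borel"
      by (rule usc_borel_measurable_curve[OF assms(3) \<gamma>(1)]) (use \<gamma>(2) assms(2) in blast)
    show "\<phi> (\<gamma> t) \<le> \<phi> p" for t
      by (rule p(2)[OF \<gamma>(2)])
    show "\<phi> (\<gamma> t) < \<phi> p" if "0 < cos t" for t
      by (rule p(3)[OF \<gamma>(2) \<gamma>(3)[OF that]])
  qed
  then show False
    using \<gamma>(4) by simp
qed

section \<open>From small circles to the unit circle\<close>

lemma usc_circle:
  fixes s :: "complex \<Rightarrow> real"
  assumes "\<And>c. open {x \<in> \<Omega>. s x < c}" "cball z r \<subseteq> \<Omega>" "0 \<le> r"
    and "\<And>x. x \<in> cball z r \<Longrightarrow> B \<le> s x"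
  shows usc_circle_measurable: "(\<lambda>t. s (z + of_real r * cis t)) \<in> borel_measurable borel"
    and usc_circle_bounded: "\<exists>B'. \<forall>t. \<bar>s (z + of_real r * cis t)\<bar> \<le> B'"
proof -
  have in_cball: "z + of_real r * cis t \<in> cball z r" for t
    using assms(3) by (simp add: dist_norm norm_mult)
  show "(\<lambda>t. s (z + of_real r * cis t)) \<in> borel_measurable borel"
    by (rule usc_borel_measurable_curve[OF assms(1)])
      (rule continuous_intros subsetD[OF assms(2) in_cball])+
  obtain B' where "\<And>t. \<bar>s (z + of_real r * cis t)\<bar> \<le> B'"
    using usc_bounded_curve[OF compact_cball assms(2,1,4) in_cball] by metis
  then show "\<exists>B'. \<forall>t. \<bar>s (z + of_real r * cis t)\<bar> \<le> B'"
    by (intro exI allI)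
qed

text \<open>
  The local mean value inequality passes to the unit circle because continuous functions on the
  circle are uniform limits of boundary values of harmonic polynomials.
\<close>

lemma local_submean_below_majorant:
  fixes s h :: "complex \<Rightarrow> real"
  assumes usc: "\<And>c. open {x \<in> \<Omega>. s x < c}" and sub: "cball 0 1 \<subseteq> \<Omega>"
    and lb: "\<And>x. x \<in> cball 0 1 \<Longrightarrow> B \<le> s x"
    and loc: "\<And>z. z \<in> ball 0 1 \<Longrightarrow> \<exists>\<rho>>0. \<forall>r. 0 < r \<and> r < \<rho> \<longrightarrow>
        s z \<le> integral\<^sup>L circle_prob (\<lambda>t. s (z + of_real r * cis t))"
    and h: "continuous_on (sphere 0 1) h" "\<And>x. x \<in> sphere 0 1 \<Longrightarrow> s x < h x"
  shows "s 0 \<le> integral\<^sup>L circle_prob (\<lambda>t. h (cis t))"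
proof (rule field_le_epsilon)
  fix e :: real
  assume "0 < e"
  have "continuous_on (sphere 0 1) (\<lambda>x. h x + e / 2)"
    using h(1) by (intro continuous_intros)
  \<comment> \<open>Approximating \<open>h + e / 2\<close> instead of \<open>h\<close> places Re p
    strictly between \<open>h\<close> and \<open>h + e\<close> on the circle: it still majorizes
    \<open>s\<close> there, and its mean exceeds that of \<open>h\<close> by at most
    \<open>e\<close>.\<close>
  then obtain p where p: "\<And>\<zeta>. \<zeta> \<in> sphere 0 1 \<Longrightarrow> \<bar>h \<zeta> + e / 2 - Re (poly p \<zeta>)\<bar> < e / 2"
    using Re_poly_dense_on_circle[of "\<lambda>x. h x + e / 2" "e / 2"] \<open>0 < e\<close> by auto
  define \<phi> where "\<phi> z = s z - Re (poly p z)" for z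
  have contp: "continuous_on A (\<lambda>z. Re (poly p z))" for A
    by (intro continuous_intros)
  have usc\<phi>: "open {x \<in> \<Omega>. \<phi> x < c}" for c
  proof -
    \<comment> \<open>A level \<open>d\<close> between the two functions splits the inequality into
      one for \<open>s\<close> and one for the polynomial, which writes the sublevel set as a union
      of open sets.\<close>
    have "\<phi> x < c \<longleftrightarrow> (\<exists>d. s x < d \<and> d < c + Re (poly p x))" for x
    proof
      assume "\<phi> x < c"
      then have "s x < c + Re (poly p x)"
        by (simp add: \<phi>_def)
      then show "\<exists>d. s x < d \<and> d < c + Re (poly p x)"
        by (rule dense)
    qed (auto simp: \<phi>_def)
    then have "{x \<in> \<Omega>. \<phi> x < c} = (\<Union>d. {x \<in> \<Omega>. s x < d} \<inter> {x. d < c + Re (poly p x)})"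
      by blast
    moreover have "open {x. d < c + Re (poly p x)}" for d
      by (rule open_Collect_less) (auto intro!: continuous_intros contp)
    ultimately show ?thesis
      using usc by (simp only:) (intro open_UN ballI open_Int)
  qed
  have "(0::complex) \<in> cball 0 1"
    by simp
  then obtain x0 where "\<forall>x\<in>cball 0 1. Re (poly p x) \<le> Re (poly p x0)"
    using continuous_attains_sup[OF compact_cball _ contp] by blast
  then obtain b where b: "\<And>x. x \<in> cball 0 1 \<Longrightarrow> Re (poly p x) \<le> b"
    by blast
  have "\<phi> 0 \<le> 0"
  proof (rule usc_maximum_principle[OF compact_cball sub usc\<phi>, where l = Re and B = "B - b"])
    show "\<exists>\<gamma>. continuous_on UNIV \<gamma> \<and> (\<forall>t. \<gamma> t \<in> cball 0 1) \<and> (\<forall>t. 0 < cos t \<longrightarrow> Re q < Re (\<gamma> t)) \<and>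
        \<phi> q \<le> integral\<^sup>L circle_prob (\<lambda>t. \<phi> (\<gamma> t))"
      if q: "q \<in> cball 0 1" "0 < \<phi> q" for q
    proof -
      have "q \<in> ball 0 1"
      proof (rule ccontr)
        assume "q \<notin> ball 0 1"
        then have "q \<in> sphere 0 1"
          using q(1) by auto
        then show False
          using h(2)[of q] p[of q] q(2) unfolding \<phi>_def by argo
      qed
      then obtain \<rho> where \<rho>: "0 < \<rho>" "\<And>r. 0 < r \<Longrightarrow> r < \<rho> \<Longrightarrow>
          s q \<le> integral\<^sup>L circle_prob (\<lambda>t. s (q + of_real r * cis t))"
        using loc by blast
      \<comment> \<open>Halving keeps \<open>r < \<rho>\<close>. The circle may touch the unit
        circle, because the maximum principle is applied on the closed disc.\<close>
      define r where "r = min (\<rho> / 2) (1 - cmod q)"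
      have r: "0 < r" "r < \<rho>" "r \<le> 1 - cmod q"
        using \<rho>(1) \<open>q \<in> ball 0 1\<close> by (auto simp: r_def min_def)
      have cb: "cball q r \<subseteq> cball 0 1"
        using r(3) by (simp add: cball_subset_cball_iff)
      define \<gamma> where "\<gamma> t = q + of_real r * cis t" for t
      have \<gamma>: "\<gamma> t \<in> cball 0 1" for t
        using r(1) by (intro subsetD[OF cb]) (simp add: \<gamma>_def dist_norm norm_mult)
      obtain B' where B': "\<forall>t. \<bar>s (\<gamma> t)\<bar> \<le> B'"
        unfolding \<gamma>_def using usc_circle_bounded[OF usc order_trans[OF cb sub] _ lb[OF subsetD[OF cb]]] r(1)
        by (meson less_imp_le)
      have "integrable circle_prob (\<lambda>t. s (\<gamma> t))"
        unfolding \<gamma>_def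
      proof (rule integrable_circle_prob_bounded)
        show "(\<lambda>t. s (q + complex_of_real r * cis t)) \<in> borel_measurable borel"
          using r(1) by (intro usc_circle_measurable[OF usc order_trans[OF cb sub] _ lb[OF subsetD[OF cb]]]) simp_all
      qed (use B' in \<open>auto simp: \<gamma>_def\<close>)
      moreover have "integrable circle_prob (\<lambda>t. Re (poly p (\<gamma> t)))"
        unfolding \<gamma>_def by (rule integrable_circle[OF contp]) (use r(1) in auto)
      ultimately have "integral\<^sup>L circle_prob (\<lambda>t. \<phi> (\<gamma> t))
          = integral\<^sup>L circle_prob (\<lambda>t. s (\<gamma> t)) - Re (poly p q)"
        using integral_circle_prob_Re_poly[of r p q] r(1) by (simp add: \<phi>_def \<gamma>_def)
      then have "\<phi> q \<le> integral\<^sup>L circle_prob (\<lambda>t. \<phi> (\<gamma> t))"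
        using \<rho>(2)[OF r(1,2)] by (simp add: \<phi>_def \<gamma>_def)
      moreover have "continuous_on UNIV \<gamma>"
        unfolding \<gamma>_def by (intro continuous_intros)
      moreover have "\<forall>t. 0 < cos t \<longrightarrow> Re q < Re (\<gamma> t)"
        using r(1) by (simp add: \<gamma>_def)
      ultimately show ?thesis
        using \<gamma> by blast
    qed
  next
    show "B - b \<le> \<phi> x" if "x \<in> cball 0 1" for x
      using lb[OF that] b[OF that] by (simp add: \<phi>_def)
  qed (auto intro!: continuous_intros)
  then have "s 0 \<le> Re (poly p 0)"
    by (simp add: \<phi>_def)
  also have "\<dots> = integral\<^sup>L circle_prob (\<lambda>t. Re (poly p (cis t)))"
    using integral_circle_prob_Re_poly[of 1 p 0] by simp
  also have "\<dots> \<le> integral\<^sup>L circle_prob (\<lambda>t. h (cis t) + e)"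
  proof (rule integral_mono)
    show "integrable circle_prob (\<lambda>t. Re (poly p (cis t)))"
      using integrable_circle[of 0 1 "\<lambda>z. Re (poly p z)"] contp by simp
    show "integrable circle_prob (\<lambda>t. h (cis t) + e)"
      using integrable_circle[OF h(1)] by simp
    show "Re (poly p (cis t)) \<le> h (cis t) + e" for t
      using p[of "cis t"] unfolding abs_less_iff by simp
  qed
  also have "\<dots> = integral\<^sup>L circle_prob (\<lambda>t. h (cis t)) + e"
    using integrable_circle[OF h(1)] by simp
  finally show "s 0 \<le> integral\<^sup>L circle_prob (\<lambda>t. h (cis t)) + e" .
qed

text \<open>
  The majorants \<open>h n x = sup (s \<xi> - n \<bar>x - \<xi>\<bar>) + 1 / (n + 1)\<close>, the supremum over \<open>\<xi>\<close> in the
  circle, are continuous and converge to the upper semicontinuous function \<open>s\<close>.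
\<close>

lemma local_submean_circle:
  fixes s :: "complex \<Rightarrow> real"
  assumes usc: "\<And>c. open {x \<in> \<Omega>. s x < c}" and sub: "cball 0 1 \<subseteq> \<Omega>"
    and lb: "\<And>x. x \<in> cball 0 1 \<Longrightarrow> B \<le> s x"
    and loc: "\<And>z. z \<in> ball 0 1 \<Longrightarrow> \<exists>\<rho>>0. \<forall>r. 0 < r \<and> r < \<rho> \<longrightarrow>
        s z \<le> integral\<^sup>L circle_prob (\<lambda>t. s (z + of_real r * cis t))"
  shows "s 0 \<le> integral\<^sup>L circle_prob (\<lambda>t. s (cis t))"
proof -
  let ?S = "sphere (0::complex) 1"
  have S: "1 \<in> ?S" "compact ?S" "?S \<subseteq> cball 0 1" "?S \<subseteq> \<Omega>"
    using sub by auto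
  obtain M where M: "\<And>x. x \<in> ?S \<Longrightarrow> s x \<le> M"
    using usc_attains_max[OF S(2) _ S(4) usc] S(1) by (metis empty_iff)
  have lbS: "B \<le> s x" if "x \<in> ?S" for x
    using lb S(3) that by blast
  define g where "g n x = (SUP \<xi>\<in>?S. s \<xi> - real n * dist x \<xi>)" for n x
  \<comment> \<open>The added positive term makes the majorant strict, as the comparison with
    continuous majorants demands.\<close>
  define h where "h n x = g n x + 1 / (real n + 1)" for n x
  have bdd: "bdd_above ((\<lambda>\<xi>. s \<xi> - real n * dist x \<xi>) ` ?S)" for n x
    using M by (intro bdd_aboveI2[where M = M]) (smt (verit) mult_nonneg_nonneg of_nat_0_le_iff zero_le_dist)
  have g_ge: "s x \<le> g n x" if "x \<in> ?S" for n x
    unfolding g_def using that by (intro cSUP_upper2[OF bdd, of x]) auto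
  have g_least: "g n x \<le> b" if "\<And>\<xi>. \<xi> \<in> ?S \<Longrightarrow> s \<xi> - real n * dist x \<xi> \<le> b" for n x b
    unfolding g_def using S(1) that by (intro cSUP_least) auto
  have g_le_M: "g n x \<le> M" for n x
    using M by (intro g_least) (smt (verit) mult_nonneg_nonneg of_nat_0_le_iff zero_le_dist)
  have g_lip: "g n x \<le> g n y + real n * dist x y" for n x y
  proof (rule g_least)
    fix \<xi> assume \<xi>: "\<xi> \<in> ?S"
    have "s \<xi> - real n * dist y \<xi> \<le> g n y"
      unfolding g_def using \<xi> by (intro cSUP_upper2[OF bdd, of \<xi>]) auto
    moreover have "real n * dist y \<xi> \<le> real n * (dist x y + dist x \<xi>)"
      by (intro mult_left_mono) (auto intro: dist_triangle3)
    ultimately show "s \<xi> - real n * dist x \<xi> \<le> g n y + real n * dist x y"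
      by (simp add: algebra_simps)
  qed
  have "(real n)-lipschitz_on ?S (g n)" for n
  proof (rule lipschitz_onI)
    show "dist (g n x) (g n y) \<le> real n * dist x y" for x y
      using g_lip[of n x y] g_lip[of n y x] by (simp add: dist_real_def abs_le_iff dist_commute)
  qed simp
  then have cont: "continuous_on ?S (h n)" for n
    unfolding h_def by (intro continuous_intros lipschitz_on_continuous_on)
  have h_conv: "(\<lambda>n. h n x) \<longlonglongrightarrow> s x" if x: "x \<in> ?S" for x
  proof -
    have "(\<lambda>n. g n x) \<longlonglongrightarrow> s x"
    proof (rule order_tendstoI)
      fix a assume "a < s x"
      then show "eventually (\<lambda>n. a < g n x) sequentially"
        using g_ge[OF x] by (intro always_eventually allI) (rule less_le_trans)
    next
      fix a assume "s x < a"
      then obtain a' where a': "s x < a'" "a' < a"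
        using dense by blast
      have "x \<in> {x \<in> \<Omega>. s x < a'}"
        using a' x S(4) by blast
      then obtain \<delta> where \<delta>: "0 < \<delta>" "\<And>\<xi>. dist \<xi> x < \<delta> \<Longrightarrow> s \<xi> < a'"
        using usc[of a'] unfolding open_dist by (metis (mono_tags, lifting) mem_Collect_eq)
      \<comment> \<open>At distance \<open>\<delta>\<close> or more the penalty is at least
        \<open>M - s x\<close>, so such points cannot lift the supremum above \<open>s x\<close>;
        nearer points have values below \<open>a'\<close> by semicontinuity.\<close>
      obtain N where N: "(M - s x) / \<delta> < real N"
        using reals_Archimedean2 by blast
      have "g n x < a" if "N \<le> n" for n
      proof -
        have "g n x \<le> a'"
        proof (rule g_least)
          fix \<xi> assume \<xi>: "\<xi> \<in> ?S"
          show "s \<xi> - real n * dist x \<xi> \<le> a'"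
          proof (cases "dist \<xi> x < \<delta>")
            case True
            then show ?thesis
              using \<delta>(2)[OF True] mult_nonneg_nonneg[OF of_nat_0_le_iff[of n] zero_le_dist[of x \<xi>]]
              by linarith
          next
            case False
            have "M - s x \<le> real N * \<delta>"
              using N \<delta>(1) by (simp add: field_simps)
            also have "\<dots> \<le> real n * dist x \<xi>"
              using False that \<delta>(1) by (intro mult_mono) (auto simp: dist_commute)
            finally show ?thesis
              using M[OF \<xi>] a'(1) by simp
          qed
        qed
        then show ?thesis
          using a'(2) by simp
      qed
      then show "eventually (\<lambda>n. g n x < a) sequentially"
        unfolding eventually_sequentially by blast
    qed
    moreover have "(\<lambda>n. 1 / (real n + 1)) \<longlonglongrightarrow> 0"
      using LIMSEQ_inverse_real_of_nat by (simp add: inverse_eq_divide add.commute)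
    ultimately show ?thesis
      unfolding h_def using tendsto_add by fastforce
  qed
  have cis: "cis t \<in> ?S" for t
    by simp
  have le: "s 0 \<le> integral\<^sup>L circle_prob (\<lambda>t. h n (cis t))" for n
  proof (rule local_submean_below_majorant[OF usc sub lb loc cont])
    show "s x < h n x" if "x \<in> ?S" for x
      using g_ge[OF that, of n] by (simp add: h_def add.commute[of "g n x"] add_strict_increasing)
  qed
  have "(\<lambda>n. integral\<^sup>L circle_prob (\<lambda>t. h n (cis t))) \<longlonglongrightarrow> integral\<^sup>L circle_prob (\<lambda>t. s (cis t))"
  proof (rule integral_dominated_convergence[where w = "\<lambda>t. \<bar>M\<bar> + \<bar>B\<bar> + 1"])
    show "(\<lambda>t. s (cis t)) \<in> borel_measurable circle_prob"
      using usc_circle_measurable[OF usc sub _ lb] by simp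
    show "(\<lambda>t. h n (cis t)) \<in> borel_measurable circle_prob" for n
      using borel_measurable_circle[OF cont] by simp
    show "AE t in circle_prob. (\<lambda>n. h n (cis t)) \<longlonglongrightarrow> s (cis t)"
      using h_conv[OF cis] by simp
    show "AE t in circle_prob. norm (h n (cis t)) \<le> \<bar>M\<bar> + \<bar>B\<bar> + 1" for n
    proof (rule AE_I2)
      fix t
      have "1 / (real n + 1) \<le> 1" "0 \<le> 1 / (real n + 1)"
        by auto
      then show "norm (h n (cis t)) \<le> \<bar>M\<bar> + \<bar>B\<bar> + 1"
        using g_ge[OF cis, of t n] lbS[OF cis, of t] g_le_M[of n "cis t"]
        unfolding h_def real_norm_def abs_le_iff by linarith
    qed
  qed auto
  then show ?thesis
    using le by (intro LIMSEQ_le_const) auto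
qed

section \<open>Gluing along a frontier\<close>

lemma psh_on_submean:
  assumes "psh_on D u" "\<And>\<zeta>. \<zeta> \<in> cball \<alpha> r \<Longrightarrow> a + \<zeta> *s b \<in> D" "0 < r"
  shows "u (a + \<alpha> *s b) \<le> circle_mean (\<lambda>\<zeta>. u (a + \<zeta> *s b)) \<alpha> r"
  using assms unfolding psh_on_def subharmonic_on_def by (auto simp: subset_iff)

lemma continuous_on_vector_smult [continuous_intros]:
  fixes f :: "'a::topological_space \<Rightarrow> complex" and g :: "'a \<Rightarrow> complex ^ 'n"
  assumes "continuous_on S f" "continuous_on S g"
  shows "continuous_on S (\<lambda>x. f x *s g x)"
  unfolding vector_scalar_mult_def using assms
  by (intro continuous_on_vec_lambda continuous_intros)

text \<open>
  The glued function is bounded below by the continuous \<open>u\<close>, hence real-valued, although \<open>v\<close> may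
  take the value \<open>-\<infinity>\<close>.
\<close>

lemma psh_on_glue_max:
  fixes u :: "complex ^ 'n \<Rightarrow> real"
  assumes D: "open D" "continuous_on D u" "psh_on D (\<lambda>z. ereal (u z))"
    and H: "open H" "H \<subseteq> D" "psh_on H v"
    and G: "open G" "closure G \<subseteq> H" "\<And>z. z \<in> frontier G \<Longrightarrow> v z \<le> ereal (u z)"
  shows "psh_on D (\<lambda>z. if z \<in> G then max (ereal (u z)) (v z) else ereal (u z))"
proof -
  define W where "W z = (if z \<in> G then max (ereal (u z)) (v z) else ereal (u z))" for z
  define w where "w z = real_of_ereal (W z)" for z
  have GH: "G \<subseteq> H"
    using G(2) closure_subset by blast
  have u_le_W: "ereal (u z) \<le> W z" for z
    by (auto simp: W_def)
  have v_le_W: "v z \<le> W z" if "z \<in> G" for z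
    using that by (auto simp: W_def)
  have v_fin: "v z < \<infinity>" if "z \<in> H" for z
    using H(3) that by (auto simp: psh_on_def)
  have W_fin: "W z < \<infinity>" for z
    using v_fin GH by (auto simp: W_def max_def)
  have W_eq: "W z = ereal (w z)" for z
    using u_le_W[of z] W_fin[of z] by (cases "W z") (auto simp: w_def)
  have u_le_w: "u z \<le> w z" for z
    using u_le_W[of z] by (simp add: W_eq)
  have usc_u: "open {z \<in> D. ereal (u z) < c}" for c
    using D(1,3) by (auto simp: psh_on_def usc_on_open_iff)
  have usc_v: "open {z \<in> H. v z < c}" for c
    using H(1,3) by (auto simp: psh_on_def usc_on_open_iff)
  have usc_W: "open {z \<in> D. W z < c}" for c
  proof -
    \<comment> \<open>On the frontier of \<open>G\<close>, where \<open>W = u\<close>, the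
      hypothesis \<open>v \<le> u\<close> makes \<open>v z < c\<close> follow from
      \<open>u z < c\<close>. This allows the sublevel set of \<open>v\<close> in the larger open
      set \<open>H\<close> to appear next to the complement of \<open>closure G\<close>.\<close>
    have "z \<in> {z \<in> D. W z < c} \<longleftrightarrow> z \<in> {z \<in> D. ereal (u z) < c} \<inter> ({z \<in> H. v z < c} \<union> (- closure G))" for z
    proof (cases "z \<in> G")
      case True
      then show ?thesis
        using GH closure_subset[of G] by (auto simp: W_def)
    next
      case False
      then have "z \<in> closure G \<Longrightarrow> z \<in> H \<and> v z \<le> ereal (u z)"
        using G by (auto simp: frontier_def interior_open)
      then show ?thesis
        using False by (auto simp: W_def)
    qed
    then have "{z \<in> D. W z < c} = {z \<in> D. ereal (u z) < c} \<inter> ({z \<in> H. v z < c} \<union> (- closure G))"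
      by blast
    then show ?thesis
      by (simp only:) (intro open_Int open_Un usc_u usc_v open_Compl closed_closure)
  qed
  have usc_w: "open {z \<in> D. w z < c}" for c
    using usc_W[of "ereal c"] by (simp add: W_eq)
  have "subharmonic_on {\<zeta>. a + \<zeta> *s b \<in> D} (\<lambda>\<zeta>. W (a + \<zeta> *s b))" for a b
    unfolding subharmonic_on_def
  proof (intro conjI allI impI ballI)
    have cont: "continuous_on UNIV (\<lambda>\<zeta>. a + \<zeta> *s b)"
      by (intro continuous_intros)
    have op: "open {\<zeta>. a + \<zeta> *s b \<in> D}"
      using open_vimage[OF D(1) cont] by (simp add: vimage_def)
    show "usc_on {\<zeta>. a + \<zeta> *s b \<in> D} (\<lambda>\<zeta>. W (a + \<zeta> *s b))"
      unfolding usc_on_open_iff[OF op] using open_vimage[OF usc_W cont] by (simp add: vimage_def)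
    show "W (a + \<zeta> *s b) < \<infinity>" for \<zeta>
      by (rule W_fin)
    fix \<alpha> R
    assume "0 < R \<and> cball \<alpha> R \<subseteq> {\<zeta>. a + \<zeta> *s b \<in> D}"
    then have R: "0 < R" "\<And>\<zeta>. \<zeta> \<in> cball \<alpha> R \<Longrightarrow> a + \<zeta> *s b \<in> D"
      by auto
    \<comment> \<open>The given disc is rescaled to the unit disc, where the passage from small
      circles is available.\<close>
    define L where "L z = a + (\<alpha> + of_real R * z) *s b" for z
    have contL: "continuous_on A L" for A
      unfolding L_def by (intro continuous_intros)
    define \<Omega> where "\<Omega> = {z. L z \<in> D}"
    define s where "s z = w (L z)" for z
    have op\<Omega>: "open \<Omega>"
      using open_vimage[OF D(1) contL] by (simp add: vimage_def \<Omega>_def)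
    have usc_s: "open {z \<in> \<Omega>. s z < c}" for c
      using open_vimage[OF usc_w contL] by (simp add: vimage_def \<Omega>_def s_def)
    have sub: "cball 0 1 \<subseteq> \<Omega>"
    proof
      fix z :: complex assume "z \<in> cball 0 1"
      then have "\<alpha> + of_real R * z \<in> cball \<alpha> R"
        using R(1) by (simp add: dist_norm norm_mult)
      then show "z \<in> \<Omega>"
        unfolding \<Omega>_def L_def mem_Collect_eq by (rule R(2))
    qed
    have lbK: "\<exists>B. \<forall>x\<in>K. B \<le> s x" if K: "compact K" "K \<subseteq> \<Omega>" for K
    proof -
      have "continuous_on K (\<lambda>z. u (L z))"
        by (rule continuous_on_compose2[OF D(2) contL]) (use K(2) in \<open>auto simp: \<Omega>_def\<close>)
      then have "bounded ((\<lambda>z. u (L z)) ` K)"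
        using K(1) by (intro compact_imp_bounded compact_continuous_image)
      then obtain B where B: "\<And>x. x \<in> K \<Longrightarrow> \<bar>u (L x)\<bar> \<le> B"
        unfolding bounded_iff by auto
      have "- B \<le> s x" if "x \<in> K" for x
        using B[OF that] u_le_w[of "L x"] unfolding s_def by linarith
      then show ?thesis by blast
    qed
    \<comment> \<open>On such circles \<open>w\<close> is real and bounded, so the mean of
      \<open>W\<close> is an ordinary integral. This serves the small circles as well as the given
      one, which is the case \<open>z = 0\<close>, \<open>r = 1\<close>.\<close>
    have mean_eq: "circle_mean (\<lambda>\<zeta>. W (a + \<zeta> *s b)) (\<alpha> + of_real R * z) (R * r)
        = ereal (integral\<^sup>L circle_prob (\<lambda>t. s (z + of_real r * cis t)))"
      if r: "0 \<le> r" "cball z r \<subseteq> \<Omega>" for z r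
    proof -
      obtain B where B: "\<And>x. x \<in> cball z r \<Longrightarrow> B \<le> s x"
        using lbK[OF compact_cball r(2)] by blast
      have eq: "w (a + (\<alpha> + of_real R * z + of_real (R * r) * cis t) *s b) = s (z + of_real r * cis t)" for t
        by (simp add: s_def L_def algebra_simps)
      obtain B' where "\<And>t. \<bar>s (z + of_real r * cis t)\<bar> \<le> B'"
        using usc_circle_bounded[OF usc_s r(2,1) B] by blast
      then show ?thesis
        unfolding W_eq using usc_circle_measurable[OF usc_s r(2,1) B]
        by (subst circle_mean_real[where B = B']) (simp_all only: eq)
    qed
    obtain B where B: "\<And>x. x \<in> cball 0 1 \<Longrightarrow> B \<le> s x"
      using lbK[OF compact_cball sub] by blast
    have "s 0 \<le> integral\<^sup>L circle_prob (\<lambda>t. s (cis t))"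
    proof (rule local_submean_circle[OF usc_s sub B])
      fix z :: complex assume z: "z \<in> ball 0 1"
      \<comment> \<open>Each candidate for \<open>W\<close> is tested only where it is active. Off
        \<open>G\<close> this is \<open>u\<close>, which has the mean value inequality on all
        circles in \<open>\<Omega>\<close>; at points of \<open>G\<close> the circle must stay in
        \<open>G\<close>, where \<open>v \<le> W\<close>.\<close>
      obtain \<rho> where \<rho>: "0 < \<rho>" "ball z \<rho> \<subseteq> \<Omega>" "L z \<in> G \<Longrightarrow> ball z \<rho> \<subseteq> {z. L z \<in> G}"
      proof (cases "L z \<in> G")
        case True
        have "open {z. L z \<in> G}"
          using open_vimage[OF G(1) contL] by (simp add: vimage_def)
        then obtain \<rho> where "0 < \<rho>" "ball z \<rho> \<subseteq> {z. L z \<in> G}"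
          using True open_contains_ball by blast
        moreover have "{z. L z \<in> G} \<subseteq> \<Omega>"
          using GH H(2) by (auto simp: \<Omega>_def)
        ultimately show ?thesis
          using that by blast
      next
        case False
        have "z \<in> \<Omega>"
          using z sub by (meson ball_subset_cball subsetD)
        then show ?thesis
          using that False op\<Omega> open_contains_ball by blast
      qed
      have "s z \<le> integral\<^sup>L circle_prob (\<lambda>t. s (z + of_real r * cis t))" if r: "0 < r" "r < \<rho>" for r
      proof -
        have cb: "cball z r \<subseteq> ball z \<rho>"
          using r by (simp add: cball_subset_ball_iff)
        have L_in: "\<exists>x. x \<in> cball z r \<and> a + \<zeta> *s b = L x" if "\<zeta> \<in> cball (\<alpha> + of_real R * z) (R * r)" for \<zeta>
        proof -
          define x where "x = (\<zeta> - \<alpha>) / of_real R"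
          have eq: "\<zeta> = \<alpha> + of_real R * x"
            using R(1) by (simp add: x_def)
          have "dist (\<alpha> + of_real R * z) \<zeta> = norm (of_real R * (z - x))"
            by (simp add: eq dist_norm right_diff_distrib)
          also have "\<dots> = R * dist z x"
            using R(1) by (simp only: norm_mult dist_norm) simp
          finally have "x \<in> cball z r"
            using that R(1) by simp
          then show ?thesis
            by (auto simp: L_def eq)
        qed
        have "ereal (u (L z)) \<le> circle_mean (\<lambda>\<zeta>. ereal (u (a + \<zeta> *s b))) (\<alpha> + of_real R * z) (R * r)"
          unfolding L_def
        proof (rule psh_on_submean[OF D(3)])
          show "a + \<zeta> *s b \<in> D" if "\<zeta> \<in> cball (\<alpha> + of_real R * z) (R * r)" for \<zeta>
            using L_in[OF that] order_trans[OF cb \<rho>(2)] unfolding \<Omega>_def by auto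
        qed (use R r in auto)
        also have "\<dots> \<le> circle_mean (\<lambda>\<zeta>. W (a + \<zeta> *s b)) (\<alpha> + of_real R * z) (R * r)"
          by (rule circle_mean_mono) (rule u_le_W)
        finally have 1: "ereal (u (L z)) \<le> circle_mean (\<lambda>\<zeta>. W (a + \<zeta> *s b)) (\<alpha> + of_real R * z) (R * r)" .
        have 2: "v (L z) \<le> circle_mean (\<lambda>\<zeta>. W (a + \<zeta> *s b)) (\<alpha> + of_real R * z) (R * r)" if LG: "L z \<in> G"
        proof -
          have in_G: "a + \<zeta> *s b \<in> G" if "\<zeta> \<in> cball (\<alpha> + of_real R * z) (R * r)" for \<zeta>
            using L_in[OF that] order_trans[OF cb \<rho>(3)[OF LG]] by auto
          have "v (L z) \<le> circle_mean (\<lambda>\<zeta>. v (a + \<zeta> *s b)) (\<alpha> + of_real R * z) (R * r)"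
            unfolding L_def using in_G GH R(1) r(1) by (intro psh_on_submean[OF H(3)]) auto
          also have "\<dots> \<le> circle_mean (\<lambda>\<zeta>. W (a + \<zeta> *s b)) (\<alpha> + of_real R * z) (R * r)"
            by (rule circle_mean_mono, rule v_le_W, rule in_G)
              (use R(1) r(1) in \<open>simp add: dist_norm norm_mult\<close>)
          finally show ?thesis .
        qed
        have "W (L z) \<le> circle_mean (\<lambda>\<zeta>. W (a + \<zeta> *s b)) (\<alpha> + of_real R * z) (R * r)"
          using 1 2 by (cases "L z \<in> G") (auto simp: W_def[of "L z"])
        then show ?thesis
          using mean_eq[of r z] r(1) cb \<rho>(2) by (simp add: W_eq s_def)
      qed
      then show "\<exists>\<rho>>0. \<forall>r. 0 < r \<and> r < \<rho> \<longrightarrow> s z \<le> integral\<^sup>L circle_prob (\<lambda>t. s (z + of_real r * cis t))"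
        using \<rho>(1) by blast
    qed
    then show "W (a + \<alpha> *s b) \<le> circle_mean (\<lambda>\<zeta>. W (a + \<zeta> *s b)) \<alpha> R"
      using mean_eq[of 1 0] sub by (simp add: W_eq s_def L_def)
  qed
  moreover have "usc_on D W"
    using usc_W D(1) by (simp add: usc_on_open_iff)
  ultimately have "psh_on D W"
    using W_fin by (simp add: psh_on_def)
  then show ?thesis
    by (simp add: W_def[abs_def])
qed

lemma norm_vector_smult: "norm (c *s x) = norm c * norm x" for x :: "complex ^ 'n"
  by (simp add: norm_vec_def norm_mult L2_set_right_distrib)

lemma norm_axis_complex: "norm (axis i c :: complex ^ 'n) = norm c"
proof -
  have "norm (axis i c $ j) = (if j = i then norm c else 0)" for j :: 'n
    by (simp add: axis_def)
  then show ?thesis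
    by (simp add: norm_vec_def L2_set_def if_distrib[of "\<lambda>x. x ^ 2"] cong: if_cong)
qed

section \<open>Restriction, comparison, and maximality on the cluster\<close>

lemma psh_on_subset:
  fixes u :: "complex ^ 'a \<Rightarrow> ereal"
  assumes "psh_on D u" "open D" "open H" "H \<subseteq> D"
  shows "psh_on H u"
  unfolding psh_on_def subharmonic_on_def
proof (intro conjI allI impI ballI)
  have usc: "open {z \<in> D. u z < c}" for c
    using assms(1,2) by (auto simp: psh_on_def usc_on_open_iff)
  have "{z \<in> H. u z < c} = {z \<in> D. u z < c} \<inter> H" for c
    using assms(4) by blast
  then have usc_H: "open {z \<in> H. u z < c}" for c
    using usc assms(3) by (simp add: open_Int)
  then show "usc_on H u"
    using assms(3) by (simp add: usc_on_open_iff)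
  show fin: "u z < \<infinity>" if "z \<in> H" for z
    using assms that by (auto simp: psh_on_def)
  fix a b :: "complex ^ 'a"
  have cont: "continuous_on UNIV (\<lambda>\<zeta>. a + \<zeta> *s b)"
    by (intro continuous_intros)
  have op: "open {\<zeta>. a + \<zeta> *s b \<in> H}"
    using open_vimage[OF assms(3) cont] by (simp add: vimage_def)
  show "usc_on {\<zeta>. a + \<zeta> *s b \<in> H} (\<lambda>\<zeta>. u (a + \<zeta> *s b))"
    unfolding usc_on_open_iff[OF op] using open_vimage[OF usc_H cont] by (simp add: vimage_def)
  show "u (a + \<zeta> *s b) < \<infinity>" if "\<zeta> \<in> {\<zeta>. a + \<zeta> *s b \<in> H}" for \<zeta>
    using that fin by simp
  show "u (a + \<alpha> *s b) \<le> circle_mean (\<lambda>\<zeta>. u (a + \<zeta> *s b)) \<alpha> r"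
    if "0 < r \<and> cball \<alpha> r \<subseteq> {\<zeta>. a + \<zeta> *s b \<in> H}" for \<alpha> r
    using that assms(4) by (intro psh_on_submean[OF assms(1)]) auto
qed

text \<open>The difference of \<open>u\<close> and \<open>v\<close> satisfies the mean value
  inequality along complex lines and is at most 0 on the frontier, so the maximum principle applies
  once infinite values have been removed.\<close>

lemma psh_le_plurisuperharmonic:
  fixes u :: "complex ^ 'n \<Rightarrow> real"
  assumes u: "continuous_on H u" "psh_on H (\<lambda>z. ereal (u z))"
    and v: "plurisuperharmonic_on H v"
    and H: "open H"
    and G: "open G" "compact (closure G)" "closure G \<subseteq> H" "\<And>z. z \<in> frontier G \<Longrightarrow> ereal (u z) \<le> v z"
    and z: "z \<in> G"
  shows "ereal (u z) \<le> v z"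
proof -
  have "bounded (u ` closure G)"
    using u(1) G(2,3) by (intro compact_imp_bounded compact_continuous_image) (auto intro: continuous_on_subset)
  then obtain B where B: "\<And>x. x \<in> closure G \<Longrightarrow> \<bar>u x\<bar> \<le> B"
    unfolding bounded_iff by auto
  have GH: "G \<subseteq> H"
    using G(3) closure_subset by blast
  have psh_v: "psh_on H (\<lambda>z. - v z)"
    using v by (simp add: plurisuperharmonic_on_def)
  \<comment> \<open>Truncating \<open>- v\<close> at \<open>- B\<close> makes it real and loses
    nothing: because \<open>- B \<le> - u\<close> on \<open>closure G\<close>, the inequality
    \<open>u + v' \<le> 0\<close> there is still equivalent to \<open>u \<le> v\<close>.\<close>
  define v' where "v' x = real_of_ereal (max (- v x) (ereal (- B)))" for x
  have v': "ereal (v' x) = max (- v x) (ereal (- B))" if "x \<in> H" for x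
  proof -
    have "- v x < \<infinity>"
      using psh_v that by (auto simp: psh_on_def)
    then have "\<bar>max (- v x) (ereal (- B))\<bar> \<noteq> \<infinity>"
      by (cases "v x") (auto simp: max_def)
    then show ?thesis
      by (simp add: v'_def ereal_real)
  qed
  define \<phi> where "\<phi> x = u x + v' x" for x
  have usc_v': "open {x \<in> H. v' x < c}" for c
  proof -
    have "open {x \<in> H. - v x < ereal c}"
      using psh_v H by (auto simp: psh_on_def usc_on_open_iff)
    moreover have "{x \<in> H. v' x < c} = (if - B < c then {x \<in> H. - v x < ereal c} else {})"
    proof -
      have "v' x < c \<longleftrightarrow> - v x < ereal c \<and> - B < c" if "x \<in> H" for x
        using v'[OF that] by (metis ereal_less(2) max_less_iff_conj less_ereal.simps(1))
      then show ?thesis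
        by auto
    qed
    ultimately show ?thesis
      by simp
  qed
  have usc_u: "open {x \<in> H. u x < c}" for c
    using u(2) H by (simp add: psh_on_def usc_on_ereal_open_iff)
  have usc: "open {x \<in> H. \<phi> x < c}" for c
  proof -
    have "\<phi> x < c \<longleftrightarrow> (\<exists>d. u x < d \<and> v' x < c - d)" for x
    proof
      assume "\<phi> x < c"
      then have "u x < c - v' x"
        by (simp add: \<phi>_def)
      then obtain d where "u x < d" "d < c - v' x"
        using dense by blast
      then show "\<exists>d. u x < d \<and> v' x < c - d"
        by (intro exI[of _ d]) simp
    qed (auto simp: \<phi>_def)
    then have "{x \<in> H. \<phi> x < c} = (\<Union>d. {x \<in> H. u x < d} \<inter> {x \<in> H. v' x < c - d})"
      by blast
    also have "open \<dots>"
      using usc_u usc_v' by (intro open_UN ballI open_Int)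
    finally show ?thesis .
  qed
  have lb: "- B \<le> v' x" if "x \<in> H" for x
    using v'[OF that] by (metis ereal_less_eq(3) max.cobounded2)
  \<comment> \<open>\<open>undefined\<close> merely names one index of the coordinate type. The
    circles below run in this coordinate, so \<open>l\<close> exceeds its value at the centre
    exactly where \<open>0 < cos t\<close>.\<close>
  define l where "l x = Re (x $ undefined)" for x :: "complex ^ 'n"
  have "\<phi> z \<le> 0"
  proof (rule usc_maximum_principle[OF G(2,3) usc, where l = l and B = "- B - B"])
    show "continuous_on (closure G) l"
      unfolding l_def by (intro continuous_intros)
    show "- B - B \<le> \<phi> x" if "x \<in> closure G" for x
    proof -
      have "x \<in> H"
        using that G(3) by blast
      then show ?thesis
        using lb[of x] B[OF that] unfolding \<phi>_def abs_le_iff by linarith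
    qed
    show "z \<in> closure G"
      using z closure_subset by blast
    fix p assume p: "p \<in> closure G" "0 < \<phi> p"
    have "p \<in> G"
    proof (rule ccontr)
      assume "p \<notin> G"
      then have fr: "p \<in> frontier G"
        using p(1) G(1) by (simp add: frontier_def interior_open)
      have "- v p \<le> ereal (- u p)"
        using iffD2[OF ereal_minus_le_minus G(4)[OF fr]] by simp
      moreover have "- B \<le> - u p"
        using B[OF p(1)] by simp
      ultimately have "ereal (v' p) \<le> ereal (- u p)"
        unfolding v'[OF subsetD[OF G(3) p(1)]] by (intro max.boundedI) simp_all
      then show False
        using p(2) by (simp add: \<phi>_def)
    qed
    then obtain e where e: "0 < e" "ball p e \<subseteq> G"
      using G(1) open_contains_ball by blast
    define b :: "complex ^ 'n" where "b = axis undefined 1"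
    have norm_b: "norm (\<zeta> *s b) = cmod \<zeta>" for \<zeta>
      by (simp add: b_def norm_vector_smult norm_axis_complex)
    define r where "r = e / 2"
    have r: "0 < r"
      using e(1) by (simp add: r_def)
    have in_G: "p + \<zeta> *s b \<in> G" if "\<zeta> \<in> cball 0 r" for \<zeta>
      using that e by (intro subsetD[OF e(2)]) (simp add: dist_norm norm_b r_def)
    define \<gamma> where "\<gamma> t = p + (of_real r * cis t) *s b" for t
    have \<gamma>_G: "\<gamma> t \<in> G" for t
      unfolding \<gamma>_def using r by (intro in_G) (simp add: norm_mult)
    have \<gamma>_H: "\<gamma> t \<in> H" and \<gamma>_cl: "\<gamma> t \<in> closure G" for t
      using \<gamma>_G GH closure_subset by blast+
    have cont: "continuous_on UNIV \<gamma>"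
      unfolding \<gamma>_def by (intro continuous_intros)
    have contL: "continuous_on UNIV (\<lambda>\<zeta>. p + \<zeta> *s b)"
      by (intro continuous_intros)
    have m_u: "(\<lambda>t. u (\<gamma> t)) \<in> borel_measurable borel"
      by (rule usc_borel_measurable_curve[OF usc_u cont \<gamma>_H])
    have m_v: "(\<lambda>t. v' (\<gamma> t)) \<in> borel_measurable borel"
      by (rule usc_borel_measurable_curve[OF usc_v' cont \<gamma>_H])
    have B_u: "\<bar>u (\<gamma> t)\<bar> \<le> B" for t
      by (rule B[OF \<gamma>_cl])
    obtain C where C: "\<And>t. \<bar>v' (\<gamma> t)\<bar> \<le> C"
      using usc_bounded_curve[OF G(2,3) usc_v', of "- B" \<gamma>] lb G(3) \<gamma>_cl by (metis subsetD)
    have int_u: "integrable circle_prob (\<lambda>t. u (\<gamma> t))"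
      by (rule integrable_circle_prob_bounded[OF m_u]) (use B_u in simp)
    have int_v: "integrable circle_prob (\<lambda>t. v' (\<gamma> t))"
      by (rule integrable_circle_prob_bounded[OF m_v]) (use C in simp)
    have "ereal (u (p + 0 *s b)) \<le> circle_mean (\<lambda>\<zeta>. ereal (u (p + \<zeta> *s b))) 0 r"
      using in_G GH r by (intro psh_on_submean[OF u(2)]) auto
    also have "\<dots> = ereal (integral\<^sup>L circle_prob (\<lambda>t. u (\<gamma> t)))"
      using m_u B_u by (subst circle_mean_real[where B = B]) (simp_all add: \<gamma>_def)
    finally have sub_u: "u p \<le> integral\<^sup>L circle_prob (\<lambda>t. u (\<gamma> t))"
      by simp
    have "- v (p + 0 *s b) \<le> circle_mean (\<lambda>\<zeta>. - v (p + \<zeta> *s b)) 0 r"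
      using in_G GH r by (intro psh_on_submean[OF psh_v]) auto
    also have "\<dots> \<le> circle_mean (\<lambda>\<zeta>. ereal (v' (p + \<zeta> *s b))) 0 r"
    proof (rule circle_mean_mono)
      fix t
      have "p + (0 + complex_of_real r * cis t) *s b = \<gamma> t"
        by (simp add: \<gamma>_def)
      then show "- v (p + (0 + complex_of_real r * cis t) *s b) \<le> ereal (v' (p + (0 + complex_of_real r * cis t) *s b))"
        using v'[OF \<gamma>_H[of t]] by simp
    qed
    also have "\<dots> = ereal (integral\<^sup>L circle_prob (\<lambda>t. v' (\<gamma> t)))"
      using m_v C by (subst circle_mean_real[where B = C]) (simp_all add: \<gamma>_def)
    finally have 1: "- v p \<le> ereal (integral\<^sup>L circle_prob (\<lambda>t. v' (\<gamma> t)))"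
      by simp
    have "integral\<^sup>L circle_prob (\<lambda>t. - B) \<le> integral\<^sup>L circle_prob (\<lambda>t. v' (\<gamma> t))"
      using int_v lb[OF \<gamma>_H] by (intro integral_mono) auto
    then have "ereal (v' p) \<le> ereal (integral\<^sup>L circle_prob (\<lambda>t. v' (\<gamma> t)))"
      unfolding v'[OF subsetD[OF GH \<open>p \<in> G\<close>]] using 1 by (intro max.boundedI) simp_all
    then have "\<phi> p \<le> integral\<^sup>L circle_prob (\<lambda>t. \<phi> (\<gamma> t))"
      using sub_u int_u int_v by (simp add: \<phi>_def)
    moreover have "0 < cos t \<longrightarrow> l p < l (\<gamma> t)" for t
      using r by (simp add: \<gamma>_def b_def l_def)
    ultimately show "\<exists>\<gamma>. continuous_on UNIV \<gamma> \<and> (\<forall>t. \<gamma> t \<in> closure G) \<and>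
        (\<forall>t. 0 < cos t \<longrightarrow> l p < l (\<gamma> t)) \<and>
        \<phi> p \<le> integral\<^sup>L circle_prob (\<lambda>t. \<phi> (\<gamma> t))"
      using cont \<gamma>_cl by blast
  qed
  moreover have zH: "z \<in> H"
    using z GH by blast
  ultimately have "ereal (v' z) \<le> ereal (- u z)"
    by (simp add: \<phi>_def)
  then have "- v z \<le> - ereal (u z)"
    using v'[OF zH] by simp
  then show ?thesis
    by (simp only: ereal_minus_le_minus)
qed

lemma maximal_psh_imp_maximal_on_cluster:
  fixes u :: "complex ^ 'n \<Rightarrow> real"
  assumes D: "open D" "continuous_on D u" "maximal_psh_on D (\<lambda>z. ereal (u z))"
    and cl: "D \<subseteq> cluster L"
  shows "maximal_on_cluster D L (\<lambda>z. ereal (u z))"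
proof -
  have psh: "psh_on D (\<lambda>z. ereal (u z))"
    using D(3) by (simp add: maximal_psh_on_def)
  have clD: "cluster L \<inter> D = D"
    using cl by blast
  show ?thesis
    unfolding maximal_on_cluster_def
  proof (intro conjI allI impI ballI)
    show "usc_on (cluster L \<inter> D) (\<lambda>z. ereal (u z))"
      using psh by (simp add: clD psh_on_def)
  next
    fix G H v z
    assume GH: "domain_set G \<and> domain_set H \<and> G \<subset>\<subset> H \<and> H \<subset>\<subset> D"
      and v: "psh_on H v \<and> (\<forall>z\<in>cluster L \<inter> frontier G. v z \<le> ereal (u z))"
      and z: "z \<in> cluster L \<inter> G"
    have sub: "closure G \<subseteq> H" "H \<subseteq> D"
      using GH closure_subset[of H] by (auto simp: rel_compact_in_def)
    have fr: "v x \<le> ereal (u x)" if "x \<in> frontier G" for x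
      using v that sub cl by (auto simp: frontier_def)
    define w where "w x = (if x \<in> G then max (ereal (u x)) (v x) else ereal (u x))" for x
    have "psh_on D w"
      unfolding w_def using GH v sub fr psh D
      by (intro psh_on_glue_max[of D u H]) (auto simp: domain_set_def)
    moreover have "\<forall>x\<in>frontier G. w x \<le> ereal (u x)"
      using fr by (simp add: w_def)
    moreover have "G \<subset>\<subset> D"
      using GH sub by (auto simp: rel_compact_in_def)
    ultimately have "\<forall>x\<in>G. w x \<le> ereal (u x)"
      using D(3) GH unfolding maximal_psh_on_def by blast
    then show "v z \<le> ereal (u z)"
      using z by (auto simp: w_def)
  next
    fix G H v z
    assume GH: "domain_set G \<and> domain_set H \<and> G \<subset>\<subset> H \<and> H \<subset>\<subset> D"
      and v: "plurisuperharmonic_on H v \<and> (\<forall>z\<in>cluster L \<inter> frontier G. ereal (u z) \<le> v z)"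
      and z: "z \<in> cluster L \<inter> G"
    have sub: "closure G \<subseteq> H" "H \<subseteq> D"
      using GH closure_subset[of H] by (auto simp: rel_compact_in_def)
    have "ereal (u x) \<le> v x" if "x \<in> frontier G" for x
      using v that sub cl by (auto simp: frontier_def)
    moreover have "psh_on H (\<lambda>z. ereal (u z))"
      using GH by (intro psh_on_subset[OF psh D(1) _ sub(2)]) (simp add: domain_set_def)
    ultimately show "ereal (u z) \<le> v z"
      using GH v z continuous_on_subset[OF D(2) sub(2)]
      by - (rule psh_le_plurisuperharmonic[of H u v G], simp_all add: domain_set_def rel_compact_in_def)
  qed
qed

section \<open>Vector-valued polynomials on the disc\<close>

text \<open>The pair consists of a degree bound and a coefficient sequence whose entries beyond the
  bound are ignored.\<close>

definition vpoly :: "nat \<times> (nat \<Rightarrow> complex ^ 'n) \<Rightarrow> complex \<Rightarrow> complex ^ 'n" where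
  "vpoly p \<zeta> = (\<Sum>k\<le>fst p. \<zeta> ^ k *s snd p k)"

definition energy :: "nat \<times> (nat \<Rightarrow> complex ^ 'n) \<Rightarrow> real" where
  "energy p = (\<Sum>k\<le>fst p. (norm (snd p k))\<^sup>2)"

text \<open>Partial sums of one series: the increment has terms of higher degree only, which makes
  it orthogonal on the circle to the old boundary values.\<close>

definition extends :: "nat \<times> (nat \<Rightarrow> complex ^ 'n) \<Rightarrow> nat \<times> (nat \<Rightarrow> complex ^ 'n) \<Rightarrow> bool" where
  "extends p q \<longleftrightarrow> fst p \<le> fst q \<and> (\<forall>k\<le>fst p. snd q k = snd p k)"

lemma extends_refl [simp]: "extends p p"
  by (simp add: extends_def)

lemma extends_trans: "extends p q \<Longrightarrow> extends q r \<Longrightarrow> extends p r"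
  by (auto simp: extends_def)

lemma continuous_on_vpoly [continuous_intros]: "continuous_on S (vpoly p)"
  unfolding vpoly_def[abs_def] by (intro continuous_intros)

text \<open>The real inner product is the real part of the Hermitian one, in which the two phases
  combine to \<open>s - t\<close>. Integration over the circle then annihilates pairs of terms of
  different degree.\<close>

lemma inner_vector_smult_cis:
  fixes x y :: "complex ^ 'n"
  shows "(cis s *s x) \<bullet> (cis t *s y)
    = cos (s - t) * Re (\<Sum>i\<in>UNIV. x $ i * cnj (y $ i)) - sin (s - t) * Im (\<Sum>i\<in>UNIV. x $ i * cnj (y $ i))"
proof -
  have "(cis s *s x) \<bullet> (cis t *s y) = (\<Sum>i\<in>UNIV. Re (cis (s - t) * (x $ i * cnj (y $ i))))"
    unfolding inner_vec_def
  proof (rule sum.cong[OF refl])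
    fix i
    have "z \<bullet> w = Re (z * cnj w)" for z w :: complex
      by (simp add: inner_complex_def)
    then have "((cis s *s x) $ i) \<bullet> ((cis t *s y) $ i) = Re ((cis s * x $ i) * cnj (cis t * y $ i))"
      by (simp only: vector_smult_component)
    also have "(cis s * x $ i) * cnj (cis t * y $ i) = (cis s * cis (- t)) * (x $ i * cnj (y $ i))"
      by (simp add: cis_cnj mult_ac)
    also have "cis s * cis (- t) = cis (s - t)"
      by (simp add: cis_mult)
    finally show "((cis s *s x) $ i) \<bullet> ((cis t *s y) $ i) = Re (cis (s - t) * (x $ i * cnj (y $ i)))" .
  qed
  also have "\<dots> = Re (cis (s - t) * (\<Sum>i\<in>UNIV. x $ i * cnj (y $ i)))"
    by (simp only: sum_distrib_left Re_sum)
  finally show ?thesis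
    by simp
qed

lemma parseval_vpoly: "integral\<^sup>L circle_prob (\<lambda>t. (norm (vpoly p (cis t)))\<^sup>2) = energy p"
proof -
  define d a where "d = fst p" and "a = snd p"
  define c where "c k l = (\<Sum>i\<in>UNIV. a k $ i * cnj (a l $ i))" for k l
  define I where "I k l t = cos (of_int (int k - int l) * t) * Re (c k l) - sin (of_int (int k - int l) * t) * Im (c k l)"
    for k l and t :: real
  have I: "(cis t ^ k *s a k) \<bullet> (cis t ^ l *s a l) = I k l t" for k l t
    unfolding Complex.DeMoivre inner_vector_smult_cis by (simp add: I_def c_def left_diff_distrib)
  have eq: "(norm (vpoly p (cis t)))\<^sup>2 = (\<Sum>k\<le>d. \<Sum>l\<le>d. I k l t)" for t
    unfolding power2_norm_eq_inner vpoly_def by (simp add: inner_sum_left inner_sum_right I flip: d_def a_def) (rule sum.swap)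
  have int: "integrable circle_prob (\<lambda>t. cos (x * t))" "integrable circle_prob (\<lambda>t. sin (x * t))" for x
    by (rule integrable_circle_prob_bounded[where B = 1]; simp)+
  have int_I: "integrable circle_prob (I k l)" for k l
    unfolding I_def[abs_def] by (intro Bochner_Integration.integrable_diff integrable_mult_left int)
  have "integral\<^sup>L circle_prob (I k l) = (if l = k then (norm (a k))\<^sup>2 else 0)" for k l
  proof -
    have "integral\<^sup>L circle_prob (I k l)
        = integral\<^sup>L circle_prob (\<lambda>t. cos (of_int (int k - int l) * t)) * Re (c k l)
          - integral\<^sup>L circle_prob (\<lambda>t. sin (of_int (int k - int l) * t)) * Im (c k l)"
      unfolding I_def[abs_def] using int by (simp del: of_int_diff)
    moreover have "Re (c k k) = (norm (a k))\<^sup>2"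
      using I[of 0 k k] by (simp add: I_def power2_norm_eq_inner)
    ultimately show ?thesis
      using integral_circle_prob_cos[of "int k - int l"] integral_circle_prob_sin[of "int k - int l"]
      by auto
  qed
  then show ?thesis
    unfolding eq using int_I by (simp add: energy_def flip: d_def a_def)
qed

text \<open>The difference is itself a vector polynomial, with the coefficients shared with
  \<open>p\<close> set to 0; Parseval for it gives the theorem of Pythagoras.\<close>

lemma extends_energy_diff:
  assumes "extends p q"
  shows "integral\<^sup>L circle_prob (\<lambda>t. (norm (vpoly q (cis t) - vpoly p (cis t)))\<^sup>2) = energy q - energy p"
proof -
  define r where "r = (fst q, \<lambda>k. if k \<le> fst p then 0 else snd q k)"
  have split: "{..fst q} = {..fst p} \<union> {fst p<..fst q}" "{..fst p} \<inter> {fst p<..fst q} = {}"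
    using assms by (auto simp: extends_def)
  have sum_q: "(\<Sum>k\<le>fst q. F k (snd q k)) = (\<Sum>k\<le>fst p. F k (snd p k)) + (\<Sum>k\<in>{fst p<..fst q}. F k (snd q k))"
    for F :: "nat \<Rightarrow> complex ^ 'a \<Rightarrow> 'b::comm_monoid_add"
    unfolding split(1) using assms split(2) by (subst sum.union_disjoint) (auto simp: extends_def)
  have sum_r: "(\<Sum>k\<le>fst q. F k (snd r k)) = (\<Sum>k\<in>{fst p<..fst q}. F k (snd q k))"
    if "\<And>k. F k 0 = 0" for F :: "nat \<Rightarrow> complex ^ 'a \<Rightarrow> 'b::comm_monoid_add"
    unfolding split(1) using split(2) that by (subst sum.union_disjoint) (auto simp: r_def)
  have "vpoly r \<zeta> = vpoly q \<zeta> - vpoly p \<zeta>" for \<zeta>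
    using sum_q[of "\<lambda>k x. \<zeta> ^ k *s x"] sum_r[of "\<lambda>k x. \<zeta> ^ k *s x"] by (simp add: vpoly_def r_def)
  moreover have "energy r = energy q - energy p"
    using sum_q[of "\<lambda>k x. (norm x)\<^sup>2"] sum_r[of "\<lambda>k x. (norm x)\<^sup>2"] by (simp add: energy_def r_def)
  ultimately show ?thesis
    using parseval_vpoly[of r] by simp
qed

lemma extends_energy_mono: "extends p q \<Longrightarrow> energy p \<le> energy q"
  using extends_energy_diff[of p q] by (metis (no_types, lifting) diff_ge_0_iff_ge integral_nonneg_AE AE_I2 zero_le_power2)

text \<open>
  On the circle, multiplying the real part of \<open>P\<close> by \<open>\<zeta> ^ N\<close> turns it into a polynomial without
  low-order terms; in the disc this polynomial is \<open>\<zeta> ^ N\<close> times a Laurent polynomial.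
\<close>

definition laurent_part :: "complex poly \<Rightarrow> complex \<Rightarrow> complex" where
  "laurent_part P \<zeta> = (\<Sum>k\<le>degree P. coeff P k * \<zeta> ^ k + cnj (coeff P k) * inverse \<zeta> ^ k) / 2"

definition high_poly :: "complex poly \<Rightarrow> nat \<Rightarrow> complex poly" where
  "high_poly P N = (\<Sum>k\<le>degree P. monom (coeff P k / 2) (N + k) + monom (cnj (coeff P k) / 2) (N - k))"

lemma laurent_part_circle:
  assumes "cmod \<zeta> = 1"
  shows "laurent_part P \<zeta> = of_real (Re (poly P \<zeta>))"
proof -
  have "cnj \<zeta> = inverse \<zeta>"
    using assms by (metis complex_norm_square inverse_unique mult.commute of_real_1 power_one mult.right_neutral)
  then have "laurent_part P \<zeta> = (poly P \<zeta> + cnj (poly P \<zeta>)) / 2"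
    by (simp add: laurent_part_def poly_altdef sum.distrib)
  then show ?thesis
    by (simp add: complex_add_cnj)
qed

lemma poly_high_poly:
  assumes "\<zeta> \<noteq> 0" "degree P \<le> N"
  shows "poly (high_poly P N) \<zeta> = \<zeta> ^ N * laurent_part P \<zeta>"
  unfolding high_poly_def laurent_part_def poly_sum sum_divide_distrib sum_distrib_left
proof (rule sum.cong[OF refl])
  fix k assume "k \<in> {..degree P}"
  then have "\<zeta> ^ (N - k) = \<zeta> ^ N * inverse \<zeta> ^ k"
    using assms by (simp add: power_diff power_inverse divide_inverse)
  then show "poly (monom (coeff P k / 2) (N + k) + monom (cnj (coeff P k) / 2) (N - k)) \<zeta>
      = \<zeta> ^ N * ((coeff P k * \<zeta> ^ k + cnj (coeff P k) * inverse \<zeta> ^ k) / 2)"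
    by (simp add: poly_monom power_add algebra_simps add_divide_distrib)
qed

text \<open>All exponents are at least \<open>N - degree P\<close>. The estimate is made on the
  polynomial and not on its Laurent form, so that it covers the origin.\<close>

lemma norm_high_poly_le:
  assumes "cmod \<zeta> \<le> r" "r \<le> 1" "degree P \<le> N"
  shows "cmod (poly (high_poly P N) \<zeta>) \<le> r ^ (N - degree P) * (\<Sum>k\<le>degree P. cmod (coeff P k))"
proof -
  have r: "0 \<le> r"
    using assms(1) norm_ge_zero order_trans by blast
  have "cmod (poly (high_poly P N) \<zeta>)
      \<le> (\<Sum>k\<le>degree P. r ^ (N - degree P) * cmod (coeff P k))"
    unfolding high_poly_def poly_sum
  proof (rule sum_norm_le)
    fix k assume k: "k \<in> {..degree P}"
    have pw: "cmod \<zeta> ^ j \<le> r ^ (N - degree P)" if "N - degree P \<le> j" for j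
      using power_mono[OF assms(1) norm_ge_zero, of j] power_decreasing[OF that r assms(2)] by linarith
    have "cmod (poly (monom (coeff P k / 2) (N + k) + monom (cnj (coeff P k) / 2) (N - k)) \<zeta>)
        \<le> cmod (coeff P k) / 2 * cmod \<zeta> ^ (N + k) + cmod (coeff P k) / 2 * cmod \<zeta> ^ (N - k)"
      by (simp add: poly_monom norm_mult norm_power norm_divide order_trans[OF norm_triangle_ineq])
    also have "\<dots> \<le> cmod (coeff P k) / 2 * r ^ (N - degree P) + cmod (coeff P k) / 2 * r ^ (N - degree P)"
      using k by (intro add_mono mult_left_mono pw) auto
    finally show "cmod (poly (monom (coeff P k / 2) (N + k) + monom (cnj (coeff P k) / 2) (N - k)) \<zeta>)
        \<le> r ^ (N - degree P) * cmod (coeff P k)"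
      by (simp add: mult.commute)
  qed
  then show ?thesis
    by (simp add: sum_distrib_left)
qed

lemma coeff_high_poly_low:
  assumes "j + degree P < N"
  shows "coeff (high_poly P N) j = 0"
  unfolding high_poly_def coeff_sum by (rule sum.neutral) (use assms in auto)

lemma degree_high_poly_le: "degree (high_poly P N) \<le> N + degree P"
  unfolding high_poly_def
  by (intro degree_sum_le degree_add_le order_trans[OF degree_monom_le]) auto

text \<open>The gap puts the lowest possible exponent \<open>N - degree P\<close> of the new term
  above the degree bound of \<open>p\<close>, so the old coefficients remain untouched.\<close>

lemma vpoly_extend:
  assumes "fst p + degree P < N"
  obtains q where "extends p q" "\<And>\<zeta>. vpoly q \<zeta> = vpoly p \<zeta> + poly (high_poly P N) \<zeta> *s b"
proof
  define Q where "Q = high_poly P N"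
  define q where "q = (N + degree P, \<lambda>k. (if k \<le> fst p then snd p k else 0) + coeff Q k *s b)"
  show "extends p q"
    using assms by (auto simp: extends_def q_def Q_def coeff_high_poly_low)
  fix \<zeta>
  have "vpoly q \<zeta> = (\<Sum>k\<le>N + degree P. if k \<le> fst p then \<zeta> ^ k *s snd p k else 0)
      + (\<Sum>k\<le>N + degree P. (coeff Q k * \<zeta> ^ k) *s b)"
    by (simp add: vpoly_def q_def vector_add_ldistrib vector_smult_assoc mult.commute
        if_distrib[of "\<lambda>x. _ *s x"] sum.distrib cong: if_cong)
  also have "(\<Sum>k\<le>N + degree P. if k \<le> fst p then \<zeta> ^ k *s snd p k else 0) = vpoly p \<zeta>"
    unfolding vpoly_def using assms by (intro sum.mono_neutral_cong_right) auto
  also have "(\<Sum>k\<le>N + degree P. (coeff Q k * \<zeta> ^ k) *s b) = poly Q \<zeta> *s b"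
  proof -
    have "poly Q \<zeta> = (\<Sum>k\<le>N + degree P. coeff Q k * \<zeta> ^ k)"
      unfolding poly_altdef using degree_high_poly_le[of P N]
      by (intro sum.mono_neutral_left) (auto simp: Q_def coeff_eq_0)
    then show ?thesis
      by (simp add: vec_eq_iff sum_distrib_right)
  qed
  finally show "vpoly q \<zeta> = vpoly p \<zeta> + poly (high_poly P N) \<zeta> *s b"
    by (simp add: Q_def)
qed

section \<open>Steps that keep the closed disc inside the domain\<close>

lemma in_set_infdist_Compl:
  assumes "dist x y < infdist x (- D)"
  shows "y \<in> D"
  using assms infdist_le[of y "- D" x] by (cases "y \<in> D") auto

text \<open>\<open>infdist\<close> to the empty set is 0 by convention, the case that
  \<open>D \<noteq> UNIV\<close> excludes.\<close>

lemma infdist_Compl_pos: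
  assumes "open D" "D \<noteq> UNIV" "x \<in> D"
  shows "0 < infdist x (- D)"
  using assms in_closed_iff_infdist_zero[of "- D" x] infdist_nonneg[of x "- D"]
  by (auto simp: order_less_le)

lemma power_tendsto_small:
  fixes r A e :: real
  assumes "0 \<le> r" "r < 1" "0 < e"
  shows "eventually (\<lambda>N. r ^ (N - m) * A < e) sequentially"
proof -
  have "(\<lambda>N. r ^ N * A) \<longlonglongrightarrow> 0 * A"
    using assms by (intro tendsto_intros LIMSEQ_realpow_zero)
  then have "eventually (\<lambda>N. r ^ N * A < e) sequentially"
    using assms(3) by (intro order_tendstoD(2)) auto
  then have "eventually (\<lambda>N. r ^ (N + m - m) * A < e) sequentially"
    by simp
  then show ?thesis
    by (rule iffD1[OF eventually_sequentially_seg])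
qed

text \<open>Neighbouring N-th roots of unity differ by the angle 2 pi / N. At such a point the
  rapidly rotating factor \<zeta>^N equals 1, so a step moves the value in the direction of the
  given vector itself.\<close>

lemma root_of_unity_near:
  assumes "cmod \<zeta>\<^sub>0 = 1" "0 < e"
  shows "eventually (\<lambda>N. \<exists>\<zeta>. cmod \<zeta> = 1 \<and> \<zeta> ^ N = 1 \<and> dist \<zeta> \<zeta>\<^sub>0 < e) sequentially"
proof -
  define \<theta> where "\<theta> = Arg2pi \<zeta>\<^sub>0"
  have \<theta>: "cis \<theta> = \<zeta>\<^sub>0"
    using Arg2pi[of \<zeta>\<^sub>0] assms by (auto simp: \<theta>_def cis_conv_exp is_Arg_def)
  have "continuous_on UNIV cis"
    by (intro continuous_intros)
  then have "isCont cis \<theta>"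
    by (simp add: continuous_on_eq_continuous_at)
  then obtain d where d: "0 < d" "\<And>x. dist x \<theta> < d \<Longrightarrow> dist (cis x) (cis \<theta>) < e"
    using assms(2) unfolding continuous_at_eps_delta by blast
  obtain M :: nat where M: "2 * pi / d < real M"
    using reals_Archimedean2 by blast
  have "\<exists>\<zeta>. cmod \<zeta> = 1 \<and> \<zeta> ^ N = 1 \<and> dist \<zeta> \<zeta>\<^sub>0 < e" if N: "N \<ge> M + 1" for N
  proof -
    have N0: "0 < real N"
      using N by simp
    define j where "j = \<lfloor>\<theta> * real N / (2 * pi)\<rfloor>"
    define x where "x = 2 * pi * of_int j / real N"
    have "of_int j \<le> \<theta> * real N / (2 * pi)" "\<theta> * real N / (2 * pi) < of_int j + 1"
      unfolding j_def by linarith+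
    then have "of_int j * (2 * pi) \<le> \<theta> * real N" "\<theta> * real N < (of_int j + 1) * (2 * pi)"
      by (simp_all add: field_simps)
    then have "x \<le> \<theta>" "\<theta> < x + 2 * pi / real N"
      using N0 by (simp_all add: x_def field_simps)
    moreover have "2 * pi / real N < d"
    proof -
      have "2 * pi < real M * d"
        using M d(1) by (simp add: field_simps)
      also have "\<dots> \<le> real N * d"
        using N d(1) by (intro mult_right_mono) auto
      finally show ?thesis
        using N0 by (simp add: field_simps)
    qed
    ultimately have "dist x \<theta> < d"
      by (simp add: dist_real_def)
    moreover have "cis x ^ N = 1"
    proof -
      have "cis x ^ N = cis (2 * pi * of_int j)"
        using N0 by (simp add: Complex.DeMoivre x_def)
      also have "\<dots> = 1"
        by (rule cis_multiple_2pi) simp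
      finally show ?thesis .
    qed
    ultimately show ?thesis
      using d(2)[of x] \<theta> by (intro exI[of _ "cis x"]) simp
  qed
  then show ?thesis
    unfolding eventually_sequentially by blast
qed

text \<open>
  The new polynomial is \<open>vpoly p + \<zeta> ^ N * R \<zeta> *s b\<close> with \<open>R\<close> a trigonometric polynomial close to
  \<open>\<sigma> (vpoly p)\<close> on the circle: since \<open>N\<close> is large, each boundary value is replaced by a
  whole circle of radius about \<open>\<sigma> * norm b\<close> around it, while the values inside hardly change.
\<close>

lemma vpoly_step:
  fixes b :: "complex ^ 'n"
  assumes D: "open D" "D \<noteq> UNIV" "vpoly p ` cball 0 1 \<subseteq> D"
    and \<sigma>: "continuous_on D \<sigma>" "\<And>x. x \<in> D \<Longrightarrow> 0 \<le> \<sigma> x"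
      "\<And>x. x \<in> D \<Longrightarrow> \<sigma> x * norm b \<le> infdist x (- D) / 2"
    and e: "0 < e" "\<rho> < 1" "cmod \<zeta>\<^sub>0 = 1"
  obtains q where "extends p q" "vpoly q ` cball 0 1 \<subseteq> D"
    "\<And>\<zeta>. \<zeta> \<in> cball 0 \<rho> \<Longrightarrow> norm (vpoly q \<zeta> - vpoly p \<zeta>) < e"
    "\<And>\<zeta>. \<zeta> \<in> sphere 0 1 \<Longrightarrow> \<bar>norm (vpoly q \<zeta> - vpoly p \<zeta>) - \<sigma> (vpoly p \<zeta>) * norm b\<bar> < e"
    "\<exists>\<zeta>\<in>sphere 0 1. norm (vpoly q \<zeta> - (vpoly p \<zeta>\<^sub>0 + \<sigma> (vpoly p \<zeta>\<^sub>0) *\<^sub>R b)) < e"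
proof -
  define f where "f = vpoly p"
  have contf: "continuous_on S f" for S
    unfolding f_def by (rule continuous_on_vpoly)
  have fD: "f \<zeta> \<in> D" if "cmod \<zeta> \<le> 1" for \<zeta>
    using D(3) that by (auto simp: f_def)
  have cont\<sigma>f: "continuous_on S (\<lambda>\<zeta>. \<sigma> (f \<zeta>))" if "S \<subseteq> cball 0 1" for S
    by (rule continuous_on_compose2[OF \<sigma>(1) contf]) (use that fD in force)
  obtain \<zeta>m where \<zeta>m: "cmod \<zeta>m \<le> 1" "\<And>\<zeta>. cmod \<zeta> \<le> 1 \<Longrightarrow> infdist (f \<zeta>m) (- D) \<le> infdist (f \<zeta>) (- D)"
  proof -
    have "continuous_on (cball 0 1) (\<lambda>\<zeta>. infdist (f \<zeta>) (- D))"
      by (intro continuous_on_infdist contf)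
    moreover have "cball (0::complex) 1 \<noteq> {}"
      by simp
    ultimately obtain x where "x \<in> cball 0 1" "\<forall>\<zeta>\<in>cball 0 1. infdist (f x) (- D) \<le> infdist (f \<zeta>) (- D)"
      using continuous_attains_inf[OF compact_cball] by blast
    then show thesis
      using that[of x] by simp
  qed
  define \<delta> where "\<delta> = infdist (f \<zeta>m) (- D)"
  have \<delta>: "0 < \<delta>" "\<And>\<zeta>. cmod \<zeta> \<le> 1 \<Longrightarrow> \<delta> \<le> infdist (f \<zeta>) (- D)"
    using infdist_Compl_pos[OF D(1,2) fD[OF \<zeta>m(1)]] \<zeta>m(2) by (auto simp: \<delta>_def)
  define B where "B = norm b + 1"
  have B: "0 < B" "norm b < B"
    by (auto simp: B_def add_nonneg_pos)
  \<comment> \<open>The first bound keeps the approximation error within \<open>e / 4\<close>,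
    leaving \<open>e / 2\<close> for the passage from \<open>\<zeta>\<^sub>0\<close> to a root of
    unity. The second bounds \<open>2 * \<epsilon> * norm b\<close> by \<open>\<delta> / 4\<close>,
    less than the half of the distance that a step leaves free. The summand 1 in \<open>B\<close>
    permits the division when \<open>b = 0\<close>.\<close>
  define \<epsilon> where "\<epsilon> = min (e / (4 * B)) (\<delta> / (8 * B))"
  have \<epsilon>: "0 < \<epsilon>"
    using e(1) \<delta>(1) B(1) by (simp add: \<epsilon>_def)
  have "\<epsilon> \<le> e / (4 * B)" "\<epsilon> \<le> \<delta> / (8 * B)"
    by (simp_all add: \<epsilon>_def)
  then have \<epsilon>B: "\<epsilon> * B \<le> e / 4" "\<epsilon> * B \<le> \<delta> / 8"
    using B(1) by (simp_all add: field_simps)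
  have \<epsilon>b: "\<epsilon> * norm b \<le> e / 4" "\<epsilon> * norm b \<le> \<delta> / 8"
    using \<epsilon>B mult_left_mono[OF less_imp_le[OF B(2)] less_imp_le[OF \<epsilon>]] by linarith+
  obtain P where P: "\<And>\<zeta>. cmod \<zeta> = 1 \<Longrightarrow> \<bar>\<sigma> (f \<zeta>) - Re (poly P \<zeta>)\<bar> < \<epsilon>"
    using Re_poly_dense_on_circle[OF cont\<sigma>f[OF sphere_cball] \<epsilon>] by auto
  define R where "R = laurent_part P"
  have R_circle: "R \<zeta> = of_real (Re (poly P \<zeta>))" if "cmod \<zeta> = 1" for \<zeta>
    unfolding R_def using that by (rule laurent_part_circle)
  \<comment> \<open>The points where the Laurent part is noticeably larger than intended, taken in
    an annulus that avoids its pole at 0. By compactness they stay away from the circle, and within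
    a radius that encloses them a high power makes the step small anyway.\<close>
  define K where "K = {\<zeta> \<in> cball 0 1 \<inter> {\<zeta>. 1 / 2 \<le> cmod \<zeta>}. \<sigma> (f \<zeta>) + 2 * \<epsilon> \<le> cmod (R \<zeta>)}"
  obtain r where r: "0 < r" "r < 1" "\<rho> \<le> r" "\<And>\<zeta>. r < cmod \<zeta> \<Longrightarrow> cmod \<zeta> \<le> 1 \<Longrightarrow> cmod (R \<zeta>) < \<sigma> (f \<zeta>) + 2 * \<epsilon>"
  proof -
    let ?A = "cball 0 1 \<inter> {\<zeta>::complex. 1 / 2 \<le> cmod \<zeta>}"
    have comp: "compact ?A"
      by (intro compact_Int_closed compact_cball closed_Collect_le continuous_intros)
    have nz: "\<zeta> \<noteq> 0" if "\<zeta> \<in> ?A" for \<zeta>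
      using that by auto
    have "continuous_on ?A R"
      unfolding R_def laurent_part_def[abs_def] using nz by (intro continuous_intros) auto
    then have "continuous_on ?A (\<lambda>\<zeta>. cmod (R \<zeta>) - (\<sigma> (f \<zeta>) + 2 * \<epsilon>))"
      by (intro continuous_intros cont\<sigma>f) auto
    then have "closedin (top_of_set ?A) (?A \<inter> (\<lambda>\<zeta>. cmod (R \<zeta>) - (\<sigma> (f \<zeta>) + 2 * \<epsilon>)) -` {0..})"
      by (intro continuous_closedin_preimage) auto
    moreover have "?A \<inter> (\<lambda>\<zeta>. cmod (R \<zeta>) - (\<sigma> (f \<zeta>) + 2 * \<epsilon>)) -` {0..} = K"
      unfolding K_def by auto
    ultimately have "compact K"
      using comp closedin_compact by metis
    have less1: "cmod \<zeta> < 1" if "\<zeta> \<in> K" for \<zeta>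
    proof (rule ccontr)
      assume "\<not> cmod \<zeta> < 1"
      then have "cmod \<zeta> = 1"
        using that by (auto simp: K_def)
      then show False
        using P[of \<zeta>] R_circle[of \<zeta>] \<sigma>(2)[OF fD[of \<zeta>]] that \<epsilon> by (auto simp: K_def)
    qed
    have "\<exists>r0<1. \<forall>\<zeta>\<in>K. cmod \<zeta> \<le> r0"
    proof (cases "K = {}")
      case False
      then show ?thesis
        using continuous_attains_sup[OF \<open>compact K\<close> False continuous_on_norm_id] less1 by blast
    qed (auto intro: exI[of _ 0])
    then obtain r0 where r0: "r0 < 1" "\<forall>\<zeta>\<in>K. cmod \<zeta> \<le> r0"
      by blast
    show thesis
    proof (rule that[of "max (max r0 \<rho>) (1 / 2)"])
      show "cmod (R \<zeta>) < \<sigma> (f \<zeta>) + 2 * \<epsilon>"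
        if "max (max r0 \<rho>) (1 / 2) < cmod \<zeta>" "cmod \<zeta> \<le> 1" for \<zeta>
      proof (rule ccontr)
        assume "\<not> cmod (R \<zeta>) < \<sigma> (f \<zeta>) + 2 * \<epsilon>"
        then have "\<zeta> \<in> K"
          using that by (simp add: K_def)
        then show False
          using r0(2) that(1) by fastforce
      qed
    qed (use r0(1) e(2) in auto)
  qed
  define \<psi> where "\<psi> \<zeta> = f \<zeta> + \<sigma> (f \<zeta>) *\<^sub>R b" for \<zeta>
  have "continuous_on (sphere 0 1) \<psi>"
    unfolding \<psi>_def by (intro continuous_intros contf cont\<sigma>f) auto
  moreover have "\<zeta>\<^sub>0 \<in> sphere 0 1"
    using e(3) by simp
  ultimately obtain d where d: "0 < d"
    "\<And>\<zeta>. cmod \<zeta> = 1 \<Longrightarrow> dist \<zeta> \<zeta>\<^sub>0 < d \<Longrightarrow> dist (\<psi> \<zeta>) (\<psi> \<zeta>\<^sub>0) < e / 2"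
    using e(1) unfolding continuous_on_iff by (metis half_gt_zero mem_sphere_0)
  \<comment> \<open>\<open>N\<close> is chosen last: it has to beat the coefficients of
    \<open>P\<close> on the disc of radius \<open>r\<close>, provide a root of unity near
    \<open>\<zeta>\<^sub>0\<close>, and leave the coefficients of \<open>p\<close> alone.\<close>
  have "eventually (\<lambda>N. r ^ (N - degree P) * (\<Sum>k\<le>degree P. cmod (coeff P k)) < \<epsilon> \<and>
      (\<exists>\<zeta>. cmod \<zeta> = 1 \<and> \<zeta> ^ N = 1 \<and> dist \<zeta> \<zeta>\<^sub>0 < d) \<and> fst p + degree P < N) sequentially"
    using r(1,2) \<epsilon> e(3) d(1)
    by (intro eventually_conj power_tendsto_small root_of_unity_near eventually_gt_at_top) auto
  then obtain N where N: "r ^ (N - degree P) * (\<Sum>k\<le>degree P. cmod (coeff P k)) < \<epsilon>"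
    "\<exists>\<zeta>. cmod \<zeta> = 1 \<and> \<zeta> ^ N = 1 \<and> dist \<zeta> \<zeta>\<^sub>0 < d" "fst p + degree P < N"
    using eventually_happens'[OF sequentially_bot] by blast
  define G where "G = poly (high_poly P N)"
  have G_eq: "G \<zeta> = \<zeta> ^ N * R \<zeta>" if "\<zeta> \<noteq> 0" for \<zeta>
    unfolding G_def R_def using that N(3) by (intro poly_high_poly) auto
  have G_small: "cmod (G \<zeta>) < \<epsilon>" if "cmod \<zeta> \<le> r" for \<zeta>
    unfolding G_def using norm_high_poly_le[OF that less_imp_le[OF r(2)], of P N] N(1,3) by simp
  have G_large: "cmod (G \<zeta>) < \<sigma> (f \<zeta>) + 2 * \<epsilon>" if "r < cmod \<zeta>" "cmod \<zeta> \<le> 1" for \<zeta>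
  proof -
    have "0 < cmod \<zeta>"
      using that(1) r(1) by linarith
    then have "cmod (G \<zeta>) = cmod \<zeta> ^ N * cmod (R \<zeta>)"
      by (simp add: G_eq norm_mult norm_power)
    also have "\<dots> \<le> 1 * cmod (R \<zeta>)"
      using that(2) by (intro mult_right_mono power_le_one) auto
    finally show ?thesis
      using r(4)[OF that] by simp
  qed
  obtain q where q: "extends p q" "\<And>\<zeta>. vpoly q \<zeta> = f \<zeta> + G \<zeta> *s b"
    unfolding f_def G_def using vpoly_extend[OF N(3), of b] by blast
  show thesis
  proof (rule that[OF q(1)])
    show "vpoly q ` cball 0 1 \<subseteq> D"
    proof (rule image_subsetI)
      fix \<zeta> :: complex assume "\<zeta> \<in> cball 0 1"
      then have \<zeta>: "cmod \<zeta> \<le> 1" by simp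
      have "cmod (G \<zeta>) * norm b < infdist (f \<zeta>) (- D)"
      proof (cases "cmod \<zeta> \<le> r")
        case True
        have "cmod (G \<zeta>) * norm b \<le> \<epsilon> * norm b"
          using G_small[OF True] by (intro mult_right_mono) auto
        then show ?thesis
          using \<epsilon>b(2) \<delta>(1) \<delta>(2)[OF \<zeta>] by linarith
      next
        case False
        have "cmod (G \<zeta>) * norm b \<le> (\<sigma> (f \<zeta>) + 2 * \<epsilon>) * norm b"
          using G_large[of \<zeta>] False \<zeta> by (intro mult_right_mono) auto
        also have "\<dots> = \<sigma> (f \<zeta>) * norm b + 2 * (\<epsilon> * norm b)"
          by (simp add: algebra_simps)
        finally show ?thesis
          using \<sigma>(3)[OF fD[OF \<zeta>]] \<epsilon>b(2) \<delta>(1) \<delta>(2)[OF \<zeta>] by linarith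
      qed
      then show "vpoly q \<zeta> \<in> D"
        by (intro in_set_infdist_Compl[of "f \<zeta>"]) (simp add: q(2) dist_norm norm_vector_smult)
    qed
    show "norm (vpoly q \<zeta> - vpoly p \<zeta>) < e" if "\<zeta> \<in> cball 0 \<rho>" for \<zeta>
    proof -
      have "cmod (G \<zeta>) * norm b \<le> \<epsilon> * norm b"
        using G_small[of \<zeta>] that r(3) by (intro mult_right_mono) auto
      then show ?thesis
        using \<epsilon>b(1) e(1) by (simp add: q(2) f_def[symmetric] norm_vector_smult)
    qed
    show "\<bar>norm (vpoly q \<zeta> - vpoly p \<zeta>) - \<sigma> (vpoly p \<zeta>) * norm b\<bar> < e" if "\<zeta> \<in> sphere 0 1" for \<zeta>
    proof -
      have \<zeta>: "cmod \<zeta> = 1" "\<zeta> \<noteq> 0"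
        using that by auto
      have "cmod (G \<zeta>) = \<bar>Re (poly P \<zeta>)\<bar>"
        using \<zeta> by (simp add: G_eq R_circle norm_mult norm_power)
      then have "\<bar>cmod (G \<zeta>) - \<sigma> (f \<zeta>)\<bar> \<le> \<epsilon>"
        using P[OF \<zeta>(1)] \<sigma>(2)[OF fD[of \<zeta>]] \<zeta>(1) by linarith
      then have "\<bar>cmod (G \<zeta>) - \<sigma> (f \<zeta>)\<bar> * norm b \<le> \<epsilon> * norm b"
        by (intro mult_right_mono) auto
      then have "\<bar>cmod (G \<zeta>) * norm b - \<sigma> (f \<zeta>) * norm b\<bar> \<le> \<epsilon> * norm b"
        by (simp add: left_diff_distrib[symmetric] abs_mult)
      then show ?thesis
        using \<epsilon>b(1) e(1) by (simp add: q(2) f_def[symmetric] norm_vector_smult)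
    qed
    obtain \<zeta> where \<zeta>: "cmod \<zeta> = 1" "\<zeta> ^ N = 1" "dist \<zeta> \<zeta>\<^sub>0 < d"
      using N(2) by blast
    have "vpoly q \<zeta> - \<psi> \<zeta> = (G \<zeta> - of_real (\<sigma> (f \<zeta>))) *s b"
    proof -
      have "\<sigma> (f \<zeta>) *\<^sub>R b = complex_of_real (\<sigma> (f \<zeta>)) *s b"
        unfolding vec_eq_iff vector_scaleR_component vector_smult_component
        by (simp add: scaleR_conv_of_real)
      then show ?thesis
        by (simp add: q(2) \<psi>_def vec_eq_iff algebra_simps)
    qed
    moreover have "G \<zeta> - of_real (\<sigma> (f \<zeta>)) = of_real (Re (poly P \<zeta>) - \<sigma> (f \<zeta>))"
      using G_eq[of \<zeta>] \<zeta> R_circle[of \<zeta>] by force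
    ultimately have "norm (vpoly q \<zeta> - \<psi> \<zeta>) = \<bar>Re (poly P \<zeta>) - \<sigma> (f \<zeta>)\<bar> * norm b"
      by (simp only: norm_vector_smult norm_of_real real_norm_def)
    also have "\<dots> \<le> \<epsilon> * norm b"
      using P[OF \<zeta>(1)] by (intro mult_right_mono) auto
    finally have "norm (vpoly q \<zeta> - \<psi> \<zeta>) \<le> e / 4"
      using \<epsilon>b(1) by linarith
    moreover have "norm (\<psi> \<zeta> - \<psi> \<zeta>\<^sub>0) < e / 2"
      using d(2)[OF \<zeta>(1,3)] by (simp add: dist_norm)
    ultimately have "norm (vpoly q \<zeta> - \<psi> \<zeta>\<^sub>0) < e"
      using norm_triangle_ineq[of "vpoly q \<zeta> - \<psi> \<zeta>" "\<psi> \<zeta> - \<psi> \<zeta>\<^sub>0"] e(1) by simp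
    then show "\<exists>\<zeta>\<in>sphere 0 1. norm (vpoly q \<zeta> - (vpoly p \<zeta>\<^sub>0 + \<sigma> (vpoly p \<zeta>\<^sub>0) *\<^sub>R b)) < e"
      using \<zeta>(1) by (intro bexI[of _ \<zeta>]) (simp_all add: \<psi>_def f_def)
  qed
qed

section \<open>Visiting prescribed points and spending energy\<close>

lemma vpoly_visit:
  fixes D :: "(complex ^ 'n) set"
  assumes D: "open D" "connected D" "D \<noteq> UNIV" "vpoly p ` cball 0 1 \<subseteq> D"
    and e: "0 < e" "\<rho> < 1" and z: "z \<in> D"
  obtains q where "extends p q" "vpoly q ` cball 0 1 \<subseteq> D"
    "\<And>\<zeta>. \<zeta> \<in> cball 0 \<rho> \<Longrightarrow> norm (vpoly q \<zeta> - vpoly p \<zeta>) < e"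
    "\<exists>\<zeta>\<in>sphere 0 1. norm (vpoly q \<zeta> - z) < e"
proof -
  define R where "R q e x \<longleftrightarrow> extends p q \<and> vpoly q ` cball 0 1 \<subseteq> D \<and>
      (\<forall>\<zeta>\<in>cball 0 \<rho>. norm (vpoly q \<zeta> - vpoly p \<zeta>) < e) \<and> (\<exists>\<zeta>\<in>sphere 0 1. norm (vpoly q \<zeta> - x) < e)"
    for q e x
  \<comment> \<open>The chain argument in topological form: the points approximable to every
    accuracy by boundary values of continuations form a nonempty set that is open and closed in
    \<open>D\<close>. Openness comes from one further step, closedness from the quantifier over
    \<open>e\<close>.\<close>
  define A where "A = {x \<in> D. \<forall>e>0. \<exists>q. R q e x}"
  have "R p e (vpoly p 1)" if "0 < e" for e
    unfolding R_def using D(4) that by (auto intro: bexI[of _ 1])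
  moreover have "vpoly p 1 \<in> D"
    using D(4) by auto
  ultimately have "vpoly p 1 \<in> A"
    unfolding A_def by blast
  moreover have "openin (top_of_set D) A"
  proof -
    have "\<exists>T. open T \<and> x \<in> T \<and> T \<subseteq> A" if x: "x \<in> A" for x
    proof (intro exI conjI)
      define \<delta> where "\<delta> = infdist x (- D)"
      have "x \<in> D"
        using x by (simp add: A_def)
      then have \<delta>: "0 < \<delta>"
        unfolding \<delta>_def by (rule infdist_Compl_pos[OF D(1,3)])
      show "open (ball x (\<delta> / 8))" "x \<in> ball x (\<delta> / 8)"
        using \<delta> by auto
      show "ball x (\<delta> / 8) \<subseteq> A"
      proof
        fix y assume y: "y \<in> ball x (\<delta> / 8)"
        then have "dist x y < infdist x (- D)"
          using \<delta> by (simp add: \<delta>_def)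
        then have yD: "y \<in> D"
          by (rule in_set_infdist_Compl)
        have "\<exists>q. R q e y" if e: "0 < e" for e
        proof -
          \<comment> \<open>Both \<open>y\<close> and the boundary value are within
            \<open>\<delta> / 8\<close> of \<open>x\<close>. Hence
            \<open>norm b < \<delta> / 4\<close>, while the boundary value has distance at least 7/8
            of \<open>\<delta>\<close> from the complement, so the full step \<open>b\<close> uses
            less than half of that distance.\<close>
          define \<epsilon> where "\<epsilon> = min (e / 2) (\<delta> / 8)"
          have \<epsilon>: "0 < \<epsilon>" "\<epsilon> \<le> e / 2" "\<epsilon> \<le> \<delta> / 8"
            using e \<delta> by (auto simp: \<epsilon>_def)
          obtain q \<zeta> where q: "extends p q" "vpoly q ` cball 0 1 \<subseteq> D"
            "\<forall>\<zeta>\<in>cball 0 \<rho>. norm (vpoly q \<zeta> - vpoly p \<zeta>) < \<epsilon>"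
            "cmod \<zeta> = 1" "norm (vpoly q \<zeta> - x) < \<epsilon>"
            using x \<epsilon>(1) unfolding A_def R_def by fastforce
          define b where "b = y - vpoly q \<zeta>"
          have "norm b \<le> dist x y + norm (vpoly q \<zeta> - x)"
            unfolding b_def dist_norm using norm_triangle_ineq4[of "y - x" "vpoly q \<zeta> - x"]
            by (simp add: norm_minus_commute)
          then have nb: "norm b < \<delta> / 4"
            using y q(5) \<epsilon>(3) by simp
          have "\<bar>infdist x (- D) - infdist (vpoly q \<zeta>) (- D)\<bar> \<le> dist x (vpoly q \<zeta>)"
            by (rule infdist_triangle_abs)
          then have far: "2 * norm b \<le> infdist (vpoly q \<zeta>) (- D)"
            using q(5) \<epsilon>(3) nb \<delta> unfolding \<delta>_def[symmetric] by (simp add: dist_norm norm_minus_commute)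
          \<comment> \<open>The factor is 1 at the value to be moved, so the step there is exactly
            \<open>b\<close>; at other values of the disc it respects half the distance to the
            complement. For \<open>b = 0\<close> the convention \<open>inverse 0 = 0\<close> gives
            the harmless factor 0.\<close>
          define \<sigma> where "\<sigma> v = min 1 (infdist v (- D) * inverse (2 * norm b))" for v
          obtain q' where q': "extends q q'" "vpoly q' ` cball 0 1 \<subseteq> D"
            "\<And>\<xi>. \<xi> \<in> cball 0 \<rho> \<Longrightarrow> norm (vpoly q' \<xi> - vpoly q \<xi>) < e / 2"
            "\<exists>\<xi>\<in>sphere 0 1. norm (vpoly q' \<xi> - (vpoly q \<zeta> + \<sigma> (vpoly q \<zeta>) *\<^sub>R b)) < e / 2"
          proof (rule vpoly_step[OF D(1,3) q(2), of \<sigma> b "e / 2" \<rho> \<zeta>])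
            show "continuous_on D \<sigma>"
              unfolding \<sigma>_def by (intro continuous_intros continuous_on_infdist)
            show "0 \<le> \<sigma> v" for v
              by (simp add: \<sigma>_def infdist_nonneg)
            show "\<sigma> v * norm b \<le> infdist v (- D) / 2" for v
            proof (cases "b = 0")
              case False
              have "\<sigma> v * norm b \<le> infdist v (- D) * inverse (2 * norm b) * norm b"
                unfolding \<sigma>_def by (intro mult_right_mono) auto
              then show ?thesis
                using False by (simp add: field_simps)
            qed (simp add: infdist_nonneg)
          qed (use e \<open>\<rho> < 1\<close> q(4) in auto)
          have "vpoly q \<zeta> + \<sigma> (vpoly q \<zeta>) *\<^sub>R b = y"
          proof (cases "b = 0")
            case False
            then have "1 \<le> infdist (vpoly q \<zeta>) (- D) * inverse (2 * norm b)"
              using far by (simp add: field_simps)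
            then show ?thesis
              by (simp add: \<sigma>_def b_def)
          qed (simp add: b_def)
          then have "\<exists>\<xi>\<in>sphere 0 1. norm (vpoly q' \<xi> - y) < e"
            using q'(4) e by (metis field_sum_of_halves less_add_same_cancel1 half_gt_zero less_trans)
          moreover have "norm (vpoly q' \<xi> - vpoly p \<xi>) < e" if "\<xi> \<in> cball 0 \<rho>" for \<xi>
            using norm_triangle_ineq[of "vpoly q' \<xi> - vpoly q \<xi>" "vpoly q \<xi> - vpoly p \<xi>"]
              q'(3)[OF that] bspec[OF q(3) that] \<epsilon>(2) by simp
          ultimately have "R q' e y"
            using extends_trans[OF q(1) q'(1)] q'(2) by (auto simp: R_def)
          then show ?thesis ..
        qed
        then show "y \<in> A"
          using yD by (simp add: A_def)
      qed
    qed
    then have "open A"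
      by (subst open_subopen) blast
    moreover have "A \<subseteq> D"
      by (auto simp: A_def)
    ultimately show ?thesis
      by (simp add: open_subset)
  qed
  moreover have "closedin (top_of_set D) A"
  proof -
    have "x \<in> A" if x: "x \<in> D" "x \<in> closure A" for x
      unfolding A_def
    proof (intro CollectI conjI allI impI x(1))
      fix e :: real assume e: "0 < e"
      obtain y where y: "y \<in> A" "dist y x < e / 2"
        using x(2) e unfolding closure_approachable by (meson half_gt_zero)
      have "0 < e / 2"
        using e by simp
      with y(1) have "\<exists>q. R q (e / 2) y"
        unfolding A_def by blast
      then obtain q where q: "R q (e / 2) y"
        by blast
      then obtain \<zeta> where \<zeta>: "\<zeta> \<in> sphere 0 1" "norm (vpoly q \<zeta> - y) < e / 2"
        unfolding R_def by blast
      have "norm (vpoly q \<zeta> - x) < e"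
        using norm_triangle_ineq[of "vpoly q \<zeta> - y" "y - x"] \<zeta>(2) y(2) by (simp add: dist_norm)
      then have "R q e x"
        using q \<zeta>(1) e unfolding R_def by force
      then show "\<exists>q. R q e x" ..
    qed
    then have "A = D \<inter> closure A"
      using closure_subset[of A] by (auto simp: A_def)
    then show ?thesis
      by (metis closed_closure closedin_closed)
  qed
  ultimately have "A = D"
    using D(2) unfolding connected_clopen by blast
  then obtain q where "R q e z"
    using z e(1) unfolding A_def by blast
  then show thesis
    using that unfolding R_def by blast
qed

lemma integrable_infdist_vpoly:
  "integrable circle_prob (\<lambda>t. (infdist (vpoly p (cis t)) S / 2)\<^sup>2)"
proof -
  have "continuous_on (sphere 0 1) (\<lambda>\<zeta>. (infdist (vpoly p \<zeta>) S / 2)\<^sup>2)"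
    by (intro continuous_intros continuous_on_infdist) auto
  from integrable_circle[OF this] show ?thesis
    by simp
qed

lemma integrable_norm_vpoly_diff:
  "integrable circle_prob (\<lambda>t. (norm (vpoly q (cis t) - vpoly p (cis t)))\<^sup>2)"
proof -
  have "continuous_on (sphere 0 1) (\<lambda>\<zeta>. (norm (vpoly q \<zeta> - vpoly p \<zeta>))\<^sup>2)"
    by (intro continuous_intros)
  from integrable_circle[OF this] show ?thesis
    by simp
qed

text \<open>
  A step of half the distance to the complement costs energy, so boundary values at a definite
  distance from the complement must become rare when the energy stays bounded.
\<close>

lemma vpoly_main_step:
  fixes D :: "(complex ^ 'n) set"
  assumes D: "open D" "connected D" "D \<noteq> UNIV" "vpoly p ` cball 0 1 \<subseteq> D"
    and e: "0 < e" "\<rho> < 1" and z: "z \<in> D"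
  obtains q where "extends p q" "vpoly q ` cball 0 1 \<subseteq> D"
    "\<And>\<zeta>. \<zeta> \<in> cball 0 \<rho> \<Longrightarrow> norm (vpoly q \<zeta> - vpoly p \<zeta>) < e"
    "\<exists>\<zeta>\<in>ball 0 1. dist (vpoly q \<zeta>) z < e"
    "integral\<^sup>L circle_prob (\<lambda>t. (infdist (vpoly p (cis t)) (- D) / 2)\<^sup>2) \<le> 2 * (energy q - energy p) + e"
proof -
  \<comment> \<open>One half of \<open>e\<close> for each of the two continuations; the bound 1
    gives \<open>2 * \<epsilon>\<^sup>2 \<le> e\<close> in the energy estimate.\<close>
  define \<epsilon> where "\<epsilon> = min (e / 2) 1"
  have \<epsilon>: "0 < \<epsilon>" "\<epsilon> \<le> e / 2" "\<epsilon> \<le> 1"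
    using e(1) by (auto simp: \<epsilon>_def)
  define b :: "complex ^ 'n" where "b = axis undefined 1"
  have b: "norm b = 1"
    by (simp add: b_def norm_axis_complex)
  define \<sigma> where "\<sigma> v = infdist v (- D) / 2" for v
  obtain q where q: "extends p q" "vpoly q ` cball 0 1 \<subseteq> D"
    "\<And>\<zeta>. \<zeta> \<in> cball 0 \<rho> \<Longrightarrow> norm (vpoly q \<zeta> - vpoly p \<zeta>) < \<epsilon>"
    "\<And>\<zeta>. \<zeta> \<in> sphere 0 1 \<Longrightarrow> \<bar>norm (vpoly q \<zeta> - vpoly p \<zeta>) - \<sigma> (vpoly p \<zeta>) * norm b\<bar> < \<epsilon>"
  proof (rule vpoly_step[OF D(1,3,4), of \<sigma> b \<epsilon> \<rho> 1])
    show "continuous_on D \<sigma>"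
      unfolding \<sigma>_def by (intro continuous_intros continuous_on_infdist) auto
  qed (use e(2) \<epsilon>(1) in \<open>auto simp: \<sigma>_def b infdist_nonneg\<close>)
  \<comment> \<open>The visit comes second: it can only add energy, so the estimate gained by the
    first continuation persists, and the visited point belongs to the final polynomial.\<close>
  obtain q' where q': "extends q q'" "vpoly q' ` cball 0 1 \<subseteq> D"
    "\<And>\<zeta>. \<zeta> \<in> cball 0 \<rho> \<Longrightarrow> norm (vpoly q' \<zeta> - vpoly q \<zeta>) < \<epsilon>"
    "\<exists>\<zeta>\<in>sphere 0 1. norm (vpoly q' \<zeta> - z) < \<epsilon>"
    using vpoly_visit[OF D(1-3) q(2) \<epsilon>(1) e(2) z] by blast
  show thesis
  proof (rule that[OF extends_trans[OF q(1) q'(1)] q'(2)])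
    show "norm (vpoly q' \<zeta> - vpoly p \<zeta>) < e" if "\<zeta> \<in> cball 0 \<rho>" for \<zeta>
      using norm_triangle_ineq[of "vpoly q' \<zeta> - vpoly q \<zeta>" "vpoly q \<zeta> - vpoly p \<zeta>"]
        q'(3)[OF that] q(3)[OF that] \<epsilon>(2) by simp
    obtain \<xi> where \<xi>: "cmod \<xi> = 1" "norm (vpoly q' \<xi> - z) < \<epsilon>"
      using q'(4) by auto
    \<comment> \<open>The visit takes place on the circle; continuity moves it to a point of the
      open disc.\<close>
    have "open (vpoly q' -` ball z e)"
      by (intro open_vimage open_ball continuous_on_vpoly)
    moreover have "\<xi> \<in> vpoly q' -` ball z e"
      using \<xi>(2) \<epsilon>(2) e(1) by (simp add: dist_norm norm_minus_commute)
    moreover have "\<xi> \<in> closure (ball 0 1)"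
      using \<xi>(1) by simp
    ultimately obtain \<zeta> where "\<zeta> \<in> ball 0 1" "vpoly q' \<zeta> \<in> ball z e"
      unfolding closure_iff_nhds_not_empty by blast
    then show "\<exists>\<zeta>\<in>ball 0 1. dist (vpoly q' \<zeta>) z < e"
      by (auto simp: dist_commute)
    have "integral\<^sup>L circle_prob (\<lambda>t. (infdist (vpoly p (cis t)) (- D) / 2)\<^sup>2)
        \<le> integral\<^sup>L circle_prob (\<lambda>t. 2 * (norm (vpoly q (cis t) - vpoly p (cis t)))\<^sup>2 + e)"
    proof (rule integral_mono)
      show "integrable circle_prob (\<lambda>t. (infdist (vpoly p (cis t)) (- D) / 2)\<^sup>2)"
        by (rule integrable_infdist_vpoly)
      show "integrable circle_prob (\<lambda>t. 2 * (norm (vpoly q (cis t) - vpoly p (cis t)))\<^sup>2 + e)"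
        using integrable_norm_vpoly_diff[of q p] by simp
      fix t
      define x where "x = norm (vpoly q (cis t) - vpoly p (cis t))"
      define y where "y = infdist (vpoly p (cis t)) (- D) / 2"
      have xy: "0 \<le> y" "y \<le> x + \<epsilon>"
        using q(4)[of "cis t"] by (auto simp: x_def y_def b \<sigma>_def infdist_nonneg abs_less_iff)
      have "y\<^sup>2 \<le> (x + \<epsilon>)\<^sup>2"
        using xy by (intro power_mono) auto
      also have "\<dots> \<le> 2 * x\<^sup>2 + 2 * \<epsilon>\<^sup>2"
        using zero_le_power2[of "x - \<epsilon>"] by (simp add: power2_eq_square algebra_simps)
      also have "2 * \<epsilon>\<^sup>2 \<le> 2 * ((e / 2) * 1)"
        unfolding power2_eq_square using \<epsilon> by (intro mult_left_mono mult_mono) auto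
      finally show "(infdist (vpoly p (cis t)) (- D) / 2)\<^sup>2 \<le> 2 * (norm (vpoly q (cis t) - vpoly p (cis t)))\<^sup>2 + e"
        by (simp add: x_def y_def)
    qed
    also have "\<dots> = 2 * (energy q - energy p) + e"
      using integrable_norm_vpoly_diff[of q p] extends_energy_diff[OF q(1)] by simp
    also have "\<dots> \<le> 2 * (energy q' - energy p) + e"
      using extends_energy_mono[OF q'(1)] by simp
    finally show "integral\<^sup>L circle_prob (\<lambda>t. (infdist (vpoly p (cis t)) (- D) / 2)\<^sup>2)
        \<le> 2 * (energy q' - energy p) + e" .
  qed
qed

section \<open>The sequence of discs and its persistent visits\<close>

lemma recurrent_dense_sequence:
  fixes D :: "'a::{metric_space, second_countable_topology} set"
  assumes "open D" "D \<noteq> {}"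
  obtains \<tau> :: "nat \<Rightarrow> 'a" where "\<And>j. \<tau> j \<in> D"
    "\<forall>z\<in>D. \<forall>r>0. \<forall>J. \<exists>j\<ge>J. dist (\<tau> j) z < r"
proof -
  obtain B :: "'a set" where B: "countable B" "\<And>X. open X \<Longrightarrow> X \<noteq> {} \<Longrightarrow> \<exists>d\<in>B. d \<in> X"
    using countable_dense_setE by metis
  have ne: "B \<inter> D \<noteq> {}"
    using B(2)[OF assms] by blast
  have cnt: "countable (B \<inter> D)"
    using B(1) by blast
  \<comment> \<open>Decoding pairs repeats every element at infinitely many indices. This recurrence
    is needed because the visit at index \<open>j\<close> has accuracy 2^-j, so high accuracy
    requires late indices.\<close>
  define \<tau> where "\<tau> j = from_nat_into (B \<inter> D) (fst (prod_decode j))" for j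
  show thesis
  proof
    show "\<tau> j \<in> D" for j
      using from_nat_into[OF ne] by (auto simp: \<tau>_def)
    show "\<forall>z\<in>D. \<forall>r>0. \<forall>J. \<exists>j\<ge>J. dist (\<tau> j) z < r"
    proof (intro ballI allI impI)
      fix z and r :: real and J :: nat
      assume "z \<in> D" "0 < r"
      then have "open (D \<inter> ball z r)" "D \<inter> ball z r \<noteq> {}"
        using assms(1) by auto
      then have "\<exists>d\<in>B. d \<in> D \<inter> ball z r"
        by (rule B(2))
      then obtain d where d: "d \<in> B" "d \<in> D" "dist d z < r"
        by (auto simp: dist_commute)
      then obtain n where "from_nat_into (B \<inter> D) n = d"
        using from_nat_into_surj[OF cnt, of d] by blast
      then have "\<tau> (prod_encode (n, J)) = d"
        by (simp add: \<tau>_def)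
      then show "\<exists>j\<ge>J. dist (\<tau> j) z < r"
        using d(3) le_prod_encode_2 by metis
    qed
  qed
qed

text \<open>The dependent choice carries a radius along with each polynomial: the visit of stage
  \<open>j\<close> lies inside radius \<open>\<rho> j\<close>, and the next stage must stay close on
  that closed disc. Since radii never shrink, earlier visits remain protected too.\<close>

lemma vpoly_sequence:
  fixes D :: "(complex ^ 'n) set"
  assumes D: "open D" "connected D" "D \<noteq> UNIV" and \<tau>: "\<And>j. \<tau> j \<in> D"
  obtains p \<rho> where "\<And>j. vpoly (p j) ` cball 0 1 \<subseteq> D" "\<And>j. extends (p j) (p (Suc j))"
    "\<And>j. \<rho> j < 1" "\<And>j. \<rho> j \<le> \<rho> (Suc j)"
    "\<And>j. \<exists>\<zeta>\<in>ball 0 (\<rho> j). dist (vpoly (p j) \<zeta>) (\<tau> j) < (1 / 2) ^ j"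
    "\<And>j \<zeta>. \<zeta> \<in> cball 0 (\<rho> j) \<Longrightarrow> norm (vpoly (p (Suc j)) \<zeta> - vpoly (p j) \<zeta>) < (1 / 2) ^ j"
    "\<And>j. integral\<^sup>L circle_prob (\<lambda>t. (infdist (vpoly (p j) (cis t)) (- D) / 2)\<^sup>2)
        \<le> 2 * (energy (p (Suc j)) - energy (p j)) + (1 / 2) ^ j"
proof -
  define P where "P j x \<longleftrightarrow> vpoly (fst x) ` cball 0 1 \<subseteq> D \<and> snd x < (1::real) \<and>
      (\<exists>\<zeta>\<in>ball 0 (snd x). dist (vpoly (fst x) \<zeta>) (\<tau> j) < (1 / 2) ^ j)" for j x
  define Q where "Q j x y \<longleftrightarrow> extends (fst x) (fst y) \<and> snd x \<le> snd y \<and>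
      (\<forall>\<zeta>\<in>cball 0 (snd x). norm (vpoly (fst y) \<zeta> - vpoly (fst x) \<zeta>) < (1 / 2) ^ j) \<and>
      integral\<^sup>L circle_prob (\<lambda>t. (infdist (vpoly (fst x) (cis t)) (- D) / 2)\<^sup>2)
        \<le> 2 * (energy (fst y) - energy (fst x)) + (1 / 2) ^ j" for j :: nat and x y :: "_ \<times> real"
  have "\<exists>s. \<forall>j. P j (s j) \<and> Q j (s j) (s (Suc j))"
  proof (rule dependent_nat_choice)
    have "vpoly (0, \<lambda>_. \<tau> 0) \<zeta> = \<tau> 0" for \<zeta>
      by (simp add: vpoly_def)
    then have "P 0 ((0, \<lambda>_. \<tau> 0), 1 / 2)"
      unfolding P_def using \<tau> by (auto intro: exI[of _ 0])
    then show "\<exists>x. P 0 x" ..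
  next
    fix x j
    assume x: "P j x"
    obtain q where q: "extends (fst x) q" "vpoly q ` cball 0 1 \<subseteq> D"
      "\<And>\<zeta>. \<zeta> \<in> cball 0 (snd x) \<Longrightarrow> norm (vpoly q \<zeta> - vpoly (fst x) \<zeta>) < (1 / 2) ^ Suc j"
      "\<exists>\<zeta>\<in>ball 0 1. dist (vpoly q \<zeta>) (\<tau> (Suc j)) < (1 / 2) ^ Suc j"
      "integral\<^sup>L circle_prob (\<lambda>t. (infdist (vpoly (fst x) (cis t)) (- D) / 2)\<^sup>2)
        \<le> 2 * (energy q - energy (fst x)) + (1 / 2) ^ Suc j"
      using vpoly_main_step[OF D, of "fst x" "(1 / 2) ^ Suc j" "snd x" "\<tau> (Suc j)"] x \<tau>
      unfolding P_def by (metis half_gt_zero_iff zero_less_one zero_less_power)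
    obtain \<zeta> where \<zeta>: "cmod \<zeta> < 1" "dist (vpoly q \<zeta>) (\<tau> (Suc j)) < (1 / 2) ^ Suc j"
      using q(4) by auto
    \<comment> \<open>The midpoint between \<open>cmod \<zeta>\<close> and 1 encloses the new visit
      without reaching the circle.\<close>
    define r where "r = max (snd x) ((1 + cmod \<zeta>) / 2)"
    have half: "(1 / 2) ^ Suc j \<le> ((1 / 2) ^ j :: real)"
      by simp
    have "cmod \<zeta> < r" "r < 1"
      using \<zeta>(1) x by (auto simp: r_def P_def less_max_iff_disj)
    then have "P (Suc j) (q, r)"
      unfolding P_def using q(2) \<zeta>(2) by auto
    moreover have "Q j x (q, r)"
      unfolding Q_def fst_conv snd_conv
    proof (intro conjI ballI)
      show "norm (vpoly q \<zeta> - vpoly (fst x) \<zeta>) < (1 / 2) ^ j" if "\<zeta> \<in> cball 0 (snd x)" for \<zeta>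
        using q(3)[OF that] half by linarith
      show "integral\<^sup>L circle_prob (\<lambda>t. (infdist (vpoly (fst x) (cis t)) (- D) / 2)\<^sup>2)
          \<le> 2 * (energy q - energy (fst x)) + (1 / 2) ^ j"
        using q(5) half by linarith
    qed (use q(1) in \<open>simp_all add: r_def\<close>)
    ultimately show "\<exists>y. P (Suc j) y \<and> Q j x y"
      by blast
  qed
  then obtain s where s: "\<And>j. P j (s j)" "\<And>j. Q j (s j) (s (Suc j))"
    by blast
  show thesis
    by (rule that[of "\<lambda>j. fst (s j)" "\<lambda>j. snd (s j)"]) (use s in \<open>auto simp: P_def Q_def\<close>)
qed

lemma vpoly_sequence_persistent:
  assumes "\<And>j. \<rho> j \<le> \<rho> (Suc j)" "\<And>j. \<rho> j < 1"
    and "\<And>j. \<exists>\<zeta>\<in>ball 0 (\<rho> j). dist (vpoly (p j) \<zeta>) (\<tau> j) < (1 / 2) ^ j"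
    and step: "\<And>j \<zeta>. \<zeta> \<in> cball 0 (\<rho> j) \<Longrightarrow> norm (vpoly (p (Suc j)) \<zeta> - vpoly (p j) \<zeta>) < (1 / 2) ^ j"
    and "\<And>J. \<exists>j\<ge>J. dist (\<tau> j) z < r / 4" "0 < r"
  obtains \<zeta> s where "0 < s" "ball \<zeta> s \<subseteq> ball 0 1"
    "eventually (\<lambda>m. \<forall>\<xi>\<in>ball \<zeta> s. vpoly (p m) \<xi> \<in> ball z r) sequentially"
proof -
  \<comment> \<open>The budget: \<open>r / 4\<close> from \<open>z\<close> to the target,
    \<open>r / 8\<close> from the target to the visit, and twice \<open>r / 8\<close> for all later
    steps together.\<close>
  obtain J where J: "(1 / 2) ^ J < r / 8"
    using real_arch_pow_inv[of "r / 8" "1 / 2"] assms(6) by auto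
  obtain j where j: "J \<le> j" "dist (\<tau> j) z < r / 4"
    using assms(5) by blast
  have jr: "(1 / 2) ^ j < r / 8"
  proof -
    have "(1 / 2 :: real) ^ j \<le> (1 / 2) ^ J"
      using j(1) by (intro power_decreasing) auto
    then show ?thesis
      using J by linarith
  qed
  obtain \<zeta> where \<zeta>: "\<zeta> \<in> ball 0 (\<rho> j)" "dist (vpoly (p j) \<zeta>) (\<tau> j) < (1 / 2) ^ j"
    using assms(3) by blast
  have "open (ball 0 (\<rho> j) \<inter> vpoly (p j) -` ball (\<tau> j) ((1 / 2) ^ j))"
    by (intro open_Int open_ball open_vimage continuous_on_vpoly)
  moreover have "\<zeta> \<in> ball 0 (\<rho> j) \<inter> vpoly (p j) -` ball (\<tau> j) ((1 / 2) ^ j)"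
    using \<zeta> by (simp add: dist_commute)
  ultimately obtain s where s: "0 < s"
    "ball \<zeta> s \<subseteq> ball 0 (\<rho> j) \<inter> vpoly (p j) -` ball (\<tau> j) ((1 / 2) ^ j)"
    unfolding open_contains_ball by blast
  have mono: "\<rho> j \<le> \<rho> m" if "j \<le> m" for m
    using that assms(1) by (rule lift_Suc_mono_le[rotated])
  have "vpoly (p m) \<xi> \<in> ball z r" if m: "j \<le> m" and \<xi>: "\<xi> \<in> ball \<zeta> s" for m \<xi>
  proof -
    \<comment> \<open>The geometric sum is kept exact, with the tail in \<open>m\<close> subtracted,
      so that the induction closes.\<close>
    have "norm (vpoly (p m) \<xi> - vpoly (p j) \<xi>) \<le> 2 * (1 / 2) ^ j - 2 * (1 / 2) ^ m"
      using m
    proof (induction m rule: dec_induct)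
      case (step n)
      have "\<xi> \<in> cball 0 (\<rho> n)"
        using \<xi> s(2) mono[OF step.hyps(1)] by force
      then have "norm (vpoly (p (Suc n)) \<xi> - vpoly (p n) \<xi>) < (1 / 2) ^ n"
        by (rule assms(4))
      then show ?case
        using step.IH norm_triangle_ineq[of "vpoly (p (Suc n)) \<xi> - vpoly (p n) \<xi>" "vpoly (p n) \<xi> - vpoly (p j) \<xi>"]
        by simp
    qed simp
    moreover have "0 < (1 / 2 :: real) ^ m"
      by simp
    ultimately have "dist (vpoly (p m) \<xi>) (vpoly (p j) \<xi>) < 2 * (1 / 2) ^ j"
      unfolding dist_norm by linarith
    moreover have "dist (vpoly (p j) \<xi>) (\<tau> j) < (1 / 2) ^ j"
      using \<xi> s(2) by (force simp: dist_commute)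
    ultimately have "dist (vpoly (p m) \<xi>) z < r"
      using j(2) jr dist_triangle[of "vpoly (p m) \<xi>" z "vpoly (p j) \<xi>"]
        dist_triangle[of "vpoly (p j) \<xi>" z "\<tau> j"] assms(6) by linarith
    then show ?thesis
      by (simp add: dist_commute)
  qed
  then have "eventually (\<lambda>m. \<forall>\<xi>\<in>ball \<zeta> s. vpoly (p m) \<xi> \<in> ball z r) sequentially"
    unfolding eventually_sequentially by blast
  moreover have "ball \<zeta> s \<subseteq> ball 0 1"
    using s(2) assms(2)[of j] by force
  ultimately show thesis
    using that s(1) by blast
qed

section \<open>Almost everywhere convergence of boundary values\<close>

lemma strict_mono_above:
  fixes N :: "nat \<Rightarrow> nat"
  obtains k where "strict_mono k" "\<And>i. N i \<le> k i"
proof (rule that[of "\<lambda>i. i + (\<Sum>l\<le>i. N l)"])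
  show "strict_mono (\<lambda>i. i + (\<Sum>l\<le>i. N l))"
    by (rule strict_mono_Suc_iff[THEN iffD2]) simp
  show "N i \<le> i + (\<Sum>l\<le>i. N l)" for i
    using member_le_sum[of i "{..i}" N] by simp
qed

text \<open>The elementary bound x \<le> 2^-i + 2^i x^2 turns mean squares of at most 4^-i into
  means of at most 2 * 2^-i. The norms of the increments then have a finite sum in mean, hence
  almost everywhere.\<close>

lemma AE_convergent_of_fast_L2:
  fixes X :: "nat \<Rightarrow> real \<Rightarrow> 'b::{banach, second_countable_topology}"
  assumes [measurable]: "\<And>i. X i \<in> borel_measurable borel"
    and int: "\<And>i. integrable circle_prob (\<lambda>t. (norm (X (Suc i) t - X i t))\<^sup>2)"
    and le: "\<And>i. integral\<^sup>L circle_prob (\<lambda>t. (norm (X (Suc i) t - X i t))\<^sup>2) \<le> (1 / 4) ^ i"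
  shows "AE t in circle_prob. convergent (\<lambda>i. X i t)"
proof -
  define g where "g i t = norm (X (Suc i) t - X i t)" for i t
  have g0: "0 \<le> g i t" for i t
    by (simp add: g_def)
  have [measurable]: "g i \<in> borel_measurable borel" for i
    unfolding g_def[abs_def] by measurable
  have g_le: "g i t \<le> (1 / 2) ^ i + 2 ^ i * (g i t)\<^sup>2" for i t
  proof (cases "g i t \<le> (1 / 2) ^ i")
    case False
    then have "1 \<le> 2 ^ i * g i t"
      by (simp add: power_one_over field_simps)
    then have "1 * g i t \<le> 2 ^ i * g i t * g i t"
      using g0 by (intro mult_right_mono)
    then show ?thesis
      by (simp add: power2_eq_square mult.assoc add_increasing)
  qed (simp add: add_increasing2)
  have nn: "(\<integral>\<^sup>+ t. ennreal (g i t) \<partial>circle_prob) \<le> ennreal (2 * (1 / 2) ^ i)" for i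
  proof -
    have int': "integrable circle_prob (\<lambda>t. (1 / 2) ^ i + 2 ^ i * (g i t)\<^sup>2)"
      using int[of i] by (simp add: g_def)
    have "(\<integral>\<^sup>+ t. ennreal (g i t) \<partial>circle_prob) \<le> (\<integral>\<^sup>+ t. ennreal ((1 / 2) ^ i + 2 ^ i * (g i t)\<^sup>2) \<partial>circle_prob)"
      by (intro nn_integral_mono ennreal_leI g_le)
    also have "\<dots> = ennreal (integral\<^sup>L circle_prob (\<lambda>t. (1 / 2) ^ i + 2 ^ i * (g i t)\<^sup>2))"
      using int' by (rule nn_integral_eq_integral) simp
    also have "\<dots> \<le> ennreal (2 * (1 / 2) ^ i)"
    proof (rule ennreal_leI)
      have "integral\<^sup>L circle_prob (\<lambda>t. (1 / 2) ^ i + 2 ^ i * (g i t)\<^sup>2)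
          = (1 / 2) ^ i + 2 ^ i * integral\<^sup>L circle_prob (\<lambda>t. (g i t)\<^sup>2)"
        using int[of i] by (simp add: g_def)
      also have "\<dots> \<le> (1 / 2) ^ i + 2 ^ i * (1 / 4) ^ i"
        using le[of i] by (simp add: g_def)
      also have "2 ^ i * (1 / 4) ^ i = (1 / 2 :: real) ^ i"
        by (simp flip: power_mult_distrib)
      finally show "integral\<^sup>L circle_prob (\<lambda>t. (1 / 2) ^ i + 2 ^ i * (g i t)\<^sup>2) \<le> 2 * (1 / 2) ^ i"
        by simp
    qed
    finally show ?thesis .
  qed
  have "(\<integral>\<^sup>+ t. (\<Sum>i. ennreal (g i t)) \<partial>circle_prob) = (\<Sum>i. \<integral>\<^sup>+ t. ennreal (g i t) \<partial>circle_prob)"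
    by (rule nn_integral_suminf) simp
  also have "\<dots> \<le> (\<Sum>i. ennreal (2 * (1 / 2) ^ i))"
    by (rule suminf_le[OF nn summableI summableI])
  also have "\<dots> < \<infinity>"
  proof -
    have "summable (\<lambda>i. 2 * (1 / 2 :: real) ^ i)"
      by (intro summable_mult summable_geometric) simp
    then have "(\<Sum>i. ennreal (2 * (1 / 2) ^ i)) \<noteq> top"
      by (rule ennreal_suminf_neq_top) simp
    then show ?thesis
      unfolding infinity_ennreal_def less_top .
  qed
  finally have "AE t in circle_prob. (\<Sum>i. ennreal (g i t)) \<noteq> \<infinity>"
    by (intro nn_integral_PInf_AE) auto
  then show ?thesis
  proof (eventually_elim)
    fix t assume "(\<Sum>i. ennreal (g i t)) \<noteq> \<infinity>"
    then have "summable (\<lambda>i. g i t)"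
      using g0 by (intro summable_suminf_not_top) auto
    then have "summable (\<lambda>i. X (Suc i) t - X i t)"
      unfolding g_def by (rule summable_norm_cancel)
    then have "convergent (\<lambda>n. \<Sum>i<n. X (Suc i) t - X i t)"
      by (simp add: summable_iff_convergent)
    then have "convergent (\<lambda>n. (\<Sum>i<n. X (Suc i) t - X i t) + X 0 t)"
      by (intro convergent_add convergent_const)
    then show "convergent (\<lambda>i. X i t)"
      by (simp add: sum_lessThan_telescope[of "\<lambda>i. X i t"])
  qed
qed

lemma borel_measurable_vpoly_cis [measurable]: "(\<lambda>t. vpoly p (cis t)) \<in> borel_measurable borel"
  by (intro borel_measurable_continuous_onI continuous_on_compose2[OF continuous_on_vpoly[of UNIV]]
      continuous_intros) auto

lemma vpoly_boundary_limit:
  fixes D :: "(complex ^ 'n) set"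
  assumes D: "open D" "D \<noteq> UNIV" "bounded D"
    and p: "\<And>j. vpoly (p j) ` cball 0 1 \<subseteq> D" "\<And>j. extends (p j) (p (Suc j))"
    and en: "\<And>j. integral\<^sup>L circle_prob (\<lambda>t. (infdist (vpoly (p j) (cis t)) (- D) / 2)\<^sup>2)
        \<le> 2 * (energy (p (Suc j)) - energy (p j)) + (1 / 2) ^ j"
  obtains k F where "strict_mono k" "F \<in> borel_measurable borel"
    "AE t in circle_prob. (\<lambda>i. vpoly (p (k i)) (cis t)) \<longlonglongrightarrow> F t"
    "AE t in circle_prob. F t \<in> frontier D"
proof -
  have pD: "vpoly (p j) (cis t) \<in> D" for j t
    using p(1)[of j] by auto
  obtain M where M: "\<And>x. x \<in> D \<Longrightarrow> norm x \<le> M"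
    using D(3) unfolding bounded_iff by blast
  have ext: "extends (p i) (p j)" if "i \<le> j" for i j
    using that by (induction j rule: dec_induct) (auto intro: extends_trans p(2))
  have inc: "incseq (\<lambda>j. energy (p j))"
    by (intro incseq_SucI extends_energy_mono p(2))
  have "energy (p j) \<le> M\<^sup>2" for j
  proof -
    have "continuous_on (sphere 0 1) (\<lambda>\<zeta>. (norm (vpoly (p j) \<zeta>))\<^sup>2)"
      by (intro continuous_intros)
    from integrable_circle[OF this]
    have "integral\<^sup>L circle_prob (\<lambda>t. (norm (vpoly (p j) (cis t)))\<^sup>2) \<le> integral\<^sup>L circle_prob (\<lambda>t. M\<^sup>2)"
      using M[OF pD] by (intro integral_mono power_mono) auto
    then show ?thesis
      by (simp add: parseval_vpoly)
  qed
  then obtain l where l: "(\<lambda>j. energy (p j)) \<longlonglongrightarrow> l" "\<And>j. energy (p j) \<le> l"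
    using incseq_convergent[OF inc] by metis
  \<comment> \<open>Energies within 4^-i of their limit give, through the orthogonality of
    increments, exactly the mean-square bound that forces convergence almost everywhere.\<close>
  have "\<exists>N. \<forall>n\<ge>N. l - (1 / 4) ^ i < energy (p n)" for i :: nat
    using order_tendstoD(1)[OF l(1), of "l - (1 / 4) ^ i"] by (simp add: eventually_sequentially)
  then obtain N where N: "\<And>i n. N i \<le> n \<Longrightarrow> l - (1 / 4) ^ i < energy (p n)"
    by metis
  obtain k where k: "strict_mono k" "\<And>i. N i \<le> k i"
    using strict_mono_above[of N] by metis
  define X where "X i t = vpoly (p (k i)) (cis t)" for i t
  have XD: "X i t \<in> D" for i t
    using pD by (simp add: X_def)
  have [measurable]: "X i \<in> borel_measurable borel" for i
    unfolding X_def[abs_def] by measurable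
  have "AE t in circle_prob. convergent (\<lambda>i. X i t)"
  proof (rule AE_convergent_of_fast_L2)
    show "integrable circle_prob (\<lambda>t. (norm (X (Suc i) t - X i t))\<^sup>2)" for i
      unfolding X_def by (rule integrable_norm_vpoly_diff)
    show "integral\<^sup>L circle_prob (\<lambda>t. (norm (X (Suc i) t - X i t))\<^sup>2) \<le> (1 / 4) ^ i" for i
    proof -
      have "k i \<le> k (Suc i)"
        using k(1) by (simp add: strict_mono_less_eq)
      then show ?thesis
        using extends_energy_diff[OF ext] N[OF k(2)[of i]] l(2)[of "k (Suc i)"] by (simp add: X_def)
    qed
  qed simp
  then have lim: "AE t in circle_prob. (\<lambda>i. X i t) \<longlonglongrightarrow> lim (\<lambda>i. X i t)"
    by eventually_elim (simp add: convergent_LIMSEQ_iff)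
  define F where "F t = lim (\<lambda>i. X i t)" for t
  have [measurable]: "F \<in> borel_measurable borel"
    unfolding F_def[abs_def] by measurable
  \<comment> \<open>Not a radius here, but the integrand of the energy estimate. It is continuous
    and is bounded on the bounded set \<open>D\<close>, so its means pass to the limit
    \<open>F\<close>; its zeros are the points outside \<open>D\<close>.\<close>
  define \<rho> where "\<rho> x = (infdist x (- D) / 2)\<^sup>2" for x
  have cont\<rho>: "continuous_on UNIV \<rho>"
    unfolding \<rho>_def by (intro continuous_intros continuous_on_infdist) auto
  then have [measurable]: "\<rho> \<in> borel_measurable borel"
    by (rule borel_measurable_continuous_onI)
  have "bounded (\<rho> ` closure D)"
    using D(3) by (intro compact_imp_bounded compact_continuous_image)
      (auto intro: continuous_on_subset[OF cont\<rho>])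
  then obtain B where B: "\<And>x. x \<in> D \<Longrightarrow> \<bar>\<rho> x\<bar> \<le> B"
    unfolding bounded_iff using closure_subset by (metis imageI real_norm_def subsetD)
  have conv\<rho>: "AE t in circle_prob. (\<lambda>i. \<rho> (X i t)) \<longlonglongrightarrow> \<rho> (F t)"
    using lim
  proof eventually_elim
    fix t assume "(\<lambda>i. X i t) \<longlonglongrightarrow> lim (\<lambda>i. X i t)"
    then show "(\<lambda>i. \<rho> (X i t)) \<longlonglongrightarrow> \<rho> (F t)"
      unfolding F_def using cont\<rho> by (intro isCont_tendsto_compose[of _ \<rho>]) (simp add: continuous_on_eq_continuous_at)
  qed
  have int\<rho>F: "integrable circle_prob (\<lambda>t. \<rho> (F t))"
    and "(\<lambda>i. integral\<^sup>L circle_prob (\<lambda>t. \<rho> (X i t))) \<longlonglongrightarrow> integral\<^sup>L circle_prob (\<lambda>t. \<rho> (F t))"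
  proof -
    have bound: "AE t in circle_prob. norm (\<rho> (X i t)) \<le> B" for i
      using B[OF XD] by (intro AE_I2) simp
    show "integrable circle_prob (\<lambda>t. \<rho> (F t))"
      by (rule integrable_dominated_convergence[where w = "\<lambda>_. B", OF _ _ _ conv\<rho> bound]) auto
    show "(\<lambda>i. integral\<^sup>L circle_prob (\<lambda>t. \<rho> (X i t))) \<longlonglongrightarrow> integral\<^sup>L circle_prob (\<lambda>t. \<rho> (F t))"
      by (rule integral_dominated_convergence[where w = "\<lambda>_. B", OF _ _ _ conv\<rho> bound]) auto
  qed
  moreover have "(\<lambda>i. integral\<^sup>L circle_prob (\<lambda>t. \<rho> (X i t))) \<longlonglongrightarrow> 0"
  proof (rule tendsto_sandwich[OF _ _ tendsto_const])
    show "eventually (\<lambda>i. 0 \<le> integral\<^sup>L circle_prob (\<lambda>t. \<rho> (X i t))) sequentially"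
      by (simp add: \<rho>_def)
    show "eventually (\<lambda>i. integral\<^sup>L circle_prob (\<lambda>t. \<rho> (X i t))
        \<le> 2 * (energy (p (Suc (k i))) - energy (p (k i))) + (1 / 2) ^ k i) sequentially"
      using en by (simp add: \<rho>_def X_def)
    \<comment> \<open>The estimate compares index \<open>k i\<close> with \<open>Suc (k i)\<close>
      and not with \<open>k (Suc i)\<close>; the limit is therefore taken along the full sequence
      first.\<close>
    have "(\<lambda>j. 2 * (energy (p (Suc j)) - energy (p j)) + (1 / 2) ^ j) \<longlonglongrightarrow> 2 * (l - l) + 0"
      by (intro tendsto_intros LIMSEQ_Suc l(1) LIMSEQ_realpow_zero) auto
    from LIMSEQ_subseq_LIMSEQ[OF this k(1)]
    show "(\<lambda>i. 2 * (energy (p (Suc (k i))) - energy (p (k i))) + (1 / 2) ^ k i) \<longlonglongrightarrow> 0"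
      by (simp add: o_def)
  qed
  ultimately have "integral\<^sup>L circle_prob (\<lambda>t. \<rho> (F t)) = 0"
    using LIMSEQ_unique by blast
  then have "AE t in circle_prob. \<rho> (F t) = 0"
    using int\<rho>F by (subst (asm) integral_nonneg_eq_0_iff_AE) (auto simp: \<rho>_def)
  then have fr: "AE t in circle_prob. F t \<in> frontier D"
    using lim
  proof eventually_elim
    fix t assume "\<rho> (F t) = 0" "(\<lambda>i. X i t) \<longlonglongrightarrow> lim (\<lambda>i. X i t)"
    then have "F t \<in> closure D"
      unfolding F_def closure_sequential using XD by (intro exI[of _ "\<lambda>i. X i t"]) simp
    moreover have "infdist (F t) (- D) = 0"
      using \<open>\<rho> (F t) = 0\<close> by (simp add: \<rho>_def)
    moreover have "- D \<noteq> {}" "closed (- D)"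
      using D(1,2) by auto
    ultimately show "F t \<in> frontier D"
      using D(1) in_closed_iff_infdist_zero[of "- D" "F t"] by (simp add: frontier_def interior_open)
  qed
  show thesis
    using that[OF k(1), of F] lim fr by (simp add: X_def F_def)
qed

section \<open>The universal leaf\<close>

text \<open>Continuous cutoffs decrease to the indicator of a closed set, so test integrals
  determine the measure of closed sets, and these generate the Borel sets and are stable under
  intersection.\<close>

lemma weak_limit_unique:
  assumes "weak_limit M \<mu>" "weak_limit M \<nu>"
  shows "\<mu> = \<nu>"
proof -
  note w = assms[unfolded weak_limit_def]
  have fin: "finite_measure \<mu>" "finite_measure \<nu>"
    by (rule w[THEN conjunct1])+
  have sets: "sets \<mu> = sets borel" "sets \<nu> = sets borel"
    by (rule w[THEN conjunct2, THEN conjunct1])+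
  have int_eq: "integral\<^sup>L \<mu> \<phi> = integral\<^sup>L \<nu> \<phi>"
    if "continuous_on UNIV \<phi>" "bounded (range \<phi>)" for \<phi> :: "'a \<Rightarrow> real"
    using w[THEN conjunct2, THEN conjunct2, rule_format, of \<phi>] that by (intro LIMSEQ_unique) simp_all
  have closed_eq: "emeasure \<mu> C = emeasure \<nu> C" if C: "closed C" for C
  proof (cases "C = {}")
    case False
    \<comment> \<open>The empty set is treated separately because \<open>infdist x {} = 0\<close>
      would make every cutoff equal to 1.\<close>
    define \<phi> where "\<phi> n x = max 0 (1 - real n * infdist x C)" for n x
    have cont: "continuous_on UNIV (\<phi> n)" for n
      unfolding \<phi>_def[abs_def] by (intro continuous_intros continuous_on_infdist)
    have le1: "\<bar>\<phi> n x\<bar> \<le> 1" for n x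
      by (auto simp: \<phi>_def infdist_nonneg abs_le_iff)
    have conv: "(\<lambda>n. \<phi> n x) \<longlonglongrightarrow> indicator C x" for x
    proof (cases "x \<in> C")
      case True
      then show ?thesis
        by (simp add: \<phi>_def)
    next
      case notin: False
      then have pos: "0 < infdist x C"
        using C False in_closed_iff_infdist_zero[of C x] infdist_nonneg[of x C] by linarith
      obtain N :: nat where N: "1 / infdist x C < real N"
        using reals_Archimedean2 by blast
      have "\<phi> n x = 0" if "N \<le> n" for n
      proof -
        have "1 \<le> real N * infdist x C"
          using N pos by (simp add: field_simps)
        also have "\<dots> \<le> real n * infdist x C"
          using that pos by (intro mult_right_mono) auto
        finally show ?thesis
          by (simp add: \<phi>_def)
      qed
      then have "eventually (\<lambda>n. \<phi> n x = indicator C x) sequentially"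
        using notin by (auto simp: eventually_sequentially)
      then show ?thesis
        by (rule tendsto_eventually)
    qed
    have lim: "(\<lambda>n. integral\<^sup>L \<kappa> (\<phi> n)) \<longlonglongrightarrow> measure \<kappa> C"
      if "finite_measure \<kappa>" "sets \<kappa> = sets borel" for \<kappa>
    proof -
      have meas: "\<phi> n \<in> borel_measurable \<kappa>" for n
        using borel_measurable_continuous_onI[OF cont[of n]] that(2) measurable_cong_sets by blast
      have C_meas: "C \<in> sets \<kappa>"
        using C that(2) by simp
      have "(\<lambda>n. integral\<^sup>L \<kappa> (\<phi> n)) \<longlonglongrightarrow> integral\<^sup>L \<kappa> (indicator C)"
      proof (rule integral_dominated_convergence[where w = "\<lambda>_. 1"])
        show "integrable \<kappa> (\<lambda>_. 1 :: real)"
          using that(1) by (simp add: finite_measure.integrable_const)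
        show "indicator C \<in> borel_measurable \<kappa>"
          using C_meas by simp
      qed (use meas conv le1 in simp_all)
      then show ?thesis
        using C_meas sets.Int_space_eq2[of C \<kappa>] by simp
    qed
    have "bounded (range (\<phi> n))" for n
      unfolding bounded_iff using le1 by auto
    then have "integral\<^sup>L \<mu> (\<phi> n) = integral\<^sup>L \<nu> (\<phi> n)" for n
      by (intro int_eq cont)
    then have "measure \<mu> C = measure \<nu> C"
      using lim[OF fin(1) sets(1)] lim[OF fin(2) sets(2)] by (simp add: LIMSEQ_unique)
    then show ?thesis
      using fin by (simp add: finite_measure.emeasure_eq_measure)
  qed simp
  show ?thesis
  proof (rule measure_eqI_generator_eq[where E = "Collect closed" and \<Omega> = UNIV and A = "\<lambda>_. UNIV"])
    show "Int_stable (Collect closed)"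
      by (auto simp: Int_stable_def)
    show "emeasure \<mu> X = emeasure \<nu> X" if "X \<in> Collect closed" for X
      using that closed_eq by simp
    show "sets \<mu> = sigma_sets UNIV (Collect closed)" "sets \<nu> = sigma_sets UNIV (Collect closed)"
      using sets by (simp_all add: borel_eq_closed)
    show "emeasure \<mu> UNIV \<noteq> \<infinity>"
      using finite_measure.emeasure_finite[OF fin(1)] by simp
  qed auto
qed

lemma leaf_measure_eqI:
  assumes "weak_limit (\<lambda>j. holomorphic_measure (L j)) \<mu>"
  shows "leaf_measure L = \<mu>"
  unfolding leaf_measure_def
proof (rule the_equality)
  show "\<nu> = \<mu>" if "weak_limit (\<lambda>j. holomorphic_measure (L j)) \<nu>" for \<nu>
    using that assms by (rule weak_limit_unique)
qed (rule assms)

lemma holomorphic_map_vpoly: "holomorphic_map (vpoly p)"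
  unfolding holomorphic_map_def vpoly_def by (auto intro!: holomorphic_intros)

lemma radial_limit_continuous:
  assumes "continuous_on UNIV f"
  shows "radial_limit f \<zeta> = f \<zeta>"
proof -
  have "((\<lambda>r. of_real r * \<zeta>) \<longlongrightarrow> of_real 1 * \<zeta>) (at_left 1)"
    by (intro tendsto_intros)
  then have "((\<lambda>r. f (of_real r * \<zeta>)) \<longlongrightarrow> f \<zeta>) (at_left 1)"
    using assms by (intro isCont_tendsto_compose[of _ f]) (simp_all add: continuous_on_eq_continuous_at)
  then show ?thesis
    unfolding radial_limit_def by (intro tendsto_Lim) (auto simp: trivial_limit_at_left_real)
qed

lemma holomorphic_measure_vpoly:
  "holomorphic_measure (vpoly p) = distr circle_prob borel (\<lambda>t. vpoly p (cis t))"
  unfolding holomorphic_measure_def by (simp add: radial_limit_continuous continuous_on_vpoly)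

lemma weak_limit_distr:
  fixes X :: "nat \<Rightarrow> real \<Rightarrow> 'b::{metric_space}"
  assumes X: "\<And>i. X i \<in> borel_measurable borel" and F: "F \<in> borel_measurable borel"
    and conv: "AE t in circle_prob. (\<lambda>i. X i t) \<longlonglongrightarrow> F t"
  shows "weak_limit (\<lambda>i. distr circle_prob borel (X i)) (distr circle_prob borel F)"
  unfolding weak_limit_def
proof (intro conjI allI impI)
  have X': "X i \<in> measurable circle_prob borel" for i
    using X[of i] by (simp cong: measurable_cong_sets)
  have F': "F \<in> measurable circle_prob borel"
    using F by (simp cong: measurable_cong_sets)
  show "finite_measure (distr circle_prob borel F)"
    by (rule finite_measure.finite_measure_distr[OF finite_measure_circle_prob F'])
  show "sets (distr circle_prob borel F) = sets borel"
    by simp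
  fix \<phi> :: "'b \<Rightarrow> real"
  assume \<phi>: "continuous_on UNIV \<phi> \<and> bounded (range \<phi>)"
  then obtain B where B: "\<And>x. norm (\<phi> x) \<le> B"
    unfolding bounded_iff by auto
  have m\<phi>: "\<phi> \<in> borel_measurable borel"
    using \<phi> by (intro borel_measurable_continuous_onI) simp
  have "(\<lambda>i. integral\<^sup>L circle_prob (\<lambda>t. \<phi> (X i t))) \<longlonglongrightarrow> integral\<^sup>L circle_prob (\<lambda>t. \<phi> (F t))"
  proof (rule integral_dominated_convergence[where w = "\<lambda>_. B"])
    show "(\<lambda>t. \<phi> (X i t)) \<in> borel_measurable circle_prob" for i
      using measurable_compose[OF X' m\<phi>] .
    show "(\<lambda>t. \<phi> (F t)) \<in> borel_measurable circle_prob"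
      using measurable_compose[OF F' m\<phi>] .
    show "AE t in circle_prob. (\<lambda>i. \<phi> (X i t)) \<longlonglongrightarrow> \<phi> (F t)"
      using conv
    proof eventually_elim
      fix t assume "(\<lambda>i. X i t) \<longlonglongrightarrow> F t"
      then show "(\<lambda>i. \<phi> (X i t)) \<longlonglongrightarrow> \<phi> (F t)"
        using \<phi> by (intro isCont_tendsto_compose[of _ \<phi>]) (simp_all add: continuous_on_eq_continuous_at)
    qed
  qed (use B in simp_all)
  then show "(\<lambda>i. integral\<^sup>L (distr circle_prob borel (X i)) \<phi>)
      \<longlonglongrightarrow> integral\<^sup>L (distr circle_prob borel F) \<phi>"
    by (simp add: integral_distr[OF X' m\<phi>] integral_distr[OF F' m\<phi>])
qed

text \<open>On the circle about 0 through \<zeta>, every admissible \<open>v\<close> exceeds 1 on an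
  arc inside the ball and is positive elsewhere, so \<open>v 0\<close> is at least the measure of
  that arc. This constant depends on the ball only.\<close>

lemma harmonic_measure_lower_bound:
  assumes "0 < s" "ball \<zeta> s \<subseteq> ball 0 1"
  obtains c where "0 < c" "\<And>E. ball \<zeta> s \<subseteq> E \<Longrightarrow> c \<le> harmonic_measure 0 E"
proof -
  define r where "r = cmod \<zeta>"
  define A where "A = {t. of_real r * cis t \<in> ball \<zeta> s}"
  have r: "0 \<le> r" "r < 1"
    using assms by (auto simp: r_def dest: subsetD[of _ _ \<zeta>])
  have "continuous_on UNIV (\<lambda>t. of_real r * cis t)"
    by (intro continuous_intros)
  then have "open A"
    unfolding A_def using open_vimage[OF open_ball] by (simp add: vimage_def)
  then have A_meas: "A \<in> sets circle_prob"
    by simp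
  have pos: "0 < emeasure circle_prob A"
    unfolding A_def by (rule circle_prob_ball_pos) (use assms in \<open>simp_all add: r_def\<close>)
  have le_one: "emeasure circle_prob A \<le> 1"
    using emeasure_mono[of A UNIV circle_prob] by simp
  have "enn2ereal (emeasure circle_prob A) \<le> harmonic_measure 0 E" if E: "ball \<zeta> s \<subseteq> E" for E
    unfolding harmonic_measure_def
  proof (rule Inf_greatest)
    fix x
    assume "x \<in> {v 0 |v. superharmonic_on (ball 0 1) v \<and> (\<forall>z\<in>ball 0 1. 0 < v z) \<and>
      continuous_on E v \<and> (\<forall>z\<in>E. 1 < v z)}"
    then obtain v where v: "x = v 0" "superharmonic_on (ball 0 1) v" "\<And>z. z \<in> ball 0 1 \<Longrightarrow> 0 < v z"
      "\<And>z. z \<in> E \<Longrightarrow> 1 < v z"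
      by blast
    show "enn2ereal (emeasure circle_prob A) \<le> x"
    proof (cases "r = 0")
      \<comment> \<open>For a ball centred at 0 the circle degenerates and has no mean value
        inequality, but then 0 itself lies in \<open>E\<close>.\<close>
      case True
      then have "0 \<in> E"
        using E assms(1) by (auto simp: r_def)
      then have "1 < x"
        using v by simp
      moreover have "enn2ereal (emeasure circle_prob A) \<le> 1"
        using le_one by (simp add: less_eq_ennreal.rep_eq one_ennreal.rep_eq)
      ultimately show ?thesis
        by simp
    next
      case False
      have in_disc: "of_real r * cis t \<in> ball 0 1" for t
        using r by (simp add: norm_mult)
      have "cball 0 r \<subseteq> ball (0::complex) 1"
        using r by (simp add: cball_subset_ball_iff)
      then have "- v 0 \<le> circle_mean (\<lambda>z. - v z) 0 r"
        using v(2) r(1) False unfolding superharmonic_on_def subharmonic_on_def by auto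
      also have "\<dots> = - enn2ereal (\<integral>\<^sup>+ t. e2ennreal (v (of_real r * cis t)) \<partial>circle_prob)"
      proof -
        have "e2ennreal (- v (of_real r * cis t)) = 0" for t
          using v(3)[OF in_disc[of t]] by (intro e2ennreal_neg) (simp add: ereal_uminus_le_0_iff)
        then show ?thesis
          by (simp add: circle_mean_def zero_ennreal.rep_eq)
      qed
      finally have "enn2ereal (\<integral>\<^sup>+ t. e2ennreal (v (of_real r * cis t)) \<partial>circle_prob) \<le> v 0"
        by simp
      moreover have "emeasure circle_prob A \<le> (\<integral>\<^sup>+ t. e2ennreal (v (of_real r * cis t)) \<partial>circle_prob)"
      proof -
        have "emeasure circle_prob A = (\<integral>\<^sup>+ t. indicator A t \<partial>circle_prob)"
          using A_meas by simp
        also have "\<dots> \<le> (\<integral>\<^sup>+ t. e2ennreal (v (of_real r * cis t)) \<partial>circle_prob)"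
        proof (rule nn_integral_mono)
          fix t
          have "e2ennreal 1 \<le> e2ennreal (v (of_real r * cis t))" if "t \<in> A"
            using that v(4)[of "of_real r * cis t"] E by (intro e2ennreal_mono) (auto simp: A_def)
          then show "indicator A t \<le> e2ennreal (v (of_real r * cis t))"
            by (auto simp: indicator_def one_ennreal_def)
        qed
        finally show ?thesis .
      qed
      ultimately show ?thesis
        unfolding v(1) by (metis less_eq_ennreal.rep_eq order_trans)
    qed
  qed
  moreover have "0 < enn2ereal (emeasure circle_prob A)"
    using pos by (simp add: less_ennreal.rep_eq zero_ennreal.rep_eq)
  ultimately show thesis
    using that by blast
qed

lemma universal_leaf:
  fixes D :: "(complex ^ 'n) set"
  assumes "domain_set D" "bounded D"
  obtains L :: "'n map_seq" where "perfect_leaf L" "D \<subseteq> cluster L" "leaf_supp L \<subseteq> frontier D"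
proof -
  have D: "open D" "connected D" "D \<noteq> {}"
    using assms(1) by (simp_all add: domain_set_def)
  have "D \<noteq> UNIV"
    using assms(2) not_bounded_UNIV[where 'a = "complex ^ 'n"] by blast
  note D = D this
  obtain \<tau> :: "nat \<Rightarrow> complex ^ 'n" where \<tau>: "\<And>j. \<tau> j \<in> D" "\<forall>z\<in>D. \<forall>r>0. \<forall>J. \<exists>j\<ge>J. dist (\<tau> j) z < r"
    by (rule recurrent_dense_sequence[OF D(1,3)], rule that, assumption+)
  obtain p \<rho> where p: "\<And>j. vpoly (p j) ` cball 0 1 \<subseteq> D" "\<And>j. extends (p j) (p (Suc j))"
    "\<And>j. \<rho> j < 1" "\<And>j. \<rho> j \<le> \<rho> (Suc j)"
    "\<And>j. \<exists>\<zeta>\<in>ball 0 (\<rho> j). dist (vpoly (p j) \<zeta>) (\<tau> j) < (1 / 2) ^ j"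
    "\<And>j \<zeta>. \<zeta> \<in> cball 0 (\<rho> j) \<Longrightarrow> norm (vpoly (p (Suc j)) \<zeta> - vpoly (p j) \<zeta>) < (1 / 2) ^ j"
    "\<And>j. integral\<^sup>L circle_prob (\<lambda>t. (infdist (vpoly (p j) (cis t)) (- D) / 2)\<^sup>2)
        \<le> 2 * (energy (p (Suc j)) - energy (p j)) + (1 / 2) ^ j"
    by (rule vpoly_sequence[OF D(1,2,4) \<tau>(1)], rule that, assumption+)
  obtain k F where kF: "strict_mono k" "F \<in> borel_measurable borel"
    "AE t in circle_prob. (\<lambda>i. vpoly (p (k i)) (cis t)) \<longlonglongrightarrow> F t"
    "AE t in circle_prob. F t \<in> frontier D"
    by (rule vpoly_boundary_limit[OF D(1,4) assms(2) p(1,2,7)], rule that, assumption+)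
  define L where "L i = vpoly (p (k i))" for i
  define \<mu> where "\<mu> = distr circle_prob borel F"
  have L_D: "L i \<zeta> \<in> D" if "\<zeta> \<in> ball 0 1" for i \<zeta>
    using p(1)[of "k i"] that by (auto simp: L_def)
  \<comment> \<open>One fixed ball serves all late indices. The lower bound for harmonic measure
    uses the whole ball, the inclusion in the cluster only its centre.\<close>
  have persistent: "\<exists>\<zeta> s. 0 < s \<and> ball \<zeta> s \<subseteq> ball 0 1 \<and>
      eventually (\<lambda>i. \<forall>\<xi>\<in>ball \<zeta> s. L i \<xi> \<in> ball z r) sequentially" if z: "z \<in> D" "0 < r" for z r
  proof -
    have near: "\<exists>j\<ge>J. dist (\<tau> j) z < r / 4" for J
      using \<tau>(2)[rule_format, of z "r / 4"] z by simp
    obtain \<zeta> s where \<zeta>s: "0 < s" "ball \<zeta> s \<subseteq> ball 0 1"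
      "eventually (\<lambda>m. \<forall>\<xi>\<in>ball \<zeta> s. vpoly (p m) \<xi> \<in> ball z r) sequentially"
      by (rule vpoly_sequence_persistent[of \<rho> p \<tau> z r]) (assumption | rule p near z(2) that)+
    from eventually_subseq[OF kF(1) \<zeta>s(3)] \<zeta>s(1,2) show ?thesis
      unfolding L_def by blast
  qed
  have weak: "weak_limit (\<lambda>j. holomorphic_measure (L j)) \<mu>"
    unfolding L_def holomorphic_measure_vpoly \<mu>_def by (rule weak_limit_distr[OF _ kF(2,3)]) simp
  have "leaf L"
    unfolding leaf_def
  proof (intro conjI allI)
    show "holomorphic_map (L j)" for j
      by (simp add: L_def holomorphic_map_vpoly)
    show "\<exists>M. \<forall>j. \<forall>\<zeta>\<in>ball 0 1. norm (L j \<zeta>) \<le> M"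
      using assms(2) L_D unfolding bounded_iff by blast
    show "\<exists>\<mu>. weak_limit (\<lambda>j. holomorphic_measure (L j)) \<mu>"
      using weak by blast
  qed
  have "\<not> nonessential L z" if z: "z \<in> cluster L" for z
  proof
    assume "nonessential L z"
    then obtain r where r: "0 < r"
      "(\<lambda>j. harmonic_measure 0 {\<zeta> \<in> ball 0 1. L j \<zeta> \<in> ball z r}) \<longlonglongrightarrow> 0"
      unfolding nonessential_def by blast
    \<comment> \<open>A cluster point may lie on the frontier of \<open>D\<close>, where no visit
      was arranged. A value of the leaf close to it lies in \<open>D\<close>, and persistence is
      applied to that value instead.\<close>
    obtain j \<zeta> where "\<And>i. \<zeta> i \<in> ball 0 1" "(\<lambda>i. L (j i) (\<zeta> i)) \<longlonglongrightarrow> z"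
      using z unfolding cluster_def by blast
    then have "eventually (\<lambda>i. L (j i) (\<zeta> i) \<in> ball z r) sequentially"
      using r(1) by (intro topological_tendstoD) auto
    then obtain i where "L (j i) (\<zeta> i) \<in> ball z r"
      using eventually_happens'[OF sequentially_bot] by blast
    then have "L (j i) (\<zeta> i) \<in> D \<inter> ball z r"
      using L_D \<open>\<And>i. \<zeta> i \<in> ball 0 1\<close> by blast
    then obtain z' where z': "z' \<in> D" "z' \<in> ball z r"
      by blast
    then obtain r' where r': "0 < r'" "ball z' r' \<subseteq> ball z r"
      using open_contains_ball[of "ball z r"] by blast
    obtain \<zeta>' s where \<zeta>': "0 < s" "ball \<zeta>' s \<subseteq> ball 0 1"
      "eventually (\<lambda>i. \<forall>\<xi>\<in>ball \<zeta>' s. L i \<xi> \<in> ball z' r') sequentially"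
      using persistent[OF z'(1) r'(1)] by blast
    obtain c where c: "0 < c" "\<And>E. ball \<zeta>' s \<subseteq> E \<Longrightarrow> c \<le> harmonic_measure 0 E"
      using harmonic_measure_lower_bound[OF \<zeta>'(1,2)] by blast
    have "eventually (\<lambda>i. c \<le> harmonic_measure 0 {\<zeta> \<in> ball 0 1. L i \<zeta> \<in> ball z r}) sequentially"
      using \<zeta>'(3)
    proof eventually_elim
      fix i assume "\<forall>\<xi>\<in>ball \<zeta>' s. L i \<xi> \<in> ball z' r'"
      then show "c \<le> harmonic_measure 0 {\<zeta> \<in> ball 0 1. L i \<zeta> \<in> ball z r}"
        using \<zeta>'(2) r'(2) by (intro c(2)) blast
    qed
    moreover have "eventually (\<lambda>i. harmonic_measure 0 {\<zeta> \<in> ball 0 1. L i \<zeta> \<in> ball z r} < c) sequentially"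
      using order_tendstoD(2)[OF r(2) c(1)] .
    ultimately have "eventually (\<lambda>i. False) sequentially"
      by eventually_elim simp
    then show False
      by simp
  qed
  then have "perfect_leaf L"
    using \<open>leaf L\<close> by (simp add: perfect_leaf_def)
  moreover have "D \<subseteq> cluster L"
  proof
    fix z assume z: "z \<in> D"
    \<comment> \<open>The visiting point depends on the accuracy and works from some index on;
      strictly increasing indices beyond these thresholds yield the subsequence that
      \<open>cluster\<close> asks for.\<close>
    have "\<exists>\<zeta> N. \<zeta> \<in> ball 0 1 \<and> (\<forall>i\<ge>N. dist (L i \<zeta>) z < 1 / real (Suc m))" for m
    proof -
      obtain \<zeta> s where \<zeta>: "0 < s" "ball \<zeta> s \<subseteq> ball 0 1"
        "eventually (\<lambda>i. \<forall>\<xi>\<in>ball \<zeta> s. L i \<xi> \<in> ball z (1 / real (Suc m))) sequentially"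
        using persistent[OF z, of "1 / real (Suc m)"] by auto
      have "\<zeta> \<in> ball \<zeta> s"
        using \<zeta>(1) by simp
      moreover have "eventually (\<lambda>i. dist (L i \<zeta>) z < 1 / real (Suc m)) sequentially"
        using \<zeta>(3) by eventually_elim (use \<open>\<zeta> \<in> ball \<zeta> s\<close> in \<open>auto simp: dist_commute\<close>)
      ultimately show ?thesis
        using \<zeta>(2) unfolding eventually_sequentially by blast
    qed
    then obtain \<zeta> N where \<zeta>N: "\<And>m. \<zeta> m \<in> ball 0 1"
      "\<And>m i. N m \<le> i \<Longrightarrow> dist (L i (\<zeta> m)) z < 1 / real (Suc m)"
      by metis
    obtain j where j: "strict_mono j" "\<And>m. N m \<le> j m"
      using strict_mono_above[of N] by metis
    have "(\<lambda>m. L (j m) (\<zeta> m)) \<longlonglongrightarrow> z"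
    proof (rule metric_LIMSEQ_I)
      fix e :: real assume "0 < e"
      then obtain M where M: "1 / real (Suc M) < e"
        using nat_approx_posE by blast
      have "dist (L (j m) (\<zeta> m)) z < e" if "M \<le> m" for m
      proof -
        have "1 / real (Suc m) \<le> 1 / real (Suc M)"
          using that by (intro divide_left_mono) auto
        then show ?thesis
          using \<zeta>N(2)[OF j(2)[of m]] M by linarith
      qed
      then show "\<exists>M. \<forall>m\<ge>M. dist (L (j m) (\<zeta> m)) z < e"
        by blast
    qed
    then show "z \<in> cluster L"
      unfolding cluster_def using j(1) \<zeta>N(1) by blast
  qed
  moreover have "leaf_supp L \<subseteq> frontier D"
  proof
    fix x assume "x \<in> leaf_supp L"
    then have x: "\<And>V. open V \<Longrightarrow> x \<in> V \<Longrightarrow> 0 < emeasure \<mu> V"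
      by (simp add: leaf_supp_def measure_support_def leaf_measure_eqI[OF weak])
    show "x \<in> frontier D"
    proof (rule ccontr)
      assume "x \<notin> frontier D"
      then have "0 < emeasure \<mu> (- frontier D)"
        by (intro x) auto
      moreover have "emeasure \<mu> (- frontier D) = emeasure circle_prob (F -` (- frontier D))"
        unfolding \<mu>_def using kF(2) by (subst emeasure_distr) (auto cong: measurable_cong_sets)
      moreover have "emeasure circle_prob (F -` (- frontier D)) = 0"
      proof -
        have "F -` (- frontier D) \<inter> space borel \<in> sets borel"
          using kF(2) by (rule measurable_sets) auto
        then show ?thesis
          using kF(4) by (subst (asm) AE_iff_measurable[where N = "F -` (- frontier D)"]) auto
      qed
      ultimately show False
        by simp
    qed
  qed
  ultimately show thesis
    by (rule that)
qed

text \<open>Maximality on the cluster admits competitors on domains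
  \<open>H \<subset>\<subset> D\<close> only, so a competitor on \<open>D\<close> has to be
  restricted to a domain between \<open>G\<close> and \<open>D\<close>. A union of balls centred in
  \<open>closure G\<close> is connected because every ball meets the connected set
  \<open>closure G\<close>.\<close>

lemma domain_between:
  fixes D G :: "'a::euclidean_space set"
  assumes "domain_set G" "domain_set D" "G \<subset>\<subset> D"
  obtains H where "domain_set H" "G \<subset>\<subset> H" "H \<subset>\<subset> D"
proof -
  let ?K = "closure G"
  have K: "compact ?K" "?K \<subseteq> D" "?K \<noteq> {}" "connected ?K"
    using assms by (auto simp: rel_compact_in_def domain_set_def connected_imp_connected_closure)
  obtain e where e: "0 < e" "(\<Union>x\<in>?K. cball x e) \<subseteq> D"
    using compact_subset_open_imp_cball_epsilon_subset[OF K(1) _ K(2)] assms(2) by (auto simp: domain_set_def)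
  define H where "H = (\<Union>x\<in>?K. ball x e)"
  have KH: "?K \<subseteq> H"
    using e(1) by (auto simp: H_def)
  have "connected (\<Union>x\<in>?K. ?K \<union> ball x e)"
  proof (rule connected_Union)
    show "connected S" if "S \<in> (\<lambda>x. ?K \<union> ball x e) ` ?K" for S
    proof -
      obtain x where "x \<in> ?K" "S = ?K \<union> ball x e"
        using \<open>S \<in> _\<close> by blast
      then show ?thesis
        using K(4) e(1) by (auto intro!: connected_Un)
    qed
    show "\<Inter> ((\<lambda>x. ?K \<union> ball x e) ` ?K) \<noteq> {}"
      using K(3) by blast
  qed
  moreover have "(\<Union>x\<in>?K. ?K \<union> ball x e) = H"
    using KH K(3) by (auto simp: H_def)
  ultimately have "connected H"
    by simp
  moreover have "open H"
    by (auto simp: H_def)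
  moreover have "H \<noteq> {}"
    using KH K(3) by auto
  ultimately have "domain_set H"
    by (simp add: domain_set_def)
  moreover have "G \<subset>\<subset> H"
    using K(1) KH by (simp add: rel_compact_in_def)
  moreover have "H \<subset>\<subset> D"
  proof -
    \<comment> \<open>The compact closed neighbourhood contains the closure of \<open>H\<close>; it
      lies in \<open>D\<close> because \<open>e\<close> was chosen for closed balls.\<close>
    define C where "C = {x. infdist x ?K \<le> e}"
    have "compact C"
      unfolding C_def by (rule compact_infdist_le[OF K(3,1) e(1)])
    have "H \<subseteq> C"
      unfolding H_def C_def by (auto simp: dist_commute intro: infdist_le2 less_imp_le)
    then have "closure H \<subseteq> C"
      using \<open>compact C\<close> by (intro closure_minimal compact_imp_closed)
    moreover have "C \<subseteq> D"
    proof
      fix y assume "y \<in> C"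
      moreover obtain x where "x \<in> ?K" "infdist y ?K = dist y x"
        using infdist_attains_inf[OF closed_closure K(3)] by blast
      ultimately show "y \<in> D"
        using e(2) by (force simp: C_def dist_commute)
    qed
    ultimately show ?thesis
      unfolding rel_compact_in_def using \<open>compact C\<close> compact_Int_closed[of C "closure H"]
      by (auto simp: Int_absorb1)
  qed
  ultimately show thesis
    by (rule that)
qed

theorem theorem6p3:
  fixes D :: "(complex ^ 'n) set" and u :: "complex ^ 'n \<Rightarrow> real"
  assumes "strongly_pseudoconvex D"
    and "continuous_on D u"
    and "psh_on D (\<lambda>z. ereal (u z))"
  shows "maximal_psh_on D (\<lambda>z. ereal (u z)) \<longleftrightarrow>
    (\<forall>z\<in>D. \<exists>L :: 'n map_seq. perfect_leaf L \<and> z \<in> cluster L \<and>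
       maximal_on_cluster D L (\<lambda>z. ereal (u z)) \<and>
       leaf_supp L \<subseteq> frontier D)"
proof
  have D: "domain_set D" "bounded D"
    using assms(1) by (auto simp: strongly_pseudoconvex_def)
  {
    assume max: "maximal_psh_on D (\<lambda>z. ereal (u z))"
    obtain L :: "'n map_seq" where L: "perfect_leaf L" "D \<subseteq> cluster L" "leaf_supp L \<subseteq> frontier D"
      by (rule universal_leaf[OF D])
    have "maximal_on_cluster D L (\<lambda>z. ereal (u z))"
      using D(1) assms(2) max L(2)
      by (intro maximal_psh_imp_maximal_on_cluster) (simp_all add: domain_set_def)
    then show "\<forall>z\<in>D. \<exists>L :: 'n map_seq. perfect_leaf L \<and> z \<in> cluster L \<and>
       maximal_on_cluster D L (\<lambda>z. ereal (u z)) \<and> leaf_supp L \<subseteq> frontier D"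
      using L by blast
  next
    assume leaves: "\<forall>z\<in>D. \<exists>L :: 'n map_seq. perfect_leaf L \<and> z \<in> cluster L \<and>
       maximal_on_cluster D L (\<lambda>z. ereal (u z)) \<and> leaf_supp L \<subseteq> frontier D"
    show "maximal_psh_on D (\<lambda>z. ereal (u z))"
      unfolding maximal_psh_on_def
    proof (intro conjI allI impI ballI assms(3))
      fix G v z
      assume G: "domain_set G \<and> G \<subset>\<subset> D \<and> psh_on D v \<and> (\<forall>z\<in>frontier G. v z \<le> ereal (u z))"
        and z: "z \<in> G"
      then obtain H where H: "domain_set H" "G \<subset>\<subset> H" "H \<subset>\<subset> D"
        using domain_between D(1) by blast
      have "closure H \<subseteq> D"
        using H(3) by (simp add: rel_compact_in_def)
      then have "H \<subseteq> D"
        using closure_subset by blast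
      then have "psh_on H v"
        using G D(1) H(1) by (intro psh_on_subset[of D v H]) (simp_all add: domain_set_def)
      moreover have "z \<in> D"
        using G z closure_subset unfolding rel_compact_in_def by blast
      then obtain L :: "'n map_seq" where "z \<in> cluster L" "maximal_on_cluster D L (\<lambda>z. ereal (u z))"
        using leaves by blast
      ultimately show "v z \<le> ereal (u z)"
        using G H z unfolding maximal_on_cluster_def by blast
    qed
  }
qed

end
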